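(* Let $X$ be a finite biquandle, let $S_\ast:\ \emptyset=S_0\subseteq S_1\subseteq\cdots\subseteq S_m$ be a filtration of $\mathrm{End}(X)$, and let $N\ge1$. Then the persistent $N$-directed clique homology barcode $\mathcal P^{(N)}(L;X,S_\ast)$ is an invariant of links; that is, if $L_1$ and $L_2$ are virtually equivalent oriented virtual link diagrams, then $\mathcal P^{(N)}(L_1;X,S_\ast)=\mathcal P^{(N)}(L_2;X,S_\ast)$.
   Context: **Links.** A virtual link diagram is an immersion of finitely many circles in the plane with finitely many transversal double points, each being either a classical crossing (with over/under information) or a virtual crossing (no over/under information). Diagrams are oriented. "Link" means oriented virtual link: an equivalence class of oriented virtual link diagrams under virtual equivalence, i.e. planar isotopy and the generalized Reidemeister moves: the classical Reidemeister moves R1, R2, R3 (on classical crossings), the virtual Reidemeister moves (the analogues of R1, R2, R3 with all crossings virtual), and the mixed move (an arc having two consecutive virtual crossings is moved across a classical crossing). A semi-arc is a segment of the diagram between two consecutive classical crossings (it may pass through virtual crossings; a component with no classical crossing is one semi-arc). **Biquandles.** A biquandle is a set $X$ with operations $\underline{\triangleright},\overline{\triangleright}:X\times X\to X$ such that for all $x,y,z\in X$: (1) $x\,\underline{\triangleright}\,x=x\,\overline{\triangleright}\,x$; (2) the maps $\alpha_y(x)=x\,\overline{\triangleright}\,y$, $\beta_y(x)=x\,\underline{\triangleright}\,y$ on $X$ and $S(x,y)=(y\,\overline{\triangleright}\,x,\;x\,\underline{\triangleright}\,y)$ on $X\times X$ are invertible; (3) $(x\underline{\triangleright}y)\underline{\triangleright}(z\underline{\triangleright}y)=(x\underline{\triangleright}z)\underline{\triangleright}(y\overline{\triangleright}z)$,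 $(x\underline{\triangleright}y)\overline{\triangleright}(z\underline{\triangleright}y)=(x\overline{\triangleright}z)\underline{\triangleright}(y\overline{\triangleright}z)$, $(x\overline{\triangleright}y)\overline{\triangleright}(z\overline{\triangleright}y)=(x\overline{\triangleright}z)\overline{\triangleright}(y\underline{\triangleright}z)$. $\mathrm{End}(X)$ is the set of maps $X\to X$ preserving both operations. **Colorings.** An $X$-coloring of a diagram $L$ is a labeling $f$ of the semi-arcs of $L$ by elements of $X$ such that at each classical crossing: if $x$ is the label of the semi-arc of the under-strand lying to the right of the (oriented) over-strand, and $y$ is the label of the semi-arc of the over-strand lying to the right of the (oriented) under-strand, then the other semi-arc of the under-strand (to the left of the over-strand) is labeled $x\,\underline{\triangleright}\,y$ and the other semi-arc of the over-strand (to the left of the under-strand) is labeled $y\,\overline{\triangleright}\,x$. Labels do not change at virtual crossings. $\mathrm{Col}_X(L)$ is the set of $X$-colorings. For $\alpha\in\mathrm{End}(X)$ and $f\in\mathrm{Col}_X(L)$, $\alpha\circ f\in \mathrm{Col}_X(L)$. **Coloring quiver.** A quiver is a directed graph, possibly with loops and multiple edges; $e_{\mathcal Q}(u,v)$ is the number of edges from $u$ to $v$ in $\mathcal Q$. For $S\subseteq\mathrm{End}(X)$, the $X$-coloring quiver $\mathcal Q_X^S(L)$ has vertex set $\{v_f: f\in\mathrm{Col}_X(L)\}$ and, for each $f$ and each $\alpha\in S$, one edge $v_f\to v_{\alpha\circ f}$; thus $e(v_f,v_g)=|\{\alpha\in S:\alpha\circ f=g\}|$. **$N$-directed clique homology.**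 For a finite quiver $\mathcal Q$ with vertex set $V$ and $N\ge1$, the $N$-directed clique complex $\mathcal K^{(N)}(\mathcal Q)$ is the abstract ordered simplicial complex (collection of finite lists of distinct vertices closed under taking sublists) with $K_0^{(N)}(\mathcal Q)=\{(v):v\in V\}$ and, for $n>0$, $K_n^{(N)}(\mathcal Q)=\{(v_0,\dots,v_n): v_i\ne v_j \text{ and } e_{\mathcal Q}(v_i,v_j)\ge N\text{ for all } i<j\}$. Its chain group $C_n$ is the free abelian group on $K_n^{(N)}(\mathcal Q)$, with $\partial_n(v_0,\dots,v_n)=\sum_{i=0}^n(-1)^i(v_0,\dots,\widehat{v_i},\dots,v_n)$ (and $\partial_0=0$), and $H_n^{(N)}(\mathcal Q)=\ker\partial_n/\operatorname{im}\partial_{n+1}$. Define $H_n^{(N)}(L;X,S):=H_n^{(N)}(\mathcal Q_X^S(L))$. **Persistence.** A filtration $S_\ast$ of $\mathrm{End}(X)$ is a nested sequence of subsets $S_0\subseteq\cdots\subseteq S_m$ of $\mathrm{End}(X)$; it is not required that $S_m=\mathrm{End}(X)$. For $i\le j$, $\mathcal K^{(N)}(\mathcal Q_X^{S_i}(L))$ is a subcomplex of $\mathcal K^{(N)}(\mathcal Q_X^{S_j}(L))$, and the persistent homology group $H_n^{(N),i,j}(L;X,S_\ast)$ is the image of the inclusion-induced map $H_n^{(N)}(L;X,S_i)\to H_n^{(N)}(L;X,S_j)$. **Barcode.** The barcode $\mathcal P^{(N)}(L;X,S_\ast)$ is the multiset (recorded for each dimension $n\ge0$) of persistence intervals $[i,j)$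 determined by the persistent homology groups, where $i$ is the birth index and $j\in\{i+1,\dots,m\}\cup\{\infty\}$ the death index ($\infty$ if the class survives to the last stage). Explicitly, with $\beta_n^{i,j}=\operatorname{rank}H_n^{(N),i,j}(L;X,S_\ast)$ and $\beta_n^{-1,j}=0$, the multiplicity of $[i,j)$ in dimension $n$ is $\beta_n^{i,j-1}-\beta_n^{i,j}-\beta_n^{i-1,j-1}+\beta_n^{i-1,j}$ for $0\le i<j\le m$, and the multiplicity of $[i,\infty)$ is $\beta_n^{i,m}-\beta_n^{i-1,m}$. *)

theory Defs
  imports
    "HOL-Analysis.Analysis"
    "HOL-Algebra.Free_Abelian_Groups"
    "HOL-Library.Extended_Nat"
    "HOL-Library.Multiset"
    "Graph_Theory.Digraph"
begin

section \<open>Biquandles\<close>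

record 'a biquandle_ops = "'a partial_object" +
  under_op :: "'a \<Rightarrow> 'a \<Rightarrow> 'a" (infixl \<open>\<unrhd>\<index>\<close> 70)
  over_op :: "'a \<Rightarrow> 'a \<Rightarrow> 'a" (infixl \<open>\<rhd>\<index>\<close> 70)

text \<open>The symbol \<open>\<unrhd>\<close> is the underlined triangle, \<open>\<rhd>\<close> the overlined one.\<close>

locale biquandle =
  fixes X :: "('a, 'm) biquandle_ops_scheme" (structure)
  assumes under_closed: "\<lbrakk>x \<in> carrier X; y \<in> carrier X\<rbrakk> \<Longrightarrow> x \<unrhd> y \<in> carrier X"
    and over_closed: "\<lbrakk>x \<in> carrier X; y \<in> carrier X\<rbrakk> \<Longrightarrow> x \<rhd> y \<in> carrier X"
    and diagonal: "x \<in> carrier X \<Longrightarrow> x \<unrhd> x = x \<rhd> x"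
    and over_bij: "y \<in> carrier X \<Longrightarrow> bij_betw (\<lambda>x. x \<rhd> y) (carrier X) (carrier X)"
    and under_bij: "y \<in> carrier X \<Longrightarrow> bij_betw (\<lambda>x. x \<unrhd> y) (carrier X) (carrier X)"
    and switch_bij: "bij_betw (\<lambda>(x, y). (y \<rhd> x, x \<unrhd> y))
                       (carrier X \<times> carrier X) (carrier X \<times> carrier X)"
    and exchange_under: "\<lbrakk>x \<in> carrier X; y \<in> carrier X; z \<in> carrier X\<rbrakk> \<Longrightarrow>
          (x \<unrhd> y) \<unrhd> (z \<unrhd> y) = (x \<unrhd> z) \<unrhd> (y \<rhd> z)"
    and exchange_mixed: "\<lbrakk>x \<in> carrier X; y \<in> carrier X; z \<in> carrier X\<rbrakk> \<Longrightarrow>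
          (x \<unrhd> y) \<rhd> (z \<unrhd> y) = (x \<rhd> z) \<unrhd> (y \<rhd> z)"
    and exchange_over: "\<lbrakk>x \<in> carrier X; y \<in> carrier X; z \<in> carrier X\<rbrakk> \<Longrightarrow>
          (x \<rhd> y) \<rhd> (z \<rhd> y) = (x \<rhd> z) \<rhd> (y \<unrhd> z)"

definition biquandle_End :: "('a, 'm) biquandle_ops_scheme \<Rightarrow> ('a \<Rightarrow> 'a) set" where
  "biquandle_End X = {\<alpha> \<in> carrier X \<rightarrow>\<^sub>E carrier X. \<forall>x \<in> carrier X. \<forall>y \<in> carrier X.
     \<alpha> (x \<unrhd>\<^bsub>X\<^esub> y) = \<alpha> x \<unrhd>\<^bsub>X\<^esub> \<alpha> y \<and> \<alpha> (x \<rhd>\<^bsub>X\<^esub> y) = \<alpha> x \<rhd>\<^bsub>X\<^esub> \<alpha> y}"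

definition is_filtration :: "nat \<Rightarrow> (nat \<Rightarrow> 'b set) \<Rightarrow> 'b set \<Rightarrow> bool" where
  "is_filtration m S E \<longleftrightarrow> (\<forall>i<m. S i \<subseteq> S (Suc i)) \<and> (\<forall>i\<le>m. S i \<subseteq> E)"


section \<open>Oriented virtual link diagrams\<close>

text \<open>
  The plane is the type of complex numbers.  A point of the disjoint union of \<open>n\<close> oriented
  circles is a pair \<open>(k, z)\<close> with \<open>k < n\<close> and \<open>z\<close> on the unit circle.  Each of the two points
  over a double point carries a level: it is on the over-strand or on the under-strand of a
  classical crossing, or the crossing is virtual.  Levels at other points have no meaning.
\<close>

datatype level = Over | Under | Virtual

type_synonym circle_point = "nat \<times> complex"

record diagram =
  ncomp :: nat
  curve :: "nat \<Rightarrow> complex \<Rightarrow> complex"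
  level :: "circle_point \<Rightarrow> level"

definition circles :: "diagram \<Rightarrow> circle_point set" where
  "circles D = {..<ncomp D} \<times> sphere 0 1"

definition point :: "diagram \<Rightarrow> circle_point \<Rightarrow> complex" where
  "point D p = curve D (fst p) (snd p)"

definition velocity :: "diagram \<Rightarrow> circle_point \<Rightarrow> complex" where
  "velocity D p = vector_derivative (\<lambda>s. curve D (fst p) (snd p * cis s)) (at 0)"

text \<open>The determinant of \<open>(u, v)\<close>: positive iff \<open>v\<close> points to the left of \<open>u\<close>.\<close>

definition det2 :: "complex \<Rightarrow> complex \<Rightarrow> real" where
  "det2 u v = Re u * Im v - Im u * Re v"

definition crosses :: "diagram \<Rightarrow> circle_point \<Rightarrow> circle_point \<Rightarrow> bool" where
  "crosses D p q \<longleftrightarrow> p \<in> circles D \<and> q \<in> circles D \<and> p \<noteq> q \<and> point D p = point D q"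

definition double_points :: "diagram \<Rightarrow> circle_point set" where
  "double_points D = {p. \<exists>q. crosses D p q}"

definition C1_immersed_circle :: "(complex \<Rightarrow> complex) \<Rightarrow> bool" where
  "C1_immersed_circle c \<longleftrightarrow> (\<exists>c'. continuous_on UNIV c' \<and>
     (\<forall>t. ((\<lambda>s. c (cis s)) has_vector_derivative c' t) (at t) \<and> c' t \<noteq> 0))"

definition virtual_link_diagram :: "diagram \<Rightarrow> bool" where
  "virtual_link_diagram D \<longleftrightarrow>
     (\<forall>k<ncomp D. C1_immersed_circle (curve D k)) \<and>
     finite (double_points D) \<and>
     (\<forall>p q r. crosses D p q \<and> crosses D p r \<longrightarrow> q = r) \<and>
     (\<forall>p q. crosses D p q \<longrightarrow> det2 (velocity D p) (velocity D q) \<noteq> 0 \<and>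
        (level D p, level D q) \<in> {(Over, Under), (Under, Over), (Virtual, Virtual)})"


section \<open>Virtual equivalence\<close>

text \<open>For a real-linear map \<open>L\<close> of the plane, \<open>det2 (L 1) (L \<i>)\<close> is its determinant.\<close>

definition ambient_isotopy :: "(real \<Rightarrow> complex \<Rightarrow> complex) \<Rightarrow> bool" where
  "ambient_isotopy H \<longleftrightarrow>
     (\<forall>z. H 0 z = z) \<and>
     (\<forall>t\<in>{0..1}. bij (H t)) \<and>
     continuous_on ({0..1} \<times> UNIV) (\<lambda>(t, z). H t z) \<and>
     (\<exists>H'. (\<forall>t\<in>{0..1}. \<forall>z. (H t has_derivative H' t z) (at z) \<and>
              det2 (H' t z 1) (H' t z \<i>) \<noteq> 0) \<and>
           (\<forall>v. continuous_on ({0..1} \<times> UNIV) (\<lambda>(t, z). H' t z v)))"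

definition oriented_plane_diffeo :: "(complex \<Rightarrow> complex) \<Rightarrow> bool" where
  "oriented_plane_diffeo h \<longleftrightarrow> bij h \<and>
     (\<exists>h'. (\<forall>z. (h has_derivative h' z) (at z) \<and> det2 (h' z 1) (h' z \<i>) > 0) \<and>
           (\<forall>v. continuous_on UNIV (\<lambda>z. h' z v)))"

text \<open>Lifts to the real line of orientation-preserving diffeomorphisms of the circle.\<close>

definition circle_reparam :: "(real \<Rightarrow> real) \<Rightarrow> bool" where
  "circle_reparam \<psi> \<longleftrightarrow> (\<forall>t. \<psi> (t + 2 * pi) = \<psi> t + 2 * pi) \<and>
     (\<exists>\<psi>'. continuous_on UNIV \<psi>' \<and>
        (\<forall>t. (\<psi> has_real_derivative \<psi>' t) (at t) \<and> \<psi>' t > 0))"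

text \<open>
  Diagrams are parametrized here, so the numbering of the components and their
  orientation-preserving parametrizations are forgotten together with the planar isotopy.
\<close>

definition planar_isotopic :: "diagram \<Rightarrow> diagram \<Rightarrow> bool" where
  "planar_isotopic D D' \<longleftrightarrow> virtual_link_diagram D \<and> virtual_link_diagram D' \<and>
     ncomp D = ncomp D' \<and>
     (\<exists>H \<sigma> \<psi>. ambient_isotopy H \<and> bij_betw \<sigma> {..<ncomp D} {..<ncomp D} \<and>
        (\<forall>k<ncomp D. circle_reparam (\<psi> k) \<and>
           (\<forall>t. point D' (\<sigma> k, cis (\<psi> k t)) = H 1 (point D (k, cis t)) \<and>
                ((k, cis t) \<in> double_points D \<longrightarrow>
                   level D' (\<sigma> k, cis (\<psi> k t)) = level D (k, cis t)))))"

text \<open>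
  A Reidemeister move replaces the part of a diagram in a disc.  Up to an
  orientation-preserving diffeomorphism of the plane the disc is the square below, and the
  part of the diagram in it is a standard picture, given by finitely many strands
  \<open>[-1, 1] \<Rightarrow> square\<close>.  Strand \<open>i\<close> of the picture is matched with an arc \<open>e i\<close> of one of the
  circles; the arc may run along the circle in either direction, so that all orientations of
  the strands are covered.  The entry \<open>M i j\<close> is the level of strand \<open>i\<close> at its crossings
  with strand \<open>j \<noteq> i\<close>.
\<close>

definition square :: "complex set" where
  "square = {z. \<bar>Re z\<bar> \<le> 1 \<and> \<bar>Im z\<bar> \<le> 1}"

definition circle_arc :: "diagram \<Rightarrow> (real \<Rightarrow> circle_point) \<Rightarrow> bool" where
  "circle_arc D e \<longleftrightarrow> (\<exists>k<ncomp D. \<exists>\<theta> \<theta>'. continuous_on {-1..1} \<theta>' \<and>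
     (\<forall>t\<in>{-1..1}. (\<theta> has_real_derivative \<theta>' t) (at t within {-1..1}) \<and> \<theta>' t \<noteq> 0) \<and>
     \<bar>\<theta> 1 - \<theta> (-1)\<bar> < 2 * pi \<and>
     (\<forall>t\<in>{-1..1}. e t = (k, cis (\<theta> t))))"

definition shows_picture ::
  "diagram \<Rightarrow> (complex \<Rightarrow> complex) \<Rightarrow> (nat \<Rightarrow> real \<Rightarrow> circle_point) \<Rightarrow>
   (real \<Rightarrow> complex) list \<Rightarrow> (nat \<Rightarrow> nat \<Rightarrow> level) \<Rightarrow> bool" where
  "shows_picture D h e T M \<longleftrightarrow>
     {p \<in> circles D. point D p \<in> h ` square} = (\<Union>i<length T. e i ` {-1..1}) \<and>
     (\<forall>i<length T. \<forall>t\<in>{-1..1}. point D (e i t) = h ((T ! i) t)) \<and>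
     (\<forall>i<length T. \<forall>j<length T. \<forall>s\<in>{-1..1}. \<forall>t\<in>{-1..1}.
        i \<noteq> j \<and> (T ! i) s = (T ! j) t \<longrightarrow> level D (e i s) = M i j)"

definition local_move ::
  "(real \<Rightarrow> complex) list \<Rightarrow> (real \<Rightarrow> complex) list \<Rightarrow> (nat \<Rightarrow> nat \<Rightarrow> level) \<Rightarrow>
   diagram \<Rightarrow> diagram \<Rightarrow> bool" where
  "local_move T T' M D D' \<longleftrightarrow>
     virtual_link_diagram D \<and> virtual_link_diagram D' \<and>
     ncomp D = ncomp D' \<and> length T = length T' \<and>
     (\<exists>h e. oriented_plane_diffeo h \<and>
        (\<forall>i<length T. circle_arc D (e i)) \<and>
        disjoint_family_on (\<lambda>i. e i ` {-1..1}) {..<length T} \<and>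
        shows_picture D h e T M \<and> shows_picture D' h e T' M \<and>
        (\<forall>p \<in> circles D - (\<Union>i<length T. e i ` {-1..1}).
           point D' p = point D p \<and> (p \<in> double_points D \<longrightarrow> level D' p = level D p)))"

text \<open>
  The bump \<open>(1 - t\<^sup>2)\<^sup>2\<close> vanishes to first order at \<open>t = 1\<close> and \<open>t = -1\<close>, so in each pair of
  pictures below corresponding strands have the same end points and end velocities.  The kink
  has one self-crossing, at the two parameters with \<open>(1 - t\<^sup>2)\<^sup>2 = 1/2\<close>.
\<close>

definition bump :: "real \<Rightarrow> real" where
  "bump t = (1 - t\<^sup>2)\<^sup>2"

definition R1_straight :: "(real \<Rightarrow> complex) list" where
  "R1_straight = [\<lambda>t. Complex t 0]"

definition R1_kink :: "(real \<Rightarrow> complex) list" where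
  "R1_kink = [\<lambda>t. Complex (t - 2 * t * bump t) (bump t / 2)]"

definition R2_apart :: "(real \<Rightarrow> complex) list" where
  "R2_apart = [\<lambda>t. Complex t 0, \<lambda>t. Complex t (1/2)]"

definition R2_overlap :: "(real \<Rightarrow> complex) list" where
  "R2_overlap = [\<lambda>t. Complex t 0, \<lambda>t. Complex t (1/2 - bump t)]"

definition R3_above :: "(real \<Rightarrow> complex) list" where
  "R3_above = [\<lambda>t. Complex t (t/2), \<lambda>t. Complex t (- t/2), \<lambda>t. Complex t (bump t / 2)]"

definition R3_below :: "(real \<Rightarrow> complex) list" where
  "R3_below = [\<lambda>t. Complex t (t/2), \<lambda>t. Complex t (- t/2), \<lambda>t. Complex t (- bump t / 2)]"

definition all_virtual :: "(nat \<Rightarrow> nat \<Rightarrow> level) \<Rightarrow> bool" where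
  "all_virtual M \<longleftrightarrow> (\<forall>i<3. \<forall>j<3. i \<noteq> j \<longrightarrow> M i j = Virtual)"

definition layered :: "(nat \<Rightarrow> nat \<Rightarrow> level) \<Rightarrow> bool" where
  "layered M \<longleftrightarrow> (\<exists>height :: nat \<Rightarrow> nat. inj_on height {..<3} \<and>
     (\<forall>i<3. \<forall>j<3. i \<noteq> j \<longrightarrow> M i j = (if height j < height i then Over else Under)))"

definition mixed :: "(nat \<Rightarrow> nat \<Rightarrow> level) \<Rightarrow> bool" where
  "mixed M \<longleftrightarrow> (M 0 1, M 1 0) \<in> {(Over, Under), (Under, Over)} \<and>
     M 0 2 = Virtual \<and> M 2 0 = Virtual \<and> M 1 2 = Virtual \<and> M 2 1 = Virtual"

text \<open>
  In \<open>R1\<close> the crossing of the kink may be classical (of either sign) or virtual.  In \<open>R2\<close> the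
  second strand has the same level \<open>M 1 0\<close> at both crossings: it is over twice, under twice, or
  both crossings are virtual.
\<close>

inductive reidemeister_move :: "diagram \<Rightarrow> diagram \<Rightarrow> bool" where
  R1: "local_move R1_straight R1_kink M D D' \<Longrightarrow> reidemeister_move D D'"
| R2: "local_move R2_apart R2_overlap M D D' \<Longrightarrow> reidemeister_move D D'"
| R3_classical: "local_move R3_above R3_below M D D' \<Longrightarrow> layered M \<Longrightarrow> reidemeister_move D D'"
| R3_virtual: "local_move R3_above R3_below M D D' \<Longrightarrow> all_virtual M \<Longrightarrow> reidemeister_move D D'"
| R3_mixed: "local_move R3_above R3_below M D D' \<Longrightarrow> mixed M \<Longrightarrow> reidemeister_move D D'"

definition virtually_equivalent :: "diagram \<Rightarrow> diagram \<Rightarrow> bool" where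
  "virtually_equivalent = equivclp (\<lambda>D D'. planar_isotopic D D' \<or> reidemeister_move D D')"


section \<open>Colorings\<close>

definition classical_points :: "diagram \<Rightarrow> circle_point set" where
  "classical_points D = {p \<in> double_points D. level D p \<noteq> Virtual}"

definition semi_arcs :: "diagram \<Rightarrow> circle_point set set" where
  "semi_arcs D = components (circles D - classical_points D)"

definition outgoing :: "diagram \<Rightarrow> circle_point \<Rightarrow> circle_point set" where
  "outgoing D p = (THE A. A \<in> semi_arcs D \<and>
     (\<forall>\<^sub>F s in at_right 0. (fst p, snd p * cis s) \<in> A))"

definition incoming :: "diagram \<Rightarrow> circle_point \<Rightarrow> circle_point set" where
  "incoming D p = (THE A. A \<in> semi_arcs D \<and>
     (\<forall>\<^sub>F s in at_right 0. (fst p, snd p * cis (- s)) \<in> A))"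

text \<open>
  The semi-arcs at \<open>p\<close> lying to the right and to the left of the strand through \<open>q\<close>, where
  \<open>p\<close> and \<open>q\<close> are the two points over a classical crossing.
\<close>

definition right_arc :: "diagram \<Rightarrow> circle_point \<Rightarrow> circle_point \<Rightarrow> circle_point set" where
  "right_arc D p q =
     (if det2 (velocity D q) (velocity D p) < 0 then outgoing D p else incoming D p)"

definition left_arc :: "diagram \<Rightarrow> circle_point \<Rightarrow> circle_point \<Rightarrow> circle_point set" where
  "left_arc D p q =
     (if det2 (velocity D q) (velocity D p) < 0 then incoming D p else outgoing D p)"

definition colorings ::
  "('a, 'm) biquandle_ops_scheme \<Rightarrow> diagram \<Rightarrow> (circle_point set \<Rightarrow> 'a) set" where
  "colorings X D = {f \<in> semi_arcs D \<rightarrow>\<^sub>E carrier X.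
     \<forall>u v. crosses D u v \<and> level D u = Under \<and> level D v = Over \<longrightarrow>
       f (left_arc D u v) = f (right_arc D u v) \<unrhd>\<^bsub>X\<^esub> f (right_arc D v u) \<and>
       f (left_arc D v u) = f (right_arc D v u) \<rhd>\<^bsub>X\<^esub> f (right_arc D u v)}"


section \<open>Coloring quivers\<close>

definition coloring_quiver ::
  "('a, 'm) biquandle_ops_scheme \<Rightarrow> ('a \<Rightarrow> 'a) set \<Rightarrow> diagram \<Rightarrow>
   (circle_point set \<Rightarrow> 'a, (circle_point set \<Rightarrow> 'a) \<times> ('a \<Rightarrow> 'a)) pre_digraph" where
  "coloring_quiver X S D =
     \<lparr>verts = colorings X D,
      arcs = colorings X D \<times> S,
      tail = (\<lambda>(f, \<alpha>). f),
      head = (\<lambda>(f, \<alpha>). compose (semi_arcs D) \<alpha> f)\<rparr>"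

definition edge_count :: "('v, 'e) pre_digraph \<Rightarrow> 'v \<Rightarrow> 'v \<Rightarrow> nat" where
  "edge_count Q u v = card {a \<in> arcs Q. tail Q a = u \<and> head Q a = v}"


section \<open>Directed clique complexes and their homology\<close>

definition clique_complex :: "nat \<Rightarrow> ('v, 'e) pre_digraph \<Rightarrow> 'v list set" where
  "clique_complex N Q = {vs. vs \<noteq> [] \<and> distinct vs \<and> set vs \<subseteq> verts Q \<and>
     (\<forall>j<length vs. \<forall>i<j. N \<le> edge_count Q (vs ! i) (vs ! j))}"

definition ordered_simplices :: "'v list set \<Rightarrow> nat \<Rightarrow> 'v list set" where
  "ordered_simplices K n = {vs \<in> K. length vs = Suc n}"

definition ordered_chain_group :: "'v list set \<Rightarrow> nat \<Rightarrow> ('v list \<Rightarrow>\<^sub>0 int) monoid" where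
  "ordered_chain_group K n = free_Abelian_group (ordered_simplices K n)"

definition ordered_boundary :: "nat \<Rightarrow> ('v list \<Rightarrow>\<^sub>0 int) \<Rightarrow> ('v list \<Rightarrow>\<^sub>0 int)" where
  "ordered_boundary n c = (if n = 0 then 0 else
     frag_extend (\<lambda>vs. \<Sum>i\<le>n. frag_cmul ((-1) ^ i) (frag_of (take i vs @ drop (Suc i) vs))) c)"

text \<open>In degree \<open>0\<close> the boundary map is zero, so its target is immaterial.\<close>

definition ordered_cycles :: "'v list set \<Rightarrow> nat \<Rightarrow> ('v list \<Rightarrow>\<^sub>0 int) set" where
  "ordered_cycles K n =
     kernel (ordered_chain_group K n) (ordered_chain_group K (n - 1)) (ordered_boundary n)"

definition ordered_boundaries :: "'v list set \<Rightarrow> nat \<Rightarrow> ('v list \<Rightarrow>\<^sub>0 int) set" where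
  "ordered_boundaries K n =
     ordered_boundary (Suc n) ` carrier (ordered_chain_group K (Suc n))"

definition ordered_homology :: "'v list set \<Rightarrow> nat \<Rightarrow> ('v list \<Rightarrow>\<^sub>0 int) set monoid" where
  "ordered_homology K n =
     (ordered_chain_group K n)\<lparr>carrier := ordered_cycles K n\<rparr> Mod ordered_boundaries K n"

text \<open>
  For a subcomplex \<open>K\<close> of \<open>K'\<close>, the class \<open>z + B\<^sub>n(K)\<close> is sent to
  \<open>B\<^sub>n(K') + (z + B\<^sub>n(K)) = z + B\<^sub>n(K')\<close>.
\<close>

definition inclusion_map ::
  "'v list set \<Rightarrow> nat \<Rightarrow> ('v list \<Rightarrow>\<^sub>0 int) set \<Rightarrow> ('v list \<Rightarrow>\<^sub>0 int) set" where
  "inclusion_map K' n A = ordered_boundaries K' n <#>\<^bsub>ordered_chain_group K' n\<^esub> A"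

text \<open>
  A sequence of complexes \<open>K 0 \<subseteq> \<dots> \<subseteq> K m\<close> is given by a function on the natural numbers.
\<close>

definition persistent_homology ::
  "(nat \<Rightarrow> 'v list set) \<Rightarrow> nat \<Rightarrow> nat \<Rightarrow> nat \<Rightarrow> ('v list \<Rightarrow>\<^sub>0 int) set monoid" where
  "persistent_homology K n i j =
     (ordered_homology (K j) n)
       \<lparr>carrier := inclusion_map (K j) n ` carrier (ordered_homology (K i) n)\<rparr>"

text \<open>
  The rank of an abelian group: the largest size of a family of elements that is linearly
  independent over the integers.  For finitely generated groups, the only ones used here,
  these sizes are bounded.
\<close>

definition int_independent :: "('g, 'm) monoid_scheme \<Rightarrow> 'g set \<Rightarrow> bool" where
  "int_independent G B \<longleftrightarrow> (\<forall>c :: 'g \<Rightarrow> int.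
     (\<Otimes>\<^bsub>G\<^esub>b\<in>B. b [^]\<^bsub>G\<^esub> c b) = \<one>\<^bsub>G\<^esub> \<longrightarrow> (\<forall>b\<in>B. c b = 0))"

definition abelian_rank :: "('g, 'm) monoid_scheme \<Rightarrow> nat" where
  "abelian_rank G = Sup {card B |B. B \<subseteq> carrier G \<and> finite B \<and> int_independent G B}"


section \<open>Barcodes\<close>

definition persistent_betti :: "(nat \<Rightarrow> 'v list set) \<Rightarrow> nat \<Rightarrow> nat \<Rightarrow> nat \<Rightarrow> int" where
  "persistent_betti K n i j = int (abelian_rank (persistent_homology K n i j))"

text \<open>The number \<open>\<beta>\<^sub>n\<close> for the indices \<open>i - 1, j\<close>, which is \<open>0\<close> if \<open>i = 0\<close>.\<close>

definition persistent_betti_pred :: "(nat \<Rightarrow> 'v list set) \<Rightarrow> nat \<Rightarrow> nat \<Rightarrow> nat \<Rightarrow> int" where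
  "persistent_betti_pred K n i j = (case i of 0 \<Rightarrow> 0 | Suc i' \<Rightarrow> persistent_betti K n i' j)"

definition interval_mult :: "(nat \<Rightarrow> 'v list set) \<Rightarrow> nat \<Rightarrow> nat \<Rightarrow> nat \<Rightarrow> int" where
  "interval_mult K n i j =
     persistent_betti K n i (j - 1) - persistent_betti K n i j
     - persistent_betti_pred K n i (j - 1) + persistent_betti_pred K n i j"

definition infinite_interval_mult :: "(nat \<Rightarrow> 'v list set) \<Rightarrow> nat \<Rightarrow> nat \<Rightarrow> nat \<Rightarrow> int" where
  "infinite_interval_mult K m n i = persistent_betti K n i m - persistent_betti_pred K n i m"

text \<open>
  The multiset of intervals \<open>[i, j)\<close> in dimension \<open>n\<close>, as pairs \<open>(i, j)\<close>.  The multiplicities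
  are nonnegative for nested complexes, so the conversion to natural numbers loses nothing.
\<close>

definition barcode :: "(nat \<Rightarrow> 'v list set) \<Rightarrow> nat \<Rightarrow> nat \<Rightarrow> (nat \<times> enat) multiset" where
  "barcode K m n =
     (\<Sum>i\<le>m. \<Sum>j\<in>{i<..m}. replicate_mset (nat (interval_mult K n i j)) (i, enat j)) +
     (\<Sum>i\<le>m. replicate_mset (nat (infinite_interval_mult K m n i)) (i, \<infinity>))"

definition link_barcode ::
  "nat \<Rightarrow> ('a, 'm) biquandle_ops_scheme \<Rightarrow> nat \<Rightarrow> (nat \<Rightarrow> ('a \<Rightarrow> 'a) set) \<Rightarrow> diagram \<Rightarrow>
   nat \<Rightarrow> (nat \<times> enat) multiset" where
  "link_barcode N X m S D = barcode (\<lambda>i. clique_complex N (coloring_quiver X (S i) D)) m"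

end

theory Submission
  imports Defs
begin

text \<open>
  A coloring is the same as a function on the regular points of the circles that is locally
  constant and satisfies the crossing conditions for its one-sided limits.  In this form
  colorings can be cut and glued: a coloring of one side of a Reidemeister move is determined
  by its values near the ends of the strands, and both sides of the move allow the same values
  there.  So restriction to the part of the diagram outside the move yields a bijection of the
  colorings of the two diagrams, which commutes with postcomposition by endomorphisms.  It is
  therefore an isomorphism of coloring quivers compatible with the filtration, and the
  persistent homology groups, hence their ranks, agree.

  For the classical third move, the colors of the three strands are placed on the edges of a
  cube whose vertices are the possible positions (left or right) relative to the strands.  The
  two sides of the move are the triples of faces at two opposite vertices, and by the exchange
  laws any three colors at one vertex extend uniquely to the cube; this treats all orientations
  and all orders of the strands at once.
\<close>

section \<open>Persistent homology of isomorphic complexes\<close>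

text \<open>Semi-arcs cannot be matched across a move, which splits, merges, creates and deletes
  them. Points outside the move do match; this is why colorings become functions of points and why
  two diagrams are compared by agreement on a set of test points. Such agreement survives
  postcomposition by an endomorphism, so no naturality argument is left for the individual moves.
  The other obstacle is orientation. A strand of a picture may run along its circle in either
  direction, while crossing conditions depend on left and right. Reversing a strand exchanges its
  outgoing and incoming ends and also the side to which it leaves; the two effects cancel, and only
  the direction of the crossed strand survives. The flags \<open>pos\<close> record it, so that no
  move is split by orientations. Virtual crossings impose nothing on colors; for a move with virtual
  crossings it suffices that the classical ones stay the same. Finiteness of the carrier enters
  twice: it makes edge counts monotone along the filtration, and it makes the map sending x to x
  \<unrhd> x surjective, which adding a kink requires.\<close>

lemma (in comm_group) hom_finprod:
  assumes "comm_group H" "h \<in> hom G H" "finite A" "f \<in> A \<rightarrow> carrier G"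
  shows "h (finprod G f A) = finprod H (\<lambda>x. h (f x)) A"
  using assms(3,4)
proof (induction A rule: finite_induct)
  case empty
  interpret H: comm_group H by fact
  show ?case
    using assms(2) hom_one[of h G H] is_group H.is_group by simp
next
  case (insert a A)
  interpret H: comm_group H by fact
  have h: "\<And>x. x \<in> carrier G \<Longrightarrow> h x \<in> carrier H"
    using assms(2) by (auto simp: hom_def)
  have f: "f a \<in> carrier G" "f \<in> A \<rightarrow> carrier G"
    using insert.prems by auto
  then have hf: "(\<lambda>x. h (f x)) \<in> A \<rightarrow> carrier H" "h (f a) \<in> carrier H"
    using h by auto
  have "h (finprod G f (insert a A)) = h (f a) \<otimes>\<^bsub>H\<^esub> h (finprod G f A)"
    by (simp only: finprod_insert[OF insert.hyps f(2,1)] hom_mult[OF assms(2) f(1) finprod_closed[OF f(2)]])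
  also have "\<dots> = finprod H (\<lambda>x. h (f x)) (insert a A)"
    by (simp only: H.finprod_insert[OF insert.hyps hf] insert.IH[OF f(2)])
  finally show ?case .
qed

lemma (in comm_group) subgroup_comm_group:
  assumes "subgroup H G"
  shows "comm_group (G\<lparr>carrier := H\<rparr>)"
proof (rule group.group_comm_groupI[OF subgroup_imp_group[OF assms]])
  fix x y assume "x \<in> carrier (G\<lparr>carrier := H\<rparr>)" "y \<in> carrier (G\<lparr>carrier := H\<rparr>)"
  then have "x \<in> carrier G" "y \<in> carrier G"
    using subgroup.subset[OF assms] by auto
  then show "x \<otimes>\<^bsub>G\<lparr>carrier := H\<rparr>\<^esub> y = y \<otimes>\<^bsub>G\<lparr>carrier := H\<rparr>\<^esub> x"
    by (simp add: m_comm)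
qed

section \<open>Rank of an abelian group under isomorphism\<close>

lemma int_independent_iso_image:
  assumes "comm_group G" "comm_group H" "h \<in> iso G H"
    and "B \<subseteq> carrier G" "finite B" "int_independent G B"
  shows "int_independent H (h ` B)"
  unfolding int_independent_def
proof (intro allI impI)
  interpret G: comm_group G by fact
  interpret H: comm_group H by fact
  have hom: "h \<in> hom G H" and bij: "bij_betw h (carrier G) (carrier H)"
    using assms(3) by (auto simp: iso_def)
  interpret group_hom G H h
    using hom G.is_group H.is_group by (simp add: group_hom_def group_hom_axioms_def)
  have inj: "inj_on h B"
    using bij assms(4) by (meson bij_betw_def inj_on_subset)
  fix c :: "'c \<Rightarrow> int"
  assume one: "(\<Otimes>\<^bsub>H\<^esub>b\<in>h ` B. b [^]\<^bsub>H\<^esub> c b) = \<one>\<^bsub>H\<^esub>"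
  \<comment> \<open>A relation with coefficients \<open>c\<close> among the images pulls back to one
    with coefficients \<open>c (h b)\<close>; injectivity of \<open>h\<close> then makes it a
    relation in \<open>G\<close>.\<close>
  have "h (\<Otimes>\<^bsub>G\<^esub>b\<in>B. b [^]\<^bsub>G\<^esub> c (h b)) = (\<Otimes>\<^bsub>H\<^esub>b\<in>B. h (b [^]\<^bsub>G\<^esub> c (h b)))"
    by (rule G.hom_finprod) (use assms hom in auto)
  also have "\<dots> = (\<Otimes>\<^bsub>H\<^esub>b\<in>B. h b [^]\<^bsub>H\<^esub> c (h b))"
    using assms(4) by (intro H.finprod_cong') (auto simp: hom_int_pow)
  also have "\<dots> = (\<Otimes>\<^bsub>H\<^esub>b\<in>h ` B. b [^]\<^bsub>H\<^esub> c b)"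
    using assms(4) by (intro H.finprod_reindex[symmetric] inj) auto
  finally have "h (\<Otimes>\<^bsub>G\<^esub>b\<in>B. b [^]\<^bsub>G\<^esub> c (h b)) = h \<one>\<^bsub>G\<^esub>"
    using one by simp
  moreover have "(\<Otimes>\<^bsub>G\<^esub>b\<in>B. b [^]\<^bsub>G\<^esub> c (h b)) \<in> carrier G"
    by (rule G.finprod_closed) (use assms(4) G.int_pow_closed in blast)
  ultimately have "(\<Otimes>\<^bsub>G\<^esub>b\<in>B. b [^]\<^bsub>G\<^esub> c (h b)) = \<one>\<^bsub>G\<^esub>"
    using inj_onD[OF bij_betw_imp_inj_on[OF bij]] G.one_closed by blast
  then show "\<forall>b\<in>h ` B. c b = 0"
    using assms(6) unfolding int_independent_def by (auto dest: spec[of _ "\<lambda>b. c (h b)"])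
qed

text \<open>The sets of sizes of independent families coincide, so their suprema agree whether or
  not they are bounded.\<close>

lemma abelian_rank_iso:
  assumes "comm_group G" "comm_group H" "h \<in> iso G H"
  shows "abelian_rank G = abelian_rank H"
proof -
  \<comment> \<open>Stated for arbitrary groups, so that it yields both inclusions.\<close>
  have *: "{card B |B. B \<subseteq> carrier G \<and> finite B \<and> int_independent G B}
      \<subseteq> {card B |B. B \<subseteq> carrier H \<and> finite B \<and> int_independent H B}"
    if "comm_group G" "comm_group H" "h \<in> iso G H" 
    for G :: "('x, 'y) monoid_scheme" and H :: "('z, 'w) monoid_scheme" and h
  proof clarify
    fix B assume B: "B \<subseteq> carrier G" "finite B" "int_independent G B"
    have bij: "bij_betw h (carrier G) (carrier H)"
      using that by (auto simp: iso_def)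
    have "int_independent H (h ` B)"
      using int_independent_iso_image that B by blast
    moreover have "card (h ` B) = card B"
      using bij B by (meson bij_betw_def card_image inj_on_subset)
    moreover have "h ` B \<subseteq> carrier H"
      using bij B by (auto simp: bij_betw_def)
    ultimately show "\<exists>B'. card B = card B' \<and> B' \<subseteq> carrier H \<and> finite B' \<and> int_independent H B'"
      using B by (metis finite_imageI)
  qed
  have "group G" using assms by (simp add: comm_group_def)
  then have "inv_into (carrier G) h \<in> iso H G"
    using assms group.iso_set_sym by blast
  then show ?thesis
    unfolding abelian_rank_def using *[OF assms] *[OF assms(2,1)]
    by (intro arg_cong[where f = Sup] subset_antisym)
qed

definition delete_nth :: "nat \<Rightarrow> 'v list \<Rightarrow> 'v list" where
  "delete_nth i vs = take i vs @ drop (Suc i) vs"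

lemma length_delete_nth: "i < length vs \<Longrightarrow> length (delete_nth i vs) = length vs - 1"
  by (auto simp: delete_nth_def)

lemma map_delete_nth: "map f (delete_nth i vs) = delete_nth i (map f vs)"
  by (simp add: delete_nth_def take_map drop_map)

text \<open>The simplicial identity for face maps: once the earlier entry \<open>j\<close> is gone,
  the later one sits at \<open>i - 1\<close>.\<close>

lemma delete_nth_delete_nth:
  assumes "j < i" "i < length vs"
  shows "delete_nth j (delete_nth i vs) = delete_nth (i - 1) (delete_nth j vs)"
  using assms
proof (induction vs arbitrary: i j)
  case Nil
  then show ?case by simp
next
  case (Cons v vs)
  obtain i' where i: "i = Suc i'"
    using Cons.prems by (cases i) auto
  show ?case
  proof (cases j)
    case 0
    then show ?thesis by (simp add: delete_nth_def i)
  next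
    case (Suc j')
    moreover obtain i'' where "i' = Suc i''"
      using Cons.prems Suc i by (cases i') auto
    ultimately show ?thesis
      using Cons.IH[of j' i'] Cons.prems by (simp add: delete_nth_def i)
  qed
qed

lemma ordered_boundary_eq:
  "ordered_boundary n c = (if n = 0 then 0 else
     frag_extend (\<lambda>vs. \<Sum>i\<le>n. frag_cmul ((-1) ^ i) (frag_of (delete_nth i vs))) c)"
  by (simp add: ordered_boundary_def delete_nth_def)

lemma ordered_boundary_0 [simp]: "ordered_boundary n 0 = 0"
  by (simp add: ordered_boundary_def)

lemma ordered_boundary_diff:
  "ordered_boundary n (a - b) = ordered_boundary n a - ordered_boundary n b"
  by (simp add: ordered_boundary_def frag_extend_diff)

lemma ordered_boundary_add:
  "ordered_boundary n (a + b) = ordered_boundary n a + ordered_boundary n b"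
  by (simp add: ordered_boundary_def frag_extend_add)

lemma ordered_boundary_sum:
  "finite I \<Longrightarrow> ordered_boundary n (\<Sum>i\<in>I. g i) = (\<Sum>i\<in>I. ordered_boundary n (g i))"
  by (induction I rule: finite_induct) (auto simp: ordered_boundary_add)

lemma ordered_boundary_cmul:
  "ordered_boundary n (frag_cmul k a) = frag_cmul k (ordered_boundary n a)"
  by (simp add: ordered_boundary_def frag_extend_cmul)

text \<open>The double sum is split by whether the second deletion lies to the left of the first. By
  the simplicial identity the term of \<open>(i, j)\<close> in \<open>?U\<close> is the term of
  \<open>(Suc j, i)\<close> in \<open>?L\<close> with the opposite sign.\<close>

lemma ordered_boundary_boundary_of:
  assumes "length vs = Suc (Suc n)"
  shows "ordered_boundary n (ordered_boundary (Suc n) (frag_of vs)) = 0"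
proof (cases "n = 0")
  case False
  let ?g = "\<lambda>(i, j). frag_cmul ((-1) ^ (i + j)) (frag_of (delete_nth j (delete_nth i vs)))"
  let ?L = "{(i, j). i \<le> Suc n \<and> j < i}" and ?U = "{(i, j). i \<le> j \<and> j \<le> n}"
  have "ordered_boundary n (ordered_boundary (Suc n) (frag_of vs))
      = (\<Sum>i\<le>Suc n. \<Sum>j\<le>n. frag_cmul ((-1) ^ i) (frag_cmul ((-1) ^ j) (frag_of (delete_nth j (delete_nth i vs)))))"
    using False
    by (simp only: ordered_boundary_eq[of "Suc n"] frag_extend_of if_False nat.distinct ordered_boundary_sum
         finite_atMost ordered_boundary_cmul)
      (simp add: ordered_boundary_eq frag_cmul_sum del: frag_cmul_cmul)
  also have "\<dots> = (\<Sum>p \<in> {..Suc n} \<times> {..n}. ?g p)"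
    by (simp add: sum.cartesian_product power_add del: sum.atMost_Suc)
  also have "{..Suc n} \<times> {..n} = ?L \<union> ?U"
    by auto
  also have "(\<Sum>p \<in> ?L \<union> ?U. ?g p) = (\<Sum>p \<in> ?L. ?g p) + (\<Sum>p \<in> ?U. ?g p)"
  proof (rule sum.union_disjoint)
    show "finite ?L" by (rule finite_subset[of _ "{..Suc n} \<times> {..n}"]) auto
    show "finite ?U" by (rule finite_subset[of _ "{..Suc n} \<times> {..n}"]) auto
  qed auto
  also have "(\<Sum>p \<in> ?U. ?g p) = (\<Sum>p \<in> ?L. - ?g p)"
  proof (rule sum.reindex_bij_witness[where i = "\<lambda>(i, j). (j, i - 1)" and j = "\<lambda>(i, j). (Suc j, i)"])
    fix p assume "p \<in> ?U"
    then obtain i j where p: "p = (i, j)" "i \<le> j" "j \<le> n" by auto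
    then show "- ?g (case p of (i, j) \<Rightarrow> (Suc j, i)) = ?g p"
      using delete_nth_delete_nth[of i "Suc j" vs] assms by (simp add: add.commute)
  qed auto
  finally show ?thesis
    by (simp add: sum_negf)
qed (simp add: ordered_boundary_def)

text \<open>The bound on the length exempts single vertices: their only face would be the empty
  list, which is not a simplex.\<close>

definition face_closed :: "'v list set \<Rightarrow> bool" where
  "face_closed K \<longleftrightarrow> (\<forall>vs\<in>K. \<forall>i<length vs. 2 \<le> length vs \<longrightarrow> delete_nth i vs \<in> K)"

lemma ordered_boundary_boundary:
  assumes "c \<in> carrier (ordered_chain_group K (Suc n))"
  shows "ordered_boundary n (ordered_boundary (Suc n) c) = 0"
proof -
  have "Poly_Mapping.keys c \<subseteq> ordered_simplices K (Suc n)"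
    using assms by (simp add: ordered_chain_group_def)
  then show ?thesis
  proof (induction c rule: frag_induction)
    case (one vs)
    then show ?case
      by (intro ordered_boundary_boundary_of) (simp add: ordered_simplices_def)
  qed (auto simp: ordered_boundary_diff)
qed

lemma ordered_boundary_closed:
  assumes "face_closed K" "c \<in> carrier (ordered_chain_group K n)"
  shows "ordered_boundary n c \<in> carrier (ordered_chain_group K (n - 1))"
proof -
  have c: "Poly_Mapping.keys c \<subseteq> ordered_simplices K n"
    using assms by (simp add: ordered_chain_group_def)
  have "Poly_Mapping.keys (ordered_boundary n c) \<subseteq> ordered_simplices K (n - 1)"
    using c
  proof (induction c rule: frag_induction)
    case (one vs)
    show ?case
    proof (cases "n = 0")
      case False
      have vs: "vs \<in> K" "length vs = Suc n"
        using one by (auto simp: ordered_simplices_def)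
      have "Poly_Mapping.keys (\<Sum>i\<le>n. frag_cmul ((-1) ^ i) (frag_of (delete_nth i vs)))
          \<subseteq> (\<Union>i\<le>n. Poly_Mapping.keys (frag_cmul ((-1) ^ i) (frag_of (delete_nth i vs))))"
        by (rule keys_sum)
      also have "\<dots> \<subseteq> (\<Union>i\<le>n. {delete_nth i vs})"
        by (auto simp: keys_frag_of)
      also have "\<dots> \<subseteq> ordered_simplices K (n - 1)"
        using vs False assms(1) by (auto simp: ordered_simplices_def face_closed_def length_delete_nth)
      finally show ?thesis
        using False by (simp add: ordered_boundary_eq)
    qed (simp add: ordered_boundary_def)
  next
    case (diff a b)
    then show ?case
      using keys_diff[of "ordered_boundary n a" "ordered_boundary n b"]
      by (auto simp: ordered_boundary_diff)
  qed (simp add: ordered_boundary_def)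
  then show ?thesis
    by (simp add: ordered_chain_group_def)
qed

section \<open>Cycles, boundaries and homology groups\<close>

lemma comm_group_ordered_chain_group: "comm_group (ordered_chain_group K n)"
  by (simp add: ordered_chain_group_def abelian_free_Abelian_group)

lemma mult_ordered_chain_group [simp]: "x \<otimes>\<^bsub>ordered_chain_group K n\<^esub> y = x + y"
  by (simp add: ordered_chain_group_def)

lemma one_ordered_chain_group [simp]: "\<one>\<^bsub>ordered_chain_group K n\<^esub> = 0"
  by (simp add: ordered_chain_group_def)

text \<open>In degree 0 truncated subtraction makes this the zero endomorphism, whose kernel is the
  whole chain group, as it should be for 0-cycles.\<close>

lemma ordered_boundary_group_hom:
  assumes "face_closed K"
  shows "group_hom (ordered_chain_group K n) (ordered_chain_group K (n - 1)) (ordered_boundary n)"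
  using comm_group_ordered_chain_group[of K n] comm_group_ordered_chain_group[of K "n - 1"]
    ordered_boundary_closed[OF assms]
  by (auto simp: group_hom_def group_hom_axioms_def hom_def ordered_boundary_add comm_group_def)

lemma ordered_cycles_eq:
  "ordered_cycles K n = {c \<in> carrier (ordered_chain_group K n). ordered_boundary n c = 0}"
  by (auto simp: ordered_cycles_def kernel_def)

lemma subgroup_ordered_cycles:
  assumes "face_closed K"
  shows "subgroup (ordered_cycles K n) (ordered_chain_group K n)"
  unfolding ordered_cycles_def
  by (rule group_hom.subgroup_kernel[OF ordered_boundary_group_hom[OF assms]])

lemma ordered_boundaries_subset_cycles:
  assumes "face_closed K"
  shows "ordered_boundaries K n \<subseteq> ordered_cycles K n"
  using ordered_boundary_closed[OF assms, of _ "Suc n"] ordered_boundary_boundary[of _ K n]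
  by (auto simp: ordered_boundaries_def ordered_cycles_eq)

lemma subgroup_ordered_boundaries:
  assumes "face_closed K"
  shows "subgroup (ordered_boundaries K n) (ordered_chain_group K n)"
  using group_hom.img_is_subgroup[OF ordered_boundary_group_hom[OF assms, of "Suc n"]]
  by (simp add: ordered_boundaries_def)

lemma comm_group_cycles:
  assumes "face_closed K"
  shows "comm_group ((ordered_chain_group K n)\<lparr>carrier := ordered_cycles K n\<rparr>)"
  using comm_group.subgroup_comm_group[OF comm_group_ordered_chain_group] subgroup_ordered_cycles[OF assms]
  by blast

lemma normal_boundaries:
  assumes "face_closed K"
  shows "ordered_boundaries K n \<lhd> (ordered_chain_group K n)\<lparr>carrier := ordered_cycles K n\<rparr>"
proof -
  interpret Z: comm_group "(ordered_chain_group K n)\<lparr>carrier := ordered_cycles K n\<rparr>"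
    by (rule comm_group_cycles[OF assms])
  interpret C: comm_group "ordered_chain_group K n"
    by (rule comm_group_ordered_chain_group)
  have "subgroup (ordered_boundaries K n) ((ordered_chain_group K n)\<lparr>carrier := ordered_cycles K n\<rparr>)"
    using C.subgroup_incl[OF subgroup_ordered_boundaries[OF assms] subgroup_ordered_cycles[OF assms]
        ordered_boundaries_subset_cycles[OF assms]] .
  then show ?thesis
    using Z.normal_iff_subgroup by blast
qed

lemma comm_group_ordered_homology:
  assumes "face_closed K"
  shows "comm_group (ordered_homology K n)"
  unfolding ordered_homology_def
proof (rule comm_group.abelian_FactGroup[OF comm_group_cycles[OF assms]])
  show "subgroup (ordered_boundaries K n) ((ordered_chain_group K n)\<lparr>carrier := ordered_cycles K n\<rparr>)"
    using normal_boundaries[OF assms] normal_imp_subgroup by blast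
qed

text \<open>The homology class of \<open>z\<close> as a plain set of chains, so that inclusions and
  simplicial maps act on it by taking images.\<close>

definition boundary_coset :: "'v list set \<Rightarrow> nat \<Rightarrow> ('v list \<Rightarrow>\<^sub>0 int) \<Rightarrow> ('v list \<Rightarrow>\<^sub>0 int) set" where
  "boundary_coset K n z = (\<lambda>b. b + z) ` ordered_boundaries K n"

lemma carrier_ordered_homology:
  "carrier (ordered_homology K n) = boundary_coset K n ` ordered_cycles K n"
  by (auto simp: ordered_homology_def FactGroup_def RCOSETS_def r_coset_def boundary_coset_def)

lemma boundary_coset_hom:
  assumes "face_closed K"
  shows "boundary_coset K n \<in> hom ((ordered_chain_group K n)\<lparr>carrier := ordered_cycles K n\<rparr>) (ordered_homology K n)"
proof -
  have eq: "boundary_coset K n = (\<lambda>a. ordered_boundaries K n #>\<^bsub>(ordered_chain_group K n)\<lparr>carrier := ordered_cycles K n\<rparr>\<^esub> a)"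
    by (auto simp: fun_eq_iff r_coset_def boundary_coset_def)
  show ?thesis
    unfolding eq ordered_homology_def
    by (rule normal.r_coset_hom_Mod[OF normal_boundaries[OF assms]])
qed

lemma ordered_chain_group_mono:
  "K \<subseteq> K' \<Longrightarrow> carrier (ordered_chain_group K n) \<subseteq> carrier (ordered_chain_group K' n)"
  by (rule subsetI) (simp add: ordered_chain_group_def ordered_simplices_def subset_iff)

lemma ordered_cycles_mono: "K \<subseteq> K' \<Longrightarrow> ordered_cycles K n \<subseteq> ordered_cycles K' n"
  using ordered_chain_group_mono[of K K' n] unfolding ordered_cycles_eq by blast

lemma ordered_boundaries_mono: "K \<subseteq> K' \<Longrightarrow> ordered_boundaries K n \<subseteq> ordered_boundaries K' n"
  using ordered_chain_group_mono[of K K' "Suc n"] unfolding ordered_boundaries_def by blast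

text \<open>Adding the boundaries of \<open>K\<close> to those of \<open>K'\<close> changes nothing,
  since they are among them and contain 0.\<close>

lemma inclusion_map_boundary_coset:
  assumes "face_closed K" "face_closed K'" "K \<subseteq> K'"
  shows "inclusion_map K' n (boundary_coset K n z) = boundary_coset K' n z"
proof -
  have "0 \<in> ordered_boundaries K n"
    using subgroup.one_closed[OF subgroup_ordered_boundaries[OF assms(1), of n]] by simp
  moreover have "a + b \<in> ordered_boundaries K' n"
    if "a \<in> ordered_boundaries K' n" "b \<in> ordered_boundaries K n" for a b
    using that ordered_boundaries_mono[OF assms(3), of n]
      subgroup.m_closed[OF subgroup_ordered_boundaries[OF assms(2), of n]] by fastforce
  ultimately show ?thesis
    unfolding inclusion_map_def set_mult_def boundary_coset_def
    by (auto simp: image_iff add.assoc[symmetric])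
qed

text \<open>The boundaries of the earlier complex drop out: a persistent class is a cycle of
  \<open>K i\<close> taken modulo the boundaries of \<open>K j\<close>.\<close>

lemma carrier_persistent_homology:
  assumes "face_closed (K i)" "face_closed (K j)" "K i \<subseteq> K j"
  shows "carrier (persistent_homology K n i j) = boundary_coset (K j) n ` ordered_cycles (K i) n"
  using inclusion_map_boundary_coset[OF assms]
  by (simp add: persistent_homology_def carrier_ordered_homology image_image)

text \<open>The carrier is the image of a subgroup, the cycles of \<open>K i\<close>, under the
  quotient homomorphism of the cycles of \<open>K j\<close>.\<close>

lemma comm_group_persistent_homology:
  assumes "face_closed (K i)" "face_closed (K j)" "K i \<subseteq> K j"
  shows "comm_group (persistent_homology K n i j)"
proof -
  let ?Z = "(ordered_chain_group (K j) n)\<lparr>carrier := ordered_cycles (K j) n\<rparr>"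
  have H: "comm_group (ordered_homology (K j) n)" and Z: "comm_group ?Z"
    by (rule comm_group_ordered_homology[OF assms(2)], rule comm_group_cycles[OF assms(2)])
  interpret C: comm_group "ordered_chain_group (K j) n"
    by (rule comm_group_ordered_chain_group)
  interpret Ci: comm_group "ordered_chain_group (K i) n"
    by (rule comm_group_ordered_chain_group)
  have hom: "group_hom ?Z (ordered_homology (K j) n) (boundary_coset (K j) n)"
    using H Z boundary_coset_hom[OF assms(2)] 
    by (simp add: group_hom_def group_hom_axioms_def comm_group_def)
  have "subgroup (ordered_cycles (K i) n) (ordered_chain_group (K j) n)"
  proof (rule C.subgroupI)
    show "ordered_cycles (K i) n \<subseteq> carrier (ordered_chain_group (K j) n)"
      using ordered_cycles_mono[OF assms(3), of n] by (auto simp: ordered_cycles_eq)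
    show "ordered_cycles (K i) n \<noteq> {}"
      using subgroup.one_closed[OF subgroup_ordered_cycles[OF assms(1)]] by blast
  next
    fix a assume a: "a \<in> ordered_cycles (K i) n"
    then have "inv\<^bsub>ordered_chain_group (K i) n\<^esub> a \<in> ordered_cycles (K i) n"
      by (rule subgroup.m_inv_closed[OF subgroup_ordered_cycles[OF assms(1)]])
    moreover have "a \<in> carrier (ordered_chain_group (K i) n)" "a \<in> carrier (ordered_chain_group (K j) n)"
      using a ordered_cycles_mono[OF assms(3), of n] by (auto simp: ordered_cycles_eq)
    \<comment> \<open>The two free abelian groups have different carriers, but in both the inverse
      of a chain is its negative.\<close>
    then have "inv\<^bsub>ordered_chain_group (K i) n\<^esub> a = inv\<^bsub>ordered_chain_group (K j) n\<^esub> a"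
      by (simp add: ordered_chain_group_def)
    ultimately show "inv\<^bsub>ordered_chain_group (K j) n\<^esub> a \<in> ordered_cycles (K i) n"
      by simp
  next
    fix a b assume "a \<in> ordered_cycles (K i) n" "b \<in> ordered_cycles (K i) n"
    then show "a \<otimes>\<^bsub>ordered_chain_group (K j) n\<^esub> b \<in> ordered_cycles (K i) n"
      using subgroup.m_closed[OF subgroup_ordered_cycles[OF assms(1)]] by fastforce
  qed
  then have "subgroup (ordered_cycles (K i) n) ?Z"
    using C.subgroup_incl subgroup_ordered_cycles[OF assms(2)] ordered_cycles_mono[OF assms(3)] by blast
  then have "subgroup (boundary_coset (K j) n ` ordered_cycles (K i) n) (ordered_homology (K j) n)"
    by (rule group_hom.subgroup_img_is_subgroup[OF hom])
  then show ?thesis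
    using comm_group.subgroup_comm_group[OF H] carrier_persistent_homology[OF assms, of n]
    by (simp add: persistent_homology_def)
qed

section \<open>Chain maps induced by maps of vertices\<close>

lemma frag_extend_frag_extend:
  "frag_extend f (frag_extend g c) = frag_extend (\<lambda>x. frag_extend f (g x)) c"
  by (rule frag_induction[of c UNIV]) (auto simp: frag_extend_diff)

definition chain_map :: "('v \<Rightarrow> 'w) \<Rightarrow> ('v list \<Rightarrow>\<^sub>0 int) \<Rightarrow> ('w list \<Rightarrow>\<^sub>0 int)" where
  "chain_map \<phi> = frag_extend (frag_of \<circ> map \<phi>)"

lemma chain_map_add: "chain_map \<phi> (a + b) = chain_map \<phi> a + chain_map \<phi> b"
  by (simp add: chain_map_def frag_extend_add)

text \<open>Simplices with repeated vertices are not set to zero in \<open>chain_map\<close>, so it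
  commutes with each face map for every \<open>\<phi>\<close>, injective or not.\<close>

lemma chain_map_boundary: "chain_map \<phi> (ordered_boundary n c) = ordered_boundary n (chain_map \<phi> c)"
  by (simp add: chain_map_def ordered_boundary_eq frag_extend_frag_extend frag_extend_sum frag_extend_cmul
        o_def map_delete_nth)

lemma chain_map_inverse:
  assumes "c \<in> carrier (ordered_chain_group K n)" "\<And>vs. vs \<in> K \<Longrightarrow> map \<psi> (map \<phi> vs) = vs"
  shows "chain_map \<psi> (chain_map \<phi> c) = c"
proof -
  have "chain_map \<psi> (chain_map \<phi> c) = frag_extend (\<lambda>vs. frag_of (map \<psi> (map \<phi> vs))) c"
    by (simp add: chain_map_def frag_extend_frag_extend o_def)
  also have "\<dots> = frag_extend frag_of c"
    using assms by (intro frag_extend_eq) (auto simp: ordered_chain_group_def ordered_simplices_def)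
  finally show ?thesis
    by (simp add: frag_expansion[symmetric])
qed

lemma chain_map_closed:
  assumes "c \<in> carrier (ordered_chain_group K n)" "map \<phi> ` K \<subseteq> K'"
  shows "chain_map \<phi> c \<in> carrier (ordered_chain_group K' n)"
proof -
  have "Poly_Mapping.keys (chain_map \<phi> c) \<subseteq> map \<phi> ` Poly_Mapping.keys c"
    using keys_frag_extend[of "frag_of \<circ> map \<phi>" c] by (simp add: chain_map_def keys_frag_of UNION_singleton_eq_range)
  also have "\<dots> \<subseteq> map \<phi> ` ordered_simplices K n"
    using assms(1) by (simp add: ordered_chain_group_def image_mono)
  also have "\<dots> \<subseteq> ordered_simplices K' n"
    using assms(2) by (auto simp: ordered_simplices_def)
  finally show ?thesis
    by (simp add: ordered_chain_group_def)
qed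

context
  fixes \<phi> :: "'v \<Rightarrow> 'w" and V :: "'v set"
  assumes inj: "inj_on \<phi> V"
begin

lemma chain_map_image:
  assumes "\<Union> (set ` K) \<subseteq> V"
  shows "chain_map \<phi> ` carrier (ordered_chain_group K n) = carrier (ordered_chain_group (map \<phi> ` K) n)"
proof
  show "chain_map \<phi> ` carrier (ordered_chain_group K n) \<subseteq> carrier (ordered_chain_group (map \<phi> ` K) n)"
    using chain_map_closed by blast
  have inv: "map (inv_into V \<phi>) (map \<phi> vs) = vs" if "vs \<in> K" for vs
    using that assms inj by (auto intro!: map_idI inv_into_f_f)
  show "carrier (ordered_chain_group (map \<phi> ` K) n) \<subseteq> chain_map \<phi> ` carrier (ordered_chain_group K n)"
  proof
    fix c assume c: "c \<in> carrier (ordered_chain_group (map \<phi> ` K) n)"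
    have "chain_map \<phi> (chain_map (inv_into V \<phi>) c) = c"
      using c by (rule chain_map_inverse) (use inv in force)
    moreover have "chain_map (inv_into V \<phi>) c \<in> carrier (ordered_chain_group K n)"
      using c by (rule chain_map_closed) (use inv in force)
    ultimately show "c \<in> chain_map \<phi> ` carrier (ordered_chain_group K n)"
      by (metis imageI)
  qed
qed

lemma inj_on_chain_map:
  assumes "\<Union> (set ` K) \<subseteq> V"
  shows "inj_on (chain_map \<phi>) (carrier (ordered_chain_group K n))"
proof (rule inj_on_inverseI)
  fix c assume "c \<in> carrier (ordered_chain_group K n)"
  then show "chain_map (inv_into V \<phi>) (chain_map \<phi> c) = c"
    by (rule chain_map_inverse) (use assms inj in \<open>auto intro!: map_idI inv_into_f_f\<close>)
qed

lemma face_closed_map: "face_closed K \<Longrightarrow> face_closed (map \<phi> ` K)"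
  by (auto simp: face_closed_def map_delete_nth[symmetric])

text \<open>Injectivity of the chain map in degree \<open>n - 1\<close> is what reflects cycles: a
  boundary that becomes 0 after mapping was 0 before.\<close>

lemma ordered_cycles_map:
  assumes "\<Union> (set ` K) \<subseteq> V" "face_closed K"
  shows "ordered_cycles (map \<phi> ` K) n = chain_map \<phi> ` ordered_cycles K n"
proof -
  have "ordered_boundary n (chain_map \<phi> c) = 0 \<longleftrightarrow> ordered_boundary n c = 0"
    if "c \<in> carrier (ordered_chain_group K n)" for c
  proof -
    have "chain_map \<phi> (ordered_boundary n c) = chain_map \<phi> 0 \<longleftrightarrow> ordered_boundary n c = 0"
      using inj_on_chain_map[OF assms(1), of "n - 1"] ordered_boundary_closed[OF assms(2) that]
      by (auto simp: inj_on_eq_iff ordered_chain_group_def)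
    then show ?thesis
      by (simp add: chain_map_boundary) (simp add: chain_map_def)
  qed
  then show ?thesis
    unfolding ordered_cycles_eq chain_map_image[OF assms(1), symmetric] by auto
qed

lemma ordered_boundaries_map:
  assumes "\<Union> (set ` K) \<subseteq> V"
  shows "ordered_boundaries (map \<phi> ` K) n = chain_map \<phi> ` ordered_boundaries K n"
  unfolding ordered_boundaries_def chain_map_image[OF assms(1), symmetric]
  by (simp add: image_image chain_map_boundary)

lemma boundary_coset_map:
  assumes "\<Union> (set ` K) \<subseteq> V"
  shows "boundary_coset (map \<phi> ` K) n (chain_map \<phi> z) = chain_map \<phi> ` boundary_coset K n z"
  unfolding boundary_coset_def ordered_boundaries_map[OF assms(1)]
  by (simp add: image_image chain_map_add)

text \<open>Taking images under \<open>chain_map\<close> carries cosets to cosets and sums of cosets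
  to sums, which gives an isomorphism of the persistent groups without choosing
  representatives.\<close>

lemma abelian_rank_persistent_homology_map:
  assumes "\<Union> (set ` K j) \<subseteq> V" "face_closed (K i)" "face_closed (K j)" "K i \<subseteq> K j"
    and K': "K' i = map \<phi> ` K i" "K' j = map \<phi> ` K j"
  shows "abelian_rank (persistent_homology K' n i j) = abelian_rank (persistent_homology K n i j)"
proof -
  let ?P = "persistent_homology K n i j" and ?P' = "persistent_homology K' n i j"
  have Ki: "\<Union> (set ` K i) \<subseteq> V"
    using assms by blast
  have fc': "face_closed (K' i)" "face_closed (K' j)" "K' i \<subseteq> K' j"
    using assms by (auto simp: face_closed_map)
  have car: "carrier ?P = boundary_coset (K j) n ` ordered_cycles (K i) n"
    by (rule carrier_persistent_homology) fact+
  have car': "carrier ?P' = ((`) (chain_map \<phi>)) ` carrier ?P"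
    unfolding carrier_persistent_homology[of K', OF fc'] car K' ordered_cycles_map[OF Ki assms(2)]
    by (simp add: image_image boundary_coset_map[OF assms(1)])
  \<comment> \<open>Cosets consist of chains of \<open>K j\<close>, on which
    \<open>chain_map\<close> is injective; hence distinct cosets have distinct images.\<close>
  have sub: "A \<subseteq> carrier (ordered_chain_group (K j) n)" if A: "A \<in> carrier ?P" for A
  proof -
    obtain z where z: "z \<in> ordered_cycles (K i) n" "A = boundary_coset (K j) n z"
      using A car by auto
    have "z \<in> carrier (ordered_chain_group (K j) n)"
      using z(1) ordered_cycles_mono[OF assms(4)] by (auto simp: ordered_cycles_eq)
    moreover have "b \<in> carrier (ordered_chain_group (K j) n)" if "b \<in> ordered_boundaries (K j) n" for b
      using that ordered_boundaries_subset_cycles[OF assms(3)] by (auto simp: ordered_cycles_eq)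
    ultimately show ?thesis
      using group.subgroup_self comm_group_ordered_chain_group[of "K j" n]
      by (auto simp: z(2) boundary_coset_def comm_group_def subgroup_def group.subgroup_self
           dest!: group.subgroup_self)
  qed
  have "((`) (chain_map \<phi>)) \<in> iso ?P ?P'"
  proof (rule isoI)
    show "((`) (chain_map \<phi>)) \<in> hom ?P ?P'"
    proof (rule homI)
      fix A assume "A \<in> carrier ?P"
      then show "chain_map \<phi> ` A \<in> carrier ?P'"
        using car' by blast
    next
      fix A B :: "('v list \<Rightarrow>\<^sub>0 int) set"
      show "chain_map \<phi> ` (A \<otimes>\<^bsub>?P\<^esub> B) = chain_map \<phi> ` A \<otimes>\<^bsub>?P'\<^esub> chain_map \<phi> ` B"
        by (auto simp: persistent_homology_def ordered_homology_def FactGroup_def set_mult_def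
              chain_map_add image_iff) blast+
    qed
    show "bij_betw ((`) (chain_map \<phi>)) (carrier ?P) (carrier ?P')"
      unfolding bij_betw_def car'
      using sub inj_on_chain_map[OF assms(1), of n] by (auto intro!: inj_onI simp: inj_on_image_eq_iff)
  qed
  moreover have "comm_group ?P" "comm_group ?P'"
    by (rule comm_group_persistent_homology; fact)+
  ultimately show ?thesis
    using abelian_rank_iso by metis
qed

lemma barcode_map:
  assumes "\<And>i. i \<le> m \<Longrightarrow> \<Union> (set ` K i) \<subseteq> V" "\<And>i. i \<le> m \<Longrightarrow> face_closed (K i)"
    and mono: "\<And>i j. i \<le> j \<Longrightarrow> j \<le> m \<Longrightarrow> K i \<subseteq> K j"
    and K': "\<And>i. i \<le> m \<Longrightarrow> K' i = map \<phi> ` K i"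
  shows "barcode K' m = barcode K m"
proof
  fix n
  have b: "persistent_betti K' n i j = persistent_betti K n i j" if "i \<le> j" "j \<le> m" for i j
    unfolding persistent_betti_def
    by (subst abelian_rank_persistent_homology_map) (use assms that in auto)
  \<comment> \<open>The Betti number read here has first index \<open>i - 1\<close>, which explains
    the bound \<open>i \<le> Suc j\<close>.\<close>
  have p: "persistent_betti_pred K' n i j = persistent_betti_pred K n i j" if "i \<le> Suc j" "j \<le> m" for i j
    using that by (auto simp: persistent_betti_pred_def b split: nat.split)
  show "barcode K' m n = barcode K m n"
    unfolding barcode_def interval_mult_def infinite_interval_mult_def
    by (intro arg_cong2[where f = "(+)"] sum.cong refl) (auto simp: b p)
qed

end

section \<open>Clique complexes of coloring quivers\<close>

lemma face_closed_clique_complex: "face_closed (clique_complex N Q)"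
proof -
  have "delete_nth i vs \<in> clique_complex N Q"
    if vs: "vs \<in> clique_complex N Q" "i < length vs" "2 \<le> length vs" for vs i
  proof -
    have nth: "delete_nth i vs ! k = vs ! (if k < i then k else Suc k)" if "k < length vs - 1" for k
      using that vs by (auto simp: delete_nth_def nth_append)
    have len: "length (delete_nth i vs) = length vs - 1"
      using vs length_delete_nth by blast
    have "set (delete_nth i vs) \<subseteq> set vs"
      using set_take_subset[of i vs] set_drop_subset[of "Suc i" vs] by (auto simp: delete_nth_def)
    moreover have "distinct (delete_nth i vs)"
      using vs set_take_disj_set_drop_if_distinct[of vs i "Suc i"]
      by (auto simp: delete_nth_def clique_complex_def)
    moreover have "N \<le> edge_count Q (delete_nth i vs ! k) (delete_nth i vs ! l)"
      if "l < length vs - 1" "k < l" for k l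
    proof -
      \<comment> \<open>Deletion reindexes by the increasing map that skips \<open>i\<close>, so an
        ordered pair of entries of the face is an ordered pair of entries of the simplex.\<close>
      have "(if k < i then k else Suc k) < (if l < i then l else Suc l)"
        "(if l < i then l else Suc l) < length vs"
        using that by auto
      then show ?thesis
        using vs that by (simp only: nth less_trans[of k l]) (auto simp: clique_complex_def)
    qed
    moreover have "delete_nth i vs \<noteq> []"
      using len vs by (cases "delete_nth i vs") auto
    ultimately show ?thesis
      using vs len unfolding clique_complex_def by auto
  qed
  then show ?thesis
    by (simp add: face_closed_def)
qed

lemma verts_coloring_quiver [simp]: "verts (coloring_quiver X S D) = colorings X D"
  by (simp add: coloring_quiver_def)

lemma edge_count_coloring_quiver:
  assumes "f \<in> colorings X D"
  shows "edge_count (coloring_quiver X S D) f g = card {\<alpha> \<in> S. compose (semi_arcs D) \<alpha> f = g}"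
proof -
  have "{a \<in> arcs (coloring_quiver X S D). tail (coloring_quiver X S D) a = f \<and> head (coloring_quiver X S D) a = g}
      = Pair f ` {\<alpha> \<in> S. compose (semi_arcs D) \<alpha> f = g}"
    using assms by (auto simp: coloring_quiver_def)
  then show ?thesis
    by (simp add: edge_count_def card_image inj_on_def)
qed

text \<open>An edge is labelled by an endomorphism, and \<open>\<phi>\<close> commutes with all of
  them, so it matches edges with the same label. All stages of the filtration use the same
  \<open>\<phi>\<close>; hence it identifies the whole nested families of complexes and not merely
  each stage.\<close>

proposition link_barcode_cong:
  assumes filt: "is_filtration m S (biquandle_End X)" and fin: "finite (carrier X)"
    and bij: "bij_betw \<phi> (colorings X D) (colorings X D')"
    and comp: "\<And>\<alpha> f. \<alpha> \<in> biquandle_End X \<Longrightarrow> f \<in> colorings X D \<Longrightarrow>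
      compose (semi_arcs D) \<alpha> f \<in> colorings X D \<and>
      \<phi> (compose (semi_arcs D) \<alpha> f) = compose (semi_arcs D') \<alpha> (\<phi> f)"
  shows "link_barcode N X m S D = link_barcode N X m S D'"
proof -
  let ?K = "\<lambda>i. clique_complex N (coloring_quiver X (S i) D)"
  let ?K' = "\<lambda>i. clique_complex N (coloring_quiver X (S i) D')"
  have inj: "inj_on \<phi> (colorings X D)" and im: "\<phi> ` colorings X D = colorings X D'"
    using bij by (auto simp: bij_betw_def)
  have mono: "S i \<subseteq> S j" if "i \<le> j" "j \<le> m" for i j
    using that
  proof (induction j)
    case (Suc j)
    then show ?case
      using filt unfolding is_filtration_def by (metis Suc_le_eq le_Suc_eq less_imp_le order_trans subset_refl)
  qed simp
  \<comment> \<open>Edge counts are values of \<open>card\<close>, which is monotone only on finite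
    sets; this is what makes the complexes nested.\<close>
  have finE: "finite (S i)" if "i \<le> m" for i
  proof -
    have "S i \<subseteq> carrier X \<rightarrow>\<^sub>E carrier X"
      using filt that unfolding is_filtration_def biquandle_End_def by blast
    then show ?thesis
      using finite_subset finite_PiE[OF fin, of "\<lambda>_. carrier X"] fin by blast
  qed
  have count: "edge_count (coloring_quiver X (S i) D') (\<phi> f) (\<phi> g) = edge_count (coloring_quiver X (S i) D) f g"
    if "i \<le> m" "f \<in> colorings X D" "g \<in> colorings X D" for i f g
  proof -
    have S: "S i \<subseteq> biquandle_End X"
      using filt that by (auto simp: is_filtration_def)
    have "\<phi> f \<in> colorings X D'"
      using im that by blast
    moreover have "compose (semi_arcs D') \<alpha> (\<phi> f) = \<phi> g \<longleftrightarrow> compose (semi_arcs D) \<alpha> f = g" if "\<alpha> \<in> S i" for \<alpha>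
      using comp[of \<alpha> f] that S \<open>f \<in> _\<close> \<open>g \<in> _\<close> inj by (metis inj_on_eq_iff subsetD)
    ultimately show ?thesis
      using that by (simp add: edge_count_coloring_quiver cong: conj_cong)
  qed
  have K': "?K' i = map \<phi> ` ?K i" if i: "i \<le> m" for i
  proof -
    have *: "map \<phi> vs \<in> ?K' i \<longleftrightarrow> vs \<in> ?K i" if "set vs \<subseteq> colorings X D" for vs
    proof -
      have "inj_on \<phi> (set vs)"
        using inj that inj_on_subset by blast
      moreover have "vs ! k \<in> colorings X D" if "k < length vs" for k
        using that \<open>set vs \<subseteq> _\<close> nth_mem by blast
      moreover have "\<phi> ` set vs \<subseteq> colorings X D'"
        using that im by blast
      ultimately show ?thesis
        using that by (simp add: clique_complex_def distinct_map count[OF i] cong: conj_cong)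
    qed
    show ?thesis
    proof
      show "map \<phi> ` ?K i \<subseteq> ?K' i"
      proof (rule image_subsetI)
        fix vs assume vs: "vs \<in> ?K i"
        then have "set vs \<subseteq> colorings X D"
          by (simp add: clique_complex_def)
        then show "map \<phi> vs \<in> ?K' i"
          using * vs by blast
      qed
      show "?K' i \<subseteq> map \<phi> ` ?K i"
      proof
        fix ws assume ws: "ws \<in> ?K' i"
        then have "set ws \<subseteq> \<phi> ` colorings X D"
          using im by (auto simp: clique_complex_def)
        then have "ws \<in> map \<phi> ` lists (colorings X D)"
          unfolding lists_image[symmetric] by (simp add: lists_eq_set)
        then obtain vs where vs: "set vs \<subseteq> colorings X D" "ws = map \<phi> vs"
          by auto
        then show "ws \<in> map \<phi> ` ?K i"
          using * ws by blast
      qed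
    qed
  qed
  have "barcode ?K' m = barcode ?K m"
  proof (rule barcode_map[OF inj])
    fix i assume "i \<le> m"
    show "\<Union> (set ` ?K i) \<subseteq> colorings X D"
      by (auto simp: clique_complex_def)
    show "face_closed (?K i)"
      by (rule face_closed_clique_complex)
    show "?K' i = map \<phi> ` ?K i"
      by (rule K') fact
  next
    fix i j assume "i \<le> j" "j \<le> m"
    have le: "edge_count (coloring_quiver X (S i) D) f g \<le> edge_count (coloring_quiver X (S j) D) f g"
      if "f \<in> colorings X D" for f g
      using mono[OF \<open>i \<le> j\<close> \<open>j \<le> m\<close>] finE[OF \<open>j \<le> m\<close>]
      unfolding edge_count_coloring_quiver[OF that] by (intro card_mono) auto
    show "?K i \<subseteq> ?K j"
    proof
      fix vs assume vs: "vs \<in> ?K i"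
      have "vs ! k \<in> colorings X D" if "k < length vs" for k
        using that vs by (auto simp: clique_complex_def subset_iff)
      then have "N \<le> edge_count (coloring_quiver X (S j) D) (vs ! k) (vs ! l)"
        if "k < l" "l < length vs" for k l
        using that vs order_trans[OF _ le] less_trans[OF that] by (simp add: clique_complex_def)
      then show "vs \<in> ?K j"
        using vs by (simp add: clique_complex_def)
    qed
  qed
  then show ?thesis
    by (simp add: link_barcode_def fun_eq_iff)
qed

section \<open>Colorings as locally constant functions\<close>

definition rot :: "circle_point \<Rightarrow> real \<Rightarrow> circle_point" where
  "rot p s = (fst p, snd p * cis s)"

lemma rot_0 [simp]: "rot p 0 = p"
  by (simp add: rot_def)

lemma rot_in_circles [simp]: "rot p s \<in> circles D \<longleftrightarrow> p \<in> circles D"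
  by (cases p) (auto simp: rot_def circles_def norm_mult)

lemma continuous_rot: "continuous_on A (rot p)"
  unfolding rot_def by (intro continuous_intros)

text \<open>Virtual double points count as regular, because a color runs through them
  unchanged.\<close>

definition regular_points :: "diagram \<Rightarrow> circle_point set" where
  "regular_points D = circles D - classical_points D"

lemma semi_arcs_eq: "semi_arcs D = components (regular_points D)"
  by (simp add: semi_arcs_def regular_points_def)

text \<open>Only a full turn returns to \<open>p\<close>, so nonzero angles below \<open>pi\<close>
  avoid it; any other point is avoided by continuity.\<close>

lemma eventually_rot_neq:
  assumes "p \<in> circles D"
  shows "\<forall>\<^sub>F s in at 0. rot p s \<noteq> q"
proof (cases "q = p")
  case True
  have z: "snd p \<noteq> 0"
    using assms by (auto simp: circles_def)
  have "\<forall>\<^sub>F s::real in at 0. \<bar>s\<bar> < pi \<and> s \<noteq> 0"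
    using pi_gt_zero unfolding eventually_at by (auto intro!: exI[of _ pi] simp: dist_real_def)
  then show ?thesis
  proof eventually_elim
    case (elim s)
    show ?case
    proof
      assume "rot p s = q"
      then have "snd p * cis s = snd p"
        using True by (metis rot_def snd_conv)
      then have "cis s = 1"
        using z by simp
      then have "sin s = 0"
        by (simp add: complex_eq_iff)
      then show False
        using elim sin_eq_0_pi[of s] unfolding abs_less_iff by linarith
    qed
  qed
next
  case False
  have "isCont (rot p) 0"
    using continuous_rot[of UNIV p] by (simp add: continuous_on_eq_continuous_at)
  then have "(rot p \<longlongrightarrow> p) (at 0)"
    by (metis isCont_def rot_0)
  then show ?thesis
    using False by (metis tendsto_imp_eventually_ne)
qed

lemma eventually_rot_notin:
  assumes "finite C" "p \<in> circles D"
  shows "\<forall>\<^sub>F s in at 0. rot p s \<notin> C"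
proof -
  have "\<forall>\<^sub>F s in at 0. \<forall>q\<in>C. rot p s \<noteq> q"
    using assms eventually_rot_neq by (intro eventually_ball_finite) auto
  then show ?thesis
    by (rule eventually_mono) auto
qed

lemma eventually_rot_regular:
  assumes "finite (classical_points D)" "p \<in> circles D"
  shows "\<forall>\<^sub>F s in at 0. rot p s \<in> regular_points D"
  using eventually_rot_notin[OF assms] assms(2) by (simp add: regular_points_def)

lemma eventually_at_0_cases:
  "(\<forall>\<^sub>F s in at (0::real). P s) \<longleftrightarrow>
     (\<forall>\<^sub>F s in at_right 0. P s) \<and> (\<forall>\<^sub>F s in at_right 0. P (- s))"
  using eventually_at_left_to_right[of P 0] by (auto simp: eventually_at_split)

lemma connected_component_rot:
  assumes "\<And>s. s \<in> {a<..<b} \<Longrightarrow> rot p s \<in> W" "s \<in> {a<..<b}" "t \<in> {a<..<b}"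
  shows "connected_component W (rot p s) (rot p t)"
  unfolding connected_component_def
proof (intro exI conjI)
  show "connected (rot p ` {a<..<b})"
    by (intro connected_continuous_image continuous_rot) simp
qed (use assms in auto)

lemma semi_arc_eq_component:
  assumes "A \<in> semi_arcs D" "p \<in> A"
  shows "A = connected_component_set (regular_points D) p" "p \<in> regular_points D"
  using assms unfolding semi_arcs_eq
  by (metis componentsE connected_component_eq, meson in_components_subset subsetD)

lemma component_in_semi_arcs:
  "p \<in> regular_points D \<Longrightarrow> connected_component_set (regular_points D) p \<in> semi_arcs D"
  by (simp add: semi_arcs_eq componentsI)

text \<open>Justifies the definite descriptions in \<open>outgoing\<close>
  (\<open>\<sigma> = 1\<close>) and \<open>incoming\<close> (\<open>\<sigma> = - 1\<close>).
  Classical points are finite in number, so a short one-sided arc at \<open>p\<close> avoids them;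
  it is connected and lies in a single component.\<close>

lemma ex1_semi_arc_germ:
  assumes "finite (classical_points D)" "p \<in> circles D" "\<sigma> = 1 \<or> \<sigma> = - 1"
  shows "\<exists>!A. A \<in> semi_arcs D \<and> (\<forall>\<^sub>F s in at_right 0. rot p (\<sigma> * s) \<in> A)"
proof -
  have "\<forall>\<^sub>F s in at_right 0. rot p (\<sigma> * s) \<in> regular_points D"
    using eventually_rot_regular[OF assms(1,2)] assms(3) by (auto simp: eventually_at_0_cases)
  then obtain b where b: "b > 0" "\<And>s. 0 < s \<Longrightarrow> s < b \<Longrightarrow> rot p (\<sigma> * s) \<in> regular_points D"
    by (auto simp: eventually_at_right_field)
  let ?A = "connected_component_set (regular_points D) (rot p (\<sigma> * (b / 2)))"
  have in_A: "rot p (\<sigma> * s) \<in> ?A" if "0 < s" "s < b" for s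
  proof -
    have "connected_component (regular_points D) (rot p (\<sigma> * (b / 2))) (rot p (\<sigma> * s))"
    \<comment> \<open>The open interval between 0 and \<open>\<sigma> * b\<close>, on whichever side
      of 0 it lies.\<close>
    proof (rule connected_component_rot[of "min 0 (\<sigma> * b)" "max 0 (\<sigma> * b)"])
      fix s assume "s \<in> {min 0 (\<sigma> * b)<..<max 0 (\<sigma> * b)}"
      then have "rot p (\<sigma> * (\<sigma> * s)) \<in> regular_points D"
        using assms(3) b by (intro b) auto
      then show "rot p s \<in> regular_points D"
        using assms(3) by auto
    qed (use assms(3) b that in auto)
    then show ?thesis by simp
  qed
  show ?thesis
  proof (rule ex1I[of _ ?A], intro conjI)
    show "?A \<in> semi_arcs D"
      using b(1) b(2)[of "b / 2"] by (intro component_in_semi_arcs) simp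
    show "\<forall>\<^sub>F s in at_right 0. rot p (\<sigma> * s) \<in> ?A"
      using in_A b by (auto simp: eventually_at_right_field)
  next
    fix A assume A: "A \<in> semi_arcs D \<and> (\<forall>\<^sub>F s in at_right 0. rot p (\<sigma> * s) \<in> A)"
    then have "\<forall>\<^sub>F s in at_right 0. rot p (\<sigma> * s) \<in> A"
      by blast
    then obtain c where c: "c > 0" "\<And>s. 0 < s \<Longrightarrow> s < c \<Longrightarrow> rot p (\<sigma> * s) \<in> A"
      by (auto simp: eventually_at_right_field)
    have s: "0 < min b c / 2" "min b c / 2 < b" "min b c / 2 < c"
      using b c by auto
    then have "rot p (\<sigma> * (min b c / 2)) \<in> A" "rot p (\<sigma> * (min b c / 2)) \<in> ?A"
      using c in_A by blast+
    moreover have "?A \<in> semi_arcs D"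
      using b(1) b(2)[of "b / 2"] by (intro component_in_semi_arcs) simp
    ultimately show "A = ?A"
      using A semi_arc_eq_component(1) by metis
  qed
qed

lemma outgoing_germ:
  assumes "finite (classical_points D)" "p \<in> circles D"
  shows "outgoing D p \<in> semi_arcs D" "\<forall>\<^sub>F s in at_right 0. rot p s \<in> outgoing D p"
  using theI'[OF ex1_semi_arc_germ[OF assms, of 1]] by (simp_all add: outgoing_def rot_def)

lemma incoming_germ:
  assumes "finite (classical_points D)" "p \<in> circles D"
  shows "incoming D p \<in> semi_arcs D" "\<forall>\<^sub>F s in at_right 0. rot p (- s) \<in> incoming D p"
  using theI'[OF ex1_semi_arc_germ[OF assms, of "- 1"]] by (simp_all add: incoming_def rot_def)

text \<open>
  The two semi-arcs of a strand at a crossing are indexed by the side of the other strand on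
  which they lie, \<open>True\<close> being right; \<open>u\<close> belongs to the under-strand.
\<close>

definition crossing_rel :: "('a, 'm) biquandle_ops_scheme \<Rightarrow> (bool \<Rightarrow> 'a) \<Rightarrow> (bool \<Rightarrow> 'a) \<Rightarrow> bool" where
  "crossing_rel X u v \<longleftrightarrow>
     u False = u True \<unrhd>\<^bsub>X\<^esub> v True \<and> v False = v True \<rhd>\<^bsub>X\<^esub> u True"

text \<open>The test made in \<open>right_arc\<close>: if it holds, the outgoing semi-arc at
  \<open>p\<close> is the one to the right of the strand through \<open>q\<close>.\<close>

definition leaves_right :: "diagram \<Rightarrow> circle_point \<Rightarrow> circle_point \<Rightarrow> bool" where
  "leaves_right D p q \<longleftrightarrow> det2 (velocity D q) (velocity D p) < 0"

text \<open>The flag \<open>b\<close> names the side on which the strand leaves the crossing, so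
  \<open>u b\<close> is the color after \<open>p\<close> and \<open>u (\<not> b)\<close> the color
  before it.\<close>

definition has_germs :: "(circle_point \<Rightarrow> 'a) \<Rightarrow> circle_point \<Rightarrow> (bool \<Rightarrow> 'a) \<Rightarrow> bool \<Rightarrow> bool" where
  "has_germs F p u b \<longleftrightarrow>
     (\<forall>\<^sub>F s in at_right 0. F (rot p s) = u b) \<and> (\<forall>\<^sub>F s in at_right 0. F (rot p (- s)) = u (\<not> b))"

definition crossing_ok ::
  "('a, 'm) biquandle_ops_scheme \<Rightarrow> diagram \<Rightarrow> (circle_point \<Rightarrow> 'a) \<Rightarrow> circle_point \<Rightarrow> circle_point \<Rightarrow> bool" where
  "crossing_ok X D F p q \<longleftrightarrow> (\<exists>u v. crossing_rel X u v \<and>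
     has_germs F p u (leaves_right D p q) \<and> has_germs F q v (leaves_right D q p))"

text \<open>Local constancy is tested along rotations only;
  \<open>eventually_at_circle_point\<close> turns this into the topological notion. Values at
  classical points are fixed to be \<open>undefined\<close>, so that functions agreeing on regular
  points are equal.\<close>

definition point_colorings :: "('a, 'm) biquandle_ops_scheme \<Rightarrow> diagram \<Rightarrow> (circle_point \<Rightarrow> 'a) set" where
  "point_colorings X D = {F \<in> regular_points D \<rightarrow>\<^sub>E carrier X.
     (\<forall>p\<in>regular_points D. \<forall>\<^sub>F s in at 0. F (rot p s) = F p) \<and>
     (\<forall>p q. crosses D p q \<and> level D p = Under \<and> level D q = Over \<longrightarrow> crossing_ok X D F p q)}"

definition point_coloring :: "diagram \<Rightarrow> (circle_point set \<Rightarrow> 'a) \<Rightarrow> circle_point \<Rightarrow> 'a" where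
  "point_coloring D f = (\<lambda>p\<in>regular_points D. f (connected_component_set (regular_points D) p))"

section \<open>Passage between colorings of semi-arcs and colorings of points\<close>

lemma point_coloring_semi_arc:
  assumes "A \<in> semi_arcs D" "p \<in> A"
  shows "point_coloring D f p = f A"
  using semi_arc_eq_component[OF assms] by (simp add: point_coloring_def)

text \<open>One-sided filters are nontrivial, so eventual values are unique. The existential
  quantifier in \<open>crossing_ok\<close> therefore ranges over at most one pair of germs, and a
  known pair decides the condition.\<close>

lemma has_germs_unique:
  assumes "has_germs F p u b" "has_germs F p v b"
  shows "u = v"
proof -
  have const: "x = y" if "\<forall>\<^sub>F s in at_right (0::real). G s = x" "\<forall>\<^sub>F s in at_right (0::real). G s = y"
    for G and x y :: 'a
  proof -
    have "\<forall>\<^sub>F s in at_right (0::real). x = y"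
      using that by (rule eventually_elim2) simp
    then show ?thesis
      by (simp add: eventually_const_iff)
  qed
  have "u b = v b" "u (\<not> b) = v (\<not> b)"
    using assms unfolding has_germs_def by (auto intro: const)
  then have "u c = v c" for c
    by (cases "c = b") auto
  then show ?thesis ..
qed

lemma has_germs_point_coloring:
  assumes "finite (classical_points D)" "p \<in> circles D"
  shows "has_germs (point_coloring D f) p
    (\<lambda>b. if b then f (right_arc D p q) else f (left_arc D p q)) (leaves_right D p q)"
proof -
  have "\<forall>\<^sub>F s in at_right 0. point_coloring D f (rot p s) = f (outgoing D p)"
    using outgoing_germ(2)[OF assms] by (rule eventually_mono) (rule point_coloring_semi_arc[OF outgoing_germ(1)[OF assms]])
  moreover have "\<forall>\<^sub>F s in at_right 0. point_coloring D f (rot p (- s)) = f (incoming D p)"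
    using incoming_germ(2)[OF assms] by (rule eventually_mono) (rule point_coloring_semi_arc[OF incoming_germ(1)[OF assms]])
  ultimately show ?thesis
    by (simp add: has_germs_def right_arc_def left_arc_def leaves_right_def)
qed

lemma finite_classical_points: "virtual_link_diagram D \<Longrightarrow> finite (classical_points D)"
  by (auto simp: virtual_link_diagram_def classical_points_def)

lemma crosses_in_circles: "crosses D p q \<Longrightarrow> p \<in> circles D \<and> q \<in> circles D"
  by (simp add: crosses_def)

lemma crossing_ok_point_coloring_iff:
  assumes "finite (classical_points D)" "crosses D p q"
  shows "crossing_ok X D (point_coloring D f) p q \<longleftrightarrow>
    f (left_arc D p q) = f (right_arc D p q) \<unrhd>\<^bsub>X\<^esub> f (right_arc D q p) \<and>
    f (left_arc D q p) = f (right_arc D q p) \<rhd>\<^bsub>X\<^esub> f (right_arc D p q)"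
  (is "_ \<longleftrightarrow> ?R")
proof -
  let ?u = "\<lambda>p q b. if b then f (right_arc D p q) else f (left_arc D p q)"
  have g: "has_germs (point_coloring D f) p (?u p q) (leaves_right D p q)"
    "has_germs (point_coloring D f) q (?u q p) (leaves_right D q p)"
    using has_germs_point_coloring assms crosses_in_circles by metis+
  have "crossing_ok X D (point_coloring D f) p q \<longleftrightarrow> crossing_rel X (?u p q) (?u q p)"
    unfolding crossing_ok_def using g has_germs_unique by metis
  also have "\<dots> \<longleftrightarrow> ?R"
    by (simp add: crossing_rel_def)
  finally show ?thesis .
qed

lemma point_coloring_in_point_colorings:
  assumes "finite (classical_points D)" "f \<in> colorings X D"
  shows "point_coloring D f \<in> point_colorings X D"
  unfolding point_colorings_def
proof (intro CollectI conjI ballI allI impI)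
  have f: "f A \<in> carrier X" if "A \<in> semi_arcs D" for A
    using assms(2) that by (auto simp: colorings_def)
  show "point_coloring D f \<in> regular_points D \<rightarrow>\<^sub>E carrier X"
    by (simp add: point_coloring_def f component_in_semi_arcs)
next
  fix p assume p: "p \<in> regular_points D"
  then have pc: "p \<in> circles D"
    by (simp add: regular_points_def)
  obtain d where d: "d > 0" "\<And>s. s \<noteq> 0 \<Longrightarrow> \<bar>s\<bar> < d \<Longrightarrow> rot p s \<in> regular_points D"
    using eventually_rot_regular[OF assms(1) pc] by (auto simp: eventually_at dist_real_def)
  have reg: "rot p s \<in> regular_points D" if "\<bar>s\<bar> < d" for s
    using d(2)[of s] p that by (cases "s = 0") auto
  have "point_coloring D f (rot p s) = point_coloring D f p" if "\<bar>s\<bar> < d" for s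
  proof -
    have "connected_component (regular_points D) (rot p s) (rot p 0)"
      by (rule connected_component_rot[of "- d" d]) (use reg that d in auto)
    then have "connected_component_set (regular_points D) (rot p s) = connected_component_set (regular_points D) p"
      using connected_component_eq_eq[of "regular_points D" "rot p s" p] reg[OF that] p by simp
    then show ?thesis
      using reg[OF that] p by (simp add: point_coloring_def)
  qed
  then show "\<forall>\<^sub>F s in at 0. point_coloring D f (rot p s) = point_coloring D f p"
    using d(1) by (auto simp: eventually_at dist_real_def)
next
  fix p q assume "crosses D p q \<and> level D p = Under \<and> level D q = Over"
  then show "crossing_ok X D (point_coloring D f) p q"
    using crossing_ok_point_coloring_iff[OF assms(1)] assms(2) unfolding colorings_def by blast
qed

text \<open>Points of the circles near \<open>p\<close> lie on the same circle, because the
  component index is discrete, and are rotations of \<open>p\<close> by the argument of a quotient.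
  That argument is small since \<open>Arg\<close> is continuous at 1.\<close>

lemma eventually_at_circle_point:
  assumes "p \<in> circles D" "\<forall>\<^sub>F s in at 0. P (rot p s)" "P p"
  shows "eventually P (at p within circles D)"
proof -
  obtain k z where p: "p = (k, z)" "norm z = 1"
    using assms(1) by (auto simp: circles_def)
  obtain d where d: "d > 0" "\<And>s. s \<noteq> 0 \<Longrightarrow> \<bar>s\<bar> < d \<Longrightarrow> P (rot p s)"
    using assms(2) by (auto simp: eventually_at dist_real_def)
  have P: "P (rot p s)" if "\<bar>s\<bar> < d" for s
    using d(2)[of s] assms(3) that by (cases "s = 0") auto
  have fst: "\<forall>\<^sub>F q in at p within circles D. fst q = k"
  proof -
    have "((\<lambda>q. fst q) \<longlongrightarrow> fst p) (at p within circles D)"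
      by (intro tendsto_fst tendsto_ident_at)
    moreover have "open {k}"
      by (rule open_discrete)
    ultimately show ?thesis
      using topological_tendstoD[of fst "fst p" _ "{k}"] p by simp
  qed
  have "((\<lambda>q. snd q / z) \<longlongrightarrow> snd p / z) (at p within circles D)"
    using p by (intro tendsto_intros) auto
  moreover have "snd p / z = 1"
    using p by auto
  ultimately have "((\<lambda>q. snd q / z) \<longlongrightarrow> 1) (at p within circles D)"
    by simp
  moreover have "isCont Arg 1"
    by (intro continuous_at_Arg) auto
  ultimately have "((\<lambda>q. Arg (snd q / z)) \<longlongrightarrow> Arg 1) (at p within circles D)"
    by (rule isCont_tendsto_compose[rotated])
  then have "((\<lambda>q. Arg (snd q / z)) \<longlongrightarrow> 0) (at p within circles D)"
    by simp
  then have "\<forall>\<^sub>F q in at p within circles D. \<bar>Arg (snd q / z)\<bar> < d"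
    using d(1) by (auto dest: tendstoD[of _ _ _ d] simp: dist_real_def)
  moreover have "\<forall>\<^sub>F q in at p within circles D. q \<in> circles D"
    by (auto simp: eventually_at_filter)
  ultimately show ?thesis
    using fst
  proof eventually_elim
    case (elim q)
    have n: "norm (snd q) = 1"
      using elim by (auto simp: circles_def)
    then have n': "norm (snd q / z) = 1" "snd q / z \<noteq> 0"
      using p by (auto simp: norm_divide)
    then have "cis (Arg (snd q / z)) = snd q / z"
      by (simp add: cis_Arg sgn_div_norm)
    then have "rot p (Arg (snd q / z)) = q"
      using p elim by (auto simp: rot_def prod_eq_iff)
    then show ?case
      using P elim by metis
  qed
qed

text \<open>A locally constant function is constant on each semi-arc, which is connected and
  nonempty; its value at any chosen point serves as the color.\<close>

lemma point_coloring_surj: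
  assumes "finite (classical_points D)" "F \<in> point_colorings X D"
  shows "\<exists>f\<in>colorings X D. point_coloring D f = F"
proof -
  have const: "F p = F q" if "A \<in> semi_arcs D" "p \<in> A" "q \<in> A" for A p q
  proof (rule connected_local_const[of A])
    show "connected A"
      using that in_components_connected by (auto simp: semi_arcs_eq)
    show "\<forall>p\<in>A. \<forall>\<^sub>F q in at p within A. F p = F q"
    proof
      fix p assume "p \<in> A"
      then have p: "p \<in> regular_points D"
        using semi_arc_eq_component(2) that by blast
      have "A \<subseteq> circles D"
        using that in_components_subset by (fastforce simp: semi_arcs_eq regular_points_def)
      have "\<forall>\<^sub>F q in at p within circles D. F p = F q"
        using assms(2) p by (intro eventually_at_circle_point) (auto simp: point_colorings_def regular_points_def eq_commute)
      then show "\<forall>\<^sub>F q in at p within A. F p = F q"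
        using at_le[OF \<open>A \<subseteq> circles D\<close>] filter_leD by blast
    qed
  qed (use that in auto)
  define f where "f = (\<lambda>A\<in>semi_arcs D. F (SOME p. p \<in> A))"
  have f: "f A = F p" if "A \<in> semi_arcs D" "p \<in> A" for A p
    using const[OF that(1) someI[of "\<lambda>p. p \<in> A"]] that by (auto simp: f_def)
  have pc: "point_coloring D f = F"
  proof
    fix p
    show "point_coloring D f p = F p"
    proof (cases "p \<in> regular_points D")
      case True
      then have "f (connected_component_set (regular_points D) p) = F p"
        by (intro f component_in_semi_arcs) simp_all
      then show ?thesis
        using True by (simp add: point_coloring_def)
    next
      case False
      then show ?thesis
        using assms(2) PiE_arb[of F "regular_points D" "\<lambda>_. carrier X" p]
        by (simp add: point_coloring_def point_colorings_def)
    qed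
  qed
  have "f \<in> colorings X D"
    unfolding colorings_def
  proof (intro CollectI conjI allI impI)
    have "f A \<in> carrier X" if A: "A \<in> semi_arcs D" for A
    proof -
      obtain p where "p \<in> A"
        using A in_components_nonempty semi_arcs_eq by blast
      then show ?thesis
        using f[OF A] semi_arc_eq_component(2)[OF A] assms(2)
        by (metis (no_types, lifting) PiE_mem mem_Collect_eq point_colorings_def)
    qed
    then show "f \<in> semi_arcs D \<rightarrow>\<^sub>E carrier X"
      by (auto simp: f_def)
  next
    fix p q assume *: "crosses D p q \<and> level D p = Under \<and> level D q = Over"
    then have "crossing_ok X D (point_coloring D f) p q"
      using assms(2) unfolding pc point_colorings_def by blast
    then show "f (left_arc D p q) = f (right_arc D p q) \<unrhd>\<^bsub>X\<^esub> f (right_arc D q p)"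
      "f (left_arc D q p) = f (right_arc D q p) \<rhd>\<^bsub>X\<^esub> f (right_arc D p q)"
      using crossing_ok_point_coloring_iff[OF assms(1)] * by blast+
  qed
  then show ?thesis
    using pc by blast
qed

lemma inj_on_point_coloring: "inj_on (point_coloring D) (colorings X D)"
proof (rule inj_onI)
  fix f g assume fg: "f \<in> colorings X D" "g \<in> colorings X D" "point_coloring D f = point_coloring D g"
  show "f = g"
  proof (rule PiE_ext[of f "semi_arcs D" "\<lambda>_. carrier X" g])
    fix A assume A: "A \<in> semi_arcs D"
    then obtain p where "p \<in> A"
      using in_components_nonempty semi_arcs_eq by blast
    then show "f A = g A"
      using point_coloring_semi_arc[OF A] fg(3) by metis
  qed (use fg in \<open>simp_all add: colorings_def\<close>)
qed

lemma point_coloring_compose: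
  "p \<in> regular_points D \<Longrightarrow> point_coloring D (compose (semi_arcs D) \<alpha> f) p = \<alpha> (point_coloring D f p)"
  by (simp add: point_coloring_def compose_def component_in_semi_arcs)

lemma compose_in_colorings:
  assumes "finite (classical_points D)" "f \<in> colorings X D" "\<alpha> \<in> biquandle_End X"
  shows "compose (semi_arcs D) \<alpha> f \<in> colorings X D"
  unfolding colorings_def
proof (intro CollectI conjI allI impI)
  have f: "f A \<in> carrier X" if "A \<in> semi_arcs D" for A
    using assms(2) that by (auto simp: colorings_def)
  have \<alpha>: "\<alpha> x \<in> carrier X" if "x \<in> carrier X" for x
    using assms(3) that by (auto simp: biquandle_End_def)
  show "compose (semi_arcs D) \<alpha> f \<in> semi_arcs D \<rightarrow>\<^sub>E carrier X"
    by (auto simp: compose_def f \<alpha>)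
  fix p q assume *: "crosses D p q \<and> level D p = Under \<and> level D q = Over"
  then have "p \<in> circles D" "q \<in> circles D"
    using crosses_in_circles by blast+
  then have arcs: "right_arc D p q \<in> semi_arcs D" "right_arc D q p \<in> semi_arcs D"
    "left_arc D p q \<in> semi_arcs D" "left_arc D q p \<in> semi_arcs D"
    using outgoing_germ(1) incoming_germ(1) assms(1) by (simp_all add: right_arc_def left_arc_def)
  have "f (left_arc D p q) = f (right_arc D p q) \<unrhd>\<^bsub>X\<^esub> f (right_arc D q p)"
    "f (left_arc D q p) = f (right_arc D q p) \<rhd>\<^bsub>X\<^esub> f (right_arc D p q)"
    using assms(2) * unfolding colorings_def by blast+
  then show "compose (semi_arcs D) \<alpha> f (left_arc D p q)
      = compose (semi_arcs D) \<alpha> f (right_arc D p q) \<unrhd>\<^bsub>X\<^esub> compose (semi_arcs D) \<alpha> f (right_arc D q p)"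
    "compose (semi_arcs D) \<alpha> f (left_arc D q p)
      = compose (semi_arcs D) \<alpha> f (right_arc D q p) \<rhd>\<^bsub>X\<^esub> compose (semi_arcs D) \<alpha> f (right_arc D p q)"
    using arcs f assms(3) by (simp_all add: compose_def biquandle_End_def)
qed

text \<open>\<open>Z\<close> is a set of test points and \<open>\<pi>\<close> sends them to the
  other diagram. Colorings are determined by their values at the test points, and the two diagrams
  realize the same values; agreement there is then the graph of a bijection. For a Reidemeister move
  \<open>\<pi>\<close> is the identity on points outside the move, for an isotopy it is the
  transport of all regular points.\<close>

proposition link_barcode_eqI:
  assumes filt: "is_filtration m S (biquandle_End X)" and fin: "finite (carrier X)"
    and vld: "virtual_link_diagram D" "virtual_link_diagram D'"
    and Z: "Z \<subseteq> regular_points D" "\<pi> ` Z \<subseteq> regular_points D'"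
    and inj: "\<And>F G. \<lbrakk>F \<in> point_colorings X D; G \<in> point_colorings X D; \<forall>z\<in>Z. F z = G z\<rbrakk> \<Longrightarrow> F = G"
    and inj': "\<And>F G. \<lbrakk>F \<in> point_colorings X D'; G \<in> point_colorings X D'; \<forall>z\<in>Z. F (\<pi> z) = G (\<pi> z)\<rbrakk> \<Longrightarrow> F = G"
    and ex: "\<And>F. F \<in> point_colorings X D \<Longrightarrow> \<exists>G\<in>point_colorings X D'. \<forall>z\<in>Z. F z = G (\<pi> z)"
    and ex': "\<And>G. G \<in> point_colorings X D' \<Longrightarrow> \<exists>F\<in>point_colorings X D. \<forall>z\<in>Z. F z = G (\<pi> z)"
  shows "link_barcode N X m S D = link_barcode N X m S D'"
proof -
  have finD: "finite (classical_points D)" "finite (classical_points D')"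
    using vld finite_classical_points by blast+
  \<comment> \<open>The relation compares values pointwise, so applying an endomorphism to both
    sides preserves it. This is the compatibility required of the bijection extracted from
    it.\<close>
  define R where "R f g \<longleftrightarrow> (\<forall>z\<in>Z. point_coloring D f z = point_coloring D' g (\<pi> z))" for f g :: "circle_point set \<Rightarrow> 'a"
  have ex1: "\<exists>!g. g \<in> colorings X D' \<and> R f g" if f: "f \<in> colorings X D" for f
  proof -
    obtain G where "G \<in> point_colorings X D'" "\<forall>z\<in>Z. point_coloring D f z = G (\<pi> z)"
      using ex[OF point_coloring_in_point_colorings[OF finD(1) f]] by blast
    then obtain g where g: "g \<in> colorings X D'" "R f g"
      unfolding R_def using point_coloring_surj[OF finD(2)] by metis
    moreover have "g' = g" if "g' \<in> colorings X D'" "R f g'" for g'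
    proof -
      have "point_coloring D' g' = point_coloring D' g"
        using that g finD(2) by (intro inj' point_coloring_in_point_colorings) (auto simp: R_def)
      then show ?thesis
        using inj_on_point_coloring that g by (metis inj_onD)
    qed
    ultimately show ?thesis by blast
  qed
  have ex1': "\<exists>!f. f \<in> colorings X D \<and> R f g" if g: "g \<in> colorings X D'" for g
  proof -
    obtain F where "F \<in> point_colorings X D" "\<forall>z\<in>Z. F z = point_coloring D' g (\<pi> z)"
      using ex'[OF point_coloring_in_point_colorings[OF finD(2) g]] by blast
    then obtain f where f: "f \<in> colorings X D" "R f g"
      unfolding R_def using point_coloring_surj[OF finD(1)] by metis
    moreover have "f' = f" if "f' \<in> colorings X D" "R f' g" for f'
    proof -
      have "point_coloring D f' = point_coloring D f"
        using that f finD(1) by (intro inj point_coloring_in_point_colorings) (auto simp: R_def)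
      then show ?thesis
        using inj_on_point_coloring that f by (metis inj_onD)
    qed
    ultimately show ?thesis by blast
  qed
  define \<phi> where "\<phi> f = (THE g. g \<in> colorings X D' \<and> R f g)" for f
  have \<phi>: "\<phi> f \<in> colorings X D'" "R f (\<phi> f)" if "f \<in> colorings X D" for f
    using theI'[OF ex1[OF that]] unfolding \<phi>_def by blast+
  have \<phi>_eq: "\<phi> f = g" if "f \<in> colorings X D" "g \<in> colorings X D'" "R f g" for f g
    using \<phi> ex1 that by blast
  show ?thesis
  proof (rule link_barcode_cong[OF filt fin])
    show "bij_betw \<phi> (colorings X D) (colorings X D')"
    proof (rule bij_betw_imageI)
      show "inj_on \<phi> (colorings X D)"
        using \<phi> ex1' by (metis inj_onI)
      show "\<phi> ` colorings X D = colorings X D'"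
      proof
        show "colorings X D' \<subseteq> \<phi> ` colorings X D"
          using ex1' \<phi>_eq by (metis imageI subsetI)
      qed (use \<phi> in blast)
    qed
  next
    fix \<alpha> f assume *: "\<alpha> \<in> biquandle_End X" "f \<in> colorings X D"
    have "R (compose (semi_arcs D) \<alpha> f) (compose (semi_arcs D') \<alpha> (\<phi> f))"
      unfolding R_def
    proof
      fix z assume z: "z \<in> Z"
      then have "z \<in> regular_points D" "\<pi> z \<in> regular_points D'"
        using Z by blast+
      then show "point_coloring D (compose (semi_arcs D) \<alpha> f) z
          = point_coloring D' (compose (semi_arcs D') \<alpha> (\<phi> f)) (\<pi> z)"
        using \<phi>(2)[OF *(2)] z by (simp add: point_coloring_compose R_def)
    qed
    then show "compose (semi_arcs D) \<alpha> f \<in> colorings X D \<and>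
        \<phi> (compose (semi_arcs D) \<alpha> f) = compose (semi_arcs D') \<alpha> (\<phi> f)"
      using * \<phi> finD by (auto intro!: \<phi>_eq compose_in_colorings)
  qed
qed

section \<open>Local pictures\<close>

text \<open>Continuity brings \<open>\<theta> s\<close> close to \<open>\<theta> t\<close>; for the
  converse every value slightly above \<open>\<theta> t\<close> is attained by the intermediate
  value theorem.\<close>

lemma eventually_strict_mono_at_right:
  fixes \<theta> :: "real \<Rightarrow> real"
  assumes "continuous_on {-1..1} \<theta>" "strict_mono_on {-1..1} \<theta>" "t \<in> {-1<..<1}"
  shows "(\<forall>\<^sub>F s in at_right 0. Q (\<theta> t + s)) \<longleftrightarrow> (\<forall>\<^sub>F s in at_right t. Q (\<theta> s))"
proof
  assume "\<forall>\<^sub>F s in at_right 0. Q (\<theta> t + s)"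
  then obtain b where b: "b > 0" "\<And>s. 0 < s \<Longrightarrow> s < b \<Longrightarrow> Q (\<theta> t + s)"
    by (auto simp: eventually_at_right_field)
  have "continuous_on {-1<..<1} \<theta>"
    using assms(1) by (rule continuous_on_subset) auto
  then have "isCont \<theta> t"
    using assms(3) by (simp add: continuous_on_eq_continuous_at)
  then have "(\<theta> \<longlongrightarrow> \<theta> t) (at_right t)"
    by (simp add: isCont_def filterlim_at_split)
  then have "\<forall>\<^sub>F s in at_right t. \<theta> s < \<theta> t + b"
    using b by (intro order_tendstoD) auto
  moreover have "\<forall>\<^sub>F s in at_right t. t < s \<and> s < 1"
    using assms(3) by (auto simp: eventually_at_right_field)
  ultimately show "\<forall>\<^sub>F s in at_right t. Q (\<theta> s)"
  proof eventually_elim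
    case (elim s)
    then have "\<theta> t < \<theta> s"
      using assms(2,3) by (intro strict_mono_onD[of "{-1..1}" \<theta>]) auto
    then show ?case
      using b(2)[of "\<theta> s - \<theta> t"] elim by simp
  qed
next
  assume "\<forall>\<^sub>F s in at_right t. Q (\<theta> s)"
  then obtain c' where c': "c' > t" "\<And>s. t < s \<Longrightarrow> s < c' \<Longrightarrow> Q (\<theta> s)"
    by (auto simp: eventually_at_right_field)
  \<comment> \<open>Keeps the right neighbourhood of \<open>t\<close> inside the interval on which
    \<open>\<theta>\<close> is controlled.\<close>
  define c where "c = min c' 1"
  have c: "t < c" "c \<le> 1" "\<And>s. t < s \<Longrightarrow> s < c \<Longrightarrow> Q (\<theta> s)"
    using c' assms(3) by (auto simp: c_def)
  have lt: "\<theta> t < \<theta> c"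
    using c assms by (intro strict_mono_onD[of "{-1..1}" \<theta>]) auto
  have "Q (\<theta> t + s)" if "0 < s" "s < \<theta> c - \<theta> t" for s
  proof -
    have "continuous_on {t..c} \<theta>"
      using assms(1) by (rule continuous_on_subset) (use c assms(3) in auto)
    then obtain x where x: "t \<le> x" "x \<le> c" "\<theta> x = \<theta> t + s"
      using IVT'[of \<theta> t "\<theta> t + s" c] \<open>0 < s\<close> \<open>s < \<theta> c - \<theta> t\<close> c(1) by auto
    then have "x \<noteq> t" "x \<noteq> c"
      using that by auto
    then show ?thesis
      using c(3)[of x] x by auto
  qed
  then show "\<forall>\<^sub>F s in at_right 0. Q (\<theta> t + s)"
    using lt by (auto simp: eventually_at_right_field intro!: exI[of _ "\<theta> c - \<theta> t"])
qed

text \<open>Obtained from the right-hand version for the point reflection of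
  \<open>\<theta>\<close>, which is again continuous and increasing.\<close>

lemma eventually_strict_mono_at_left:
  fixes \<theta> :: "real \<Rightarrow> real"
  assumes "continuous_on {-1..1} \<theta>" "strict_mono_on {-1..1} \<theta>" "t \<in> {-1<..<1}"
  shows "(\<forall>\<^sub>F s in at_right 0. Q (\<theta> t - s)) \<longleftrightarrow> (\<forall>\<^sub>F s in at_left t. Q (\<theta> s))"
proof -
  have "continuous_on {-1..1} (\<lambda>x. - \<theta> (- x))"
    by (intro continuous_intros continuous_on_compose2[OF assms(1)]) auto
  moreover have "strict_mono_on {-1..1} (\<lambda>x. - \<theta> (- x))"
    by (intro strict_mono_onI) (use assms(2) in \<open>auto intro!: strict_mono_onD[of "{-1..1}" \<theta>]\<close>)
  ultimately have "(\<forall>\<^sub>F s in at_right 0. Q (- (- \<theta> (- (- t)) + s))) \<longleftrightarrow> (\<forall>\<^sub>F s in at_right (- t). Q (- (- \<theta> (- s))))"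
    using assms(3) by (intro eventually_strict_mono_at_right) auto
  then show ?thesis
    using eventually_at_left_to_right[of "\<lambda>s. Q (\<theta> s)" t] by simp
qed

section \<open>Determinants and crossings of strands\<close>

lemma det2_scaleR: "det2 (a *\<^sub>R x) (b *\<^sub>R y) = a * b * det2 x y"
  by (simp add: det2_def algebra_simps)

lemma det2_commute: "det2 x y = - det2 y x"
  by (simp add: det2_def)

text \<open>Multiplicativity of the determinant. It shows that an orientation-preserving derivative
  keeps the sign of \<open>det2\<close>, hence left and right.\<close>

lemma det2_linear:
  assumes "linear f"
  shows "det2 (f x) (f y) = det2 (f 1) (f \<i>) * det2 x y"
proof -
  have f: "f z = Re z *\<^sub>R f 1 + Im z *\<^sub>R f \<i>" for z
  proof -
    have "z = Re z *\<^sub>R 1 + Im z *\<^sub>R \<i>"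
      by (simp add: complex_eq_iff)
    then have "f z = f (Re z *\<^sub>R 1 + Im z *\<^sub>R \<i>)"
      by simp
    then show ?thesis
      by (simp only: linear_add[OF assms] linear_scale[OF assms])
  qed
  show ?thesis
    by (subst (1) f[of x], subst (1) f[of y]) (simp add: det2_def algebra_simps)
qed

text \<open>Comparing pairs of strand and parameter admits crossings of a strand with itself, as in
  the kink.\<close>

definition strand_crosses :: "(real \<Rightarrow> complex) list \<Rightarrow> nat \<Rightarrow> real \<Rightarrow> nat \<Rightarrow> real \<Rightarrow> bool" where
  "strand_crosses T i s j t \<longleftrightarrow> i < length T \<and> j < length T \<and> s \<in> {-1..1} \<and> t \<in> {-1..1} \<and>
     (i, s) \<noteq> (j, t) \<and> (T ! i) s = (T ! j) t"

definition strand_classical :: "(real \<Rightarrow> complex) list \<Rightarrow> (nat \<Rightarrow> real \<Rightarrow> level) \<Rightarrow> nat \<Rightarrow> real \<Rightarrow> bool" where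
  "strand_classical T lev i s \<longleftrightarrow> lev i s \<noteq> Virtual \<and> (\<exists>j t. strand_crosses T i s j t)"

text \<open>The analogue of \<open>has_germs\<close> with the strand parameter in place of the
  orientation: \<open>b\<close> names the side reached as the parameter increases.\<close>

definition strand_germs :: "(real \<Rightarrow> 'a) \<Rightarrow> real \<Rightarrow> (bool \<Rightarrow> 'a) \<Rightarrow> bool \<Rightarrow> bool" where
  "strand_germs g s u b \<longleftrightarrow> (\<forall>\<^sub>F x in at_right s. g x = u b) \<and> (\<forall>\<^sub>F x in at_left s. g x = u (\<not> b))"

text \<open>
  Whether a strand with velocity \<open>v\<close> crosses to the right side of a strand with velocity
  \<open>w\<close>, whose orientation agrees with its parametrization iff \<open>pos\<close> holds.  The orientation of
  the crossing strand does not matter.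
\<close>

definition to_right :: "bool \<Rightarrow> complex \<Rightarrow> complex \<Rightarrow> bool" where
  "to_right pos w v \<longleftrightarrow> (if pos then 1 else - 1) * det2 w v < 0"

text \<open>A coloring of the picture by itself, on the open parameter interval since the end points
  lie on the boundary of the disc. Levels depend on the parameter and not just on the strand,
  because a classical kink is over at one passage and under at the other.\<close>

definition tangle_coloring ::
  "('a, 'm) biquandle_ops_scheme \<Rightarrow> (real \<Rightarrow> complex) list \<Rightarrow> (nat \<Rightarrow> real \<Rightarrow> complex) \<Rightarrow>
   (nat \<Rightarrow> real \<Rightarrow> level) \<Rightarrow> (nat \<Rightarrow> bool) \<Rightarrow> (nat \<Rightarrow> real \<Rightarrow> 'a) \<Rightarrow> bool" where
  "tangle_coloring X T V lev pos G \<longleftrightarrow>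
     (\<forall>i<length T. \<forall>t\<in>{-1<..<1}. \<not> strand_classical T lev i t \<longrightarrow>
        G i t \<in> carrier X \<and> (\<forall>\<^sub>F s in at t. G i s = G i t)) \<and>
     (\<forall>i s j t. strand_crosses T i s j t \<and> lev i s = Under \<and> lev j t = Over \<longrightarrow>
        (\<exists>u v. crossing_rel X u v \<and> strand_germs (G i) s u (to_right (pos j) (V j t) (V i s)) \<and>
           strand_germs (G j) t v (to_right (pos i) (V i s) (V j t))))"

text \<open>Leaves near both ends of every strand a collar without crossings. The colors on the
  collars are the boundary data of the picture.\<close>

definition confined :: "real \<Rightarrow> (real \<Rightarrow> complex) list \<Rightarrow> bool" where
  "confined r T \<longleftrightarrow> 0 < r \<and> r < 1 \<and> (\<forall>i s j t. strand_crosses T i s j t \<longrightarrow> \<bar>s\<bar> \<le> r)"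

lemma strand_crosses_commute: "strand_crosses T i s j t \<longleftrightarrow> strand_crosses T j t i s"
  by (auto simp: strand_crosses_def)

text \<open>The existential data of \<open>local_move\<close>, made explicit for one diagram. Both
  sides of a move are instances with the same \<open>h\<close>, \<open>e\<close>,
  \<open>\<kappa>\<close> and \<open>\<theta>\<close>.\<close>

locale local_picture =
  fixes D :: diagram and h :: "complex \<Rightarrow> complex" and h' :: "complex \<Rightarrow> complex \<Rightarrow> complex"
    and e :: "nat \<Rightarrow> real \<Rightarrow> circle_point" and \<kappa> :: "nat \<Rightarrow> nat" and \<theta> \<theta>' :: "nat \<Rightarrow> real \<Rightarrow> real"
    and T :: "(real \<Rightarrow> complex) list" and V :: "nat \<Rightarrow> real \<Rightarrow> complex"
  assumes vld: "virtual_link_diagram D"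
    and inj_h: "inj h"
    and h': "\<And>z. (h has_derivative h' z) (at z)"
    and det_h': "\<And>z. det2 (h' z 1) (h' z \<i>) > 0"
    and \<kappa>: "\<And>i. i < length T \<Longrightarrow> \<kappa> i < ncomp D"
    and \<theta>': "\<And>i t. i < length T \<Longrightarrow> t \<in> {-1..1} \<Longrightarrow> (\<theta> i has_real_derivative \<theta>' i t) (at t within {-1..1})"
    and \<theta>'_continuous: "\<And>i. i < length T \<Longrightarrow> continuous_on {-1..1} (\<theta>' i)"
    and \<theta>'_nonzero: "\<And>i t. i < length T \<Longrightarrow> t \<in> {-1..1} \<Longrightarrow> \<theta>' i t \<noteq> 0"
    and \<theta>_short: "\<And>i. i < length T \<Longrightarrow> \<bar>\<theta> i 1 - \<theta> i (- 1)\<bar> < 2 * pi"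
    and e: "\<And>i t. i < length T \<Longrightarrow> t \<in> {-1..1} \<Longrightarrow> e i t = (\<kappa> i, cis (\<theta> i t))"
    and e_disjoint: "disjoint_family_on (\<lambda>i. e i ` {-1..1}) {..<length T}"
    and in_square: "{p \<in> circles D. point D p \<in> h ` square} = (\<Union>i<length T. e i ` {-1..1})"
    and point_e: "\<And>i t. i < length T \<Longrightarrow> t \<in> {-1..1} \<Longrightarrow> point D (e i t) = h ((T ! i) t)"
    and V: "\<And>i t. i < length T \<Longrightarrow> t \<in> {-1<..<1} \<Longrightarrow> ((T ! i) has_vector_derivative V i t) (at t)"
begin

definition pos :: "nat \<Rightarrow> bool" where
  "pos i \<longleftrightarrow> \<theta>' i 0 > 0"

definition lev :: "nat \<Rightarrow> real \<Rightarrow> level" where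
  "lev i t = level D (e i t)"

definition arcs_upto :: "real \<Rightarrow> circle_point set" where
  "arcs_upto r = (\<Union>i<length T. e i ` {-r..r})"

lemma \<theta>_continuous: "i < length T \<Longrightarrow> continuous_on {-1..1} (\<theta> i)"
  using \<theta>' by (meson DERIV_continuous_on)

lemma \<theta>'_at:
  assumes "i < length T" "t \<in> {-1<..<1}"
  shows "(\<theta> i has_real_derivative \<theta>' i t) (at t)"
proof -
  have "at t within {-1..1} = at t"
    using assms(2) by (intro at_within_Icc_at) auto
  moreover have "t \<in> {-1..1}"
    using assms(2) by auto
  ultimately show ?thesis
    using \<theta>'[OF assms(1), of t] by metis
qed

text \<open>A continuous function without zeros on an interval keeps its sign, so its value at 0
  decides the direction of the whole strand.\<close>

lemma \<theta>'_pos_iff: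
  assumes "i < length T" "t \<in> {-1..1}"
  shows "\<theta>' i t > 0 \<longleftrightarrow> pos i"
proof (rule ccontr)
  assume *: "(\<theta>' i t > 0) \<noteq> pos i"
  have "connected (\<theta>' i ` {-1..1})"
    using \<theta>'_continuous[OF assms(1)] by (intro connected_continuous_image) auto
  moreover have "\<theta>' i t \<in> \<theta>' i ` {-1..1}" "\<theta>' i 0 \<in> \<theta>' i ` {-1..1}"
    using assms by auto
  ultimately have "0 \<in> \<theta>' i ` {-1..1}"
    using * unfolding pos_def connected_iff_interval by (metis linorder_le_less_linear less_imp_le)
  then show False
    using \<theta>'_nonzero[OF assms(1)] by auto
qed

lemma \<theta>_mono:
  assumes "i < length T"
  shows "pos i \<Longrightarrow> strict_mono_on {-1..1} (\<theta> i)" "\<not> pos i \<Longrightarrow> strict_mono_on {-1..1} (\<lambda>t. - \<theta> i t)"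
proof -
  have mvt: "\<exists>z\<in>{-1..1}. \<theta> i b - \<theta> i a = \<theta>' i z * (b - a)" if "a \<in> {-1..1}" "b \<in> {-1..1}" "a < b" for a b
  proof -
    have "continuous_on {a..b} (\<theta> i)"
      using \<theta>_continuous[OF assms] by (rule continuous_on_subset) (use that in auto)
    moreover have "(\<theta> i has_derivative (*) (\<theta>' i z)) (at z)" if z: "a < z" "z < b" for z
      unfolding has_field_derivative_def[symmetric]
      by (rule \<theta>'_at[OF assms]) (use z \<open>a \<in> _\<close> \<open>b \<in> _\<close> in auto)
    ultimately obtain z where "a < z" "z < b" "\<theta> i b - \<theta> i a = \<theta>' i z * (b - a)"
      using mvt[of a b "\<theta> i" "\<lambda>z. (*) (\<theta>' i z)"] \<open>a < b\<close> by blast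
    then show ?thesis
 
      using \<open>a \<in> _\<close> \<open>b \<in> _\<close> by (auto intro!: bexI[of _ z])
  qed
  show "strict_mono_on {-1..1} (\<theta> i)" if "pos i"
  proof (rule strict_mono_onI)
    fix a b :: real assume ab: "a \<in> {-1..1}" "b \<in> {-1..1}" "a < b"
    then obtain z where "z \<in> {-1..1}" "\<theta> i b - \<theta> i a = \<theta>' i z * (b - a)"
      using mvt by blast
    moreover from this have "\<theta>' i z > 0"
      using \<theta>'_pos_iff[OF assms] that by blast
    ultimately show "\<theta> i a < \<theta> i b"
      using mult_pos_pos[of "\<theta>' i z" "b - a"] ab by linarith
  qed
  show "strict_mono_on {-1..1} (\<lambda>t. - \<theta> i t)" if "\<not> pos i"
  proof (rule strict_mono_onI)
    fix a b :: real assume ab: "a \<in> {-1..1}" "b \<in> {-1..1}" "a < b"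
    then obtain z where z: "z \<in> {-1..1}" "\<theta> i b - \<theta> i a = \<theta>' i z * (b - a)"
      using mvt by blast
    then have "\<theta>' i z < 0"
      using \<theta>'_pos_iff[OF assms z(1)] \<theta>'_nonzero[OF assms z(1)] that by auto
    then show "- \<theta> i a < - \<theta> i b"
      using mult_neg_pos[of "\<theta>' i z" "b - a"] ab z by linarith
  qed
qed

lemma inj_on_\<theta>:
  assumes "i < length T"
  shows "inj_on (\<theta> i) {-1..1}"
proof (cases "pos i")
  case True
  then show ?thesis
    using \<theta>_mono(1)[OF assms] strict_mono_on_imp_inj_on by blast
next
  case False
  then have "inj_on (\<lambda>t. - \<theta> i t) {-1..1}"
    using \<theta>_mono(2)[OF assms] strict_mono_on_imp_inj_on by blast
  then show ?thesis
    by (auto simp: inj_on_def)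
qed

lemma \<theta>_dist_less:
  assumes "i < length T" "s \<in> {-1..1}" "t \<in> {-1..1}"
  shows "\<bar>\<theta> i s - \<theta> i t\<bar> < 2 * pi"
proof -
  have mono: "f (- 1) \<le> f x \<and> f x \<le> f 1" if "strict_mono_on {-1..1} f" "x \<in> {-1..1}" for f :: "real \<Rightarrow> real" and x
    using strict_mono_on_leD[OF that(1), of "-1" x] strict_mono_on_leD[OF that(1), of x 1] that(2) by auto
  show ?thesis
    using \<theta>_short[OF assms(1)] \<theta>_mono[OF assms(1)] mono[of "\<theta> i" s] mono[of "\<theta> i" t]
      mono[of "\<lambda>t. - \<theta> i t" s] mono[of "\<lambda>t. - \<theta> i t" t] assms(2,3)
    by (cases "pos i") auto
qed

text \<open>Distinct arcs are disjoint by assumption. A single arc is injective because it covers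
  less than a full turn and its angle is strictly monotone.\<close>

lemma e_eq_iff:
  assumes "i < length T" "j < length T" "s \<in> {-1..1}" "t \<in> {-1..1}"
  shows "e i s = e j t \<longleftrightarrow> i = j \<and> s = t"
proof
  assume eq: "e i s = e j t"
  have ij: "i = j"
  proof (rule ccontr)
    assume "i \<noteq> j"
    then have "e i ` {-1..1} \<inter> e j ` {-1..1} = {}"
      using e_disjoint assms unfolding disjoint_family_on_def by auto
    then show False
      using eq assms by (metis IntI empty_iff imageI)
  qed
  have "cis (\<theta> i s) = cis (\<theta> i t)"
    using eq assms ij by (simp add: e)
  then have "cis (\<theta> i s - \<theta> i t) = 1"
    by (metis cis_divide cis_neq_zero divide_self)
  then have "cos (\<theta> i s - \<theta> i t) = 1"
    by (metis cis.simps(1) one_complex.simps(1))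
  moreover have "\<theta> i s - \<theta> i t = 2 * ((\<theta> i s - \<theta> i t) / 2)"
    by simp
  \<comment> \<open>Halving the difference of the angles brings it strictly between
    \<open>- pi\<close> and \<open>pi\<close>, where the sine vanishes only at 0.\<close>
  ultimately have "sin ((\<theta> i s - \<theta> i t) / 2) = 0"
    using cos_double_sin[of "(\<theta> i s - \<theta> i t) / 2"] by (metis diff_eq_eq diff_self mult_eq_0_iff power_eq_0_iff zero_neq_numeral add_cancel_right_right)
  moreover have "\<bar>\<theta> i s - \<theta> i t\<bar> < 2 * pi"
    by (rule \<theta>_dist_less[OF assms(1,3,4)])
  then have "- pi < (\<theta> i s - \<theta> i t) / 2" "(\<theta> i s - \<theta> i t) / 2 < pi"
    by (auto simp: abs_less_iff field_simps)
  ultimately have "\<theta> i s = \<theta> i t"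
    using sin_eq_0_pi[of "(\<theta> i s - \<theta> i t) / 2"] by simp
  then show "i = j \<and> s = t"
    using ij inj_on_\<theta>[OF assms(1)] assms by (auto dest: inj_onD)
qed simp

lemma e_in_circles: "i < length T \<Longrightarrow> t \<in> {-1..1} \<Longrightarrow> e i t \<in> circles D"
  by (simp add: e circles_def \<kappa>)

text \<open>Everything that lies over the disc is on one of the arcs, so the partner of a crossing
  inside the disc is again on an arc; injectivity of \<open>h\<close> then reduces the crossing to
  the standard picture.\<close>

lemma crosses_e_iff:
  assumes "i < length T" "s \<in> {-1..1}"
  shows "crosses D (e i s) q \<longleftrightarrow> (\<exists>j t. q = e j t \<and> strand_crosses T i s j t)"
proof
  assume c: "crosses D (e i s) q"
  then have q: "q \<in> circles D" "point D q = point D (e i s)" "q \<noteq> e i s"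
    by (auto simp: crosses_def)
  have "point D (e i s) \<in> h ` square"
    using in_square assms by blast
  then have "q \<in> (\<Union>i<length T. e i ` {-1..1})"
    unfolding in_square[symmetric] using q by simp
  then obtain j t where jt: "j < length T" "t \<in> {-1..1}" "q = e j t"
    by auto
  have "(T ! i) s = (T ! j) t"
    using q(2) jt assms inj_h by (simp add: point_e inj_eq)
  then show "\<exists>j t. q = e j t \<and> strand_crosses T i s j t"
    using jt assms q(3) by (auto simp: strand_crosses_def)
next
  assume "\<exists>j t. q = e j t \<and> strand_crosses T i s j t"
  then obtain j t where jt: "q = e j t" "strand_crosses T i s j t"
    by blast
  then have "j < length T" "t \<in> {-1..1}" "(i, s) \<noteq> (j, t)" "(T ! i) s = (T ! j) t"
    by (auto simp: strand_crosses_def)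
  then show "crosses D (e i s) q"
    using assms jt(1) by (simp add: crosses_def e_in_circles e_eq_iff point_e)
qed

lemma classical_e_iff:
  assumes "i < length T" "s \<in> {-1..1}"
  shows "e i s \<in> classical_points D \<longleftrightarrow> strand_classical T lev i s"
  using crosses_e_iff[OF assms]
  unfolding classical_points_def double_points_def strand_classical_def lev_def by blast

lemma lev_cases:
  assumes "strand_crosses T i s j t"
  shows "(lev i s, lev j t) \<in> {(Over, Under), (Under, Over), (Virtual, Virtual)}"
proof -
  have "crosses D (e i s) (e j t)"
    using crosses_e_iff[of i s] assms by (auto simp: strand_crosses_def)
  then show ?thesis
    using vld unfolding virtual_link_diagram_def lev_def by blast
qed

lemma rot_e:
  assumes "i < length T" "t \<in> {-1..1}"
  shows "rot (e i t) s = (\<kappa> i, cis (\<theta> i t + s))"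
  using assms by (simp add: e rot_def cis_mult)

text \<open>On a strand that runs against its circle, moving forward on the circle decreases the
  strand parameter.\<close>

lemma eventually_at_e:
  assumes "i < length T" "t \<in> {-1<..<1}"
  shows "(\<forall>\<^sub>F s in at_right 0. P (rot (e i t) s)) \<longleftrightarrow>
      (if pos i then \<forall>\<^sub>F s in at_right t. P (e i s) else \<forall>\<^sub>F s in at_left t. P (e i s))"
    and "(\<forall>\<^sub>F s in at_right 0. P (rot (e i t) (- s))) \<longleftrightarrow>
      (if pos i then \<forall>\<^sub>F s in at_left t. P (e i s) else \<forall>\<^sub>F s in at_right t. P (e i s))"
proof -
  have t: "t \<in> {-1..1}"
    using assms by auto
  have "\<forall>\<^sub>F s in at t. s \<in> {-1..1}"
    using assms(2) by (intro eventually_at_in_open'[of "{-1<..<1}", THEN eventually_mono]) auto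
  then have "\<forall>\<^sub>F s in at t. P (\<kappa> i, cis (\<theta> i s)) = P (e i s)"
    by eventually_elim (simp add: e assms)
  then have ev: "(\<forall>\<^sub>F s in at_right t. P (\<kappa> i, cis (\<theta> i s))) = (\<forall>\<^sub>F s in at_right t. P (e i s))"
    "(\<forall>\<^sub>F s in at_left t. P (\<kappa> i, cis (\<theta> i s))) = (\<forall>\<^sub>F s in at_left t. P (e i s))"
    unfolding eventually_at_split by (auto dest: eventually_subst)
  have cont: "continuous_on {-1..1} (\<lambda>t. - \<theta> i t)"
    by (intro continuous_intros \<theta>_continuous assms)
  show "(\<forall>\<^sub>F s in at_right 0. P (rot (e i t) s)) \<longleftrightarrow>
      (if pos i then \<forall>\<^sub>F s in at_right t. P (e i s) else \<forall>\<^sub>F s in at_left t. P (e i s))"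
    using eventually_strict_mono_at_right[OF \<theta>_continuous \<theta>_mono(1) assms(2), of i "\<lambda>x. P (\<kappa> i, cis x)"]
      eventually_strict_mono_at_left[OF cont \<theta>_mono(2) assms(2), of "\<lambda>x. P (\<kappa> i, cis (- x))"]
      ev assms(1)
    by (simp add: rot_e[OF assms(1) t] add.commute)
  show "(\<forall>\<^sub>F s in at_right 0. P (rot (e i t) (- s))) \<longleftrightarrow>
      (if pos i then \<forall>\<^sub>F s in at_left t. P (e i s) else \<forall>\<^sub>F s in at_right t. P (e i s))"
    using eventually_strict_mono_at_left[OF \<theta>_continuous \<theta>_mono(1) assms(2), of i "\<lambda>x. P (\<kappa> i, cis x)"]
      eventually_strict_mono_at_right[OF cont \<theta>_mono(2) assms(2), of "\<lambda>x. P (\<kappa> i, cis (- x))"]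
      ev assms(1)
    by (simp add: rot_e[OF assms(1) t] add.commute)
qed

lemma eventually_at_e_iff:
  assumes "i < length T" "t \<in> {-1<..<1}"
  shows "(\<forall>\<^sub>F s in at 0. P (rot (e i t) s)) \<longleftrightarrow> (\<forall>\<^sub>F s in at t. P (e i s))"
  unfolding eventually_at_0_cases eventually_at_split[of _ t] using eventually_at_e[OF assms, of P] by auto

text \<open>The same curve is written as the circle curve at \<open>\<theta> i t\<close> and as
  \<open>h\<close> of the standard strand; both descriptions are differentiated by the chain
  rule.\<close>

lemma velocity_e:
  assumes "i < length T" "t \<in> {-1<..<1}"
  shows "\<theta>' i t *\<^sub>R velocity D (e i t) = h' ((T ! i) t) (V i t)"
proof -
  have t: "t \<in> {-1..1}"
    using assms(2) by auto
  obtain c' where c': "\<And>x. ((\<lambda>s. curve D (\<kappa> i) (cis s)) has_vector_derivative c' x) (at x)"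
    using vld \<kappa>[OF assms(1)] unfolding virtual_link_diagram_def C1_immersed_circle_def by metis
  have "((\<lambda>s. \<theta> i t + s) has_real_derivative 1) (at 0)"
    by (auto intro!: derivative_eq_intros)
  then have "(((\<lambda>s. curve D (\<kappa> i) (cis s)) \<circ> (\<lambda>s. \<theta> i t + s)) has_vector_derivative 1 *\<^sub>R c' (\<theta> i t + 0)) (at 0)"
    by (intro vector_diff_chain_at c') (simp add: has_real_derivative_iff_has_vector_derivative)
  then have "velocity D (e i t) = c' (\<theta> i t)"
    by (simp add: velocity_def e[OF assms(1) t] cis_mult o_def vector_derivative_at)
  moreover have "\<theta>' i t *\<^sub>R c' (\<theta> i t) = h' ((T ! i) t) (V i t)"
  proof -
    have "(\<theta> i has_vector_derivative \<theta>' i t) (at t)"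
      using \<theta>'_at[OF assms] by (simp add: has_real_derivative_iff_has_vector_derivative)
    then have 1: "((\<lambda>s. curve D (\<kappa> i) (cis s)) \<circ> \<theta> i has_vector_derivative \<theta>' i t *\<^sub>R c' (\<theta> i t)) (at t)"
      by (intro vector_diff_chain_at c')
    have "((h \<circ> (T ! i)) has_derivative (h' ((T ! i) t) \<circ> (\<lambda>x. x *\<^sub>R V i t))) (at t)"
      using V[OF assms] by (intro diff_chain_at h') (simp add: has_vector_derivative_def)
    moreover have "linear (h' ((T ! i) t))"
      using h' has_derivative_linear by blast
    then have "(h' ((T ! i) t) \<circ> (\<lambda>x. x *\<^sub>R V i t)) = (\<lambda>x. x *\<^sub>R h' ((T ! i) t) (V i t))"
      by (simp add: fun_eq_iff linear_scale)
    ultimately have 2: "((h \<circ> (T ! i)) has_vector_derivative h' ((T ! i) t) (V i t)) (at t)"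
      by (simp add: has_vector_derivative_def)
    have "((\<lambda>s. curve D (\<kappa> i) (cis s)) \<circ> \<theta> i has_vector_derivative h' ((T ! i) t) (V i t)) (at t)"
    proof (rule has_vector_derivative_transform_within_open[OF 2, of "{-1<..<1}"])
      fix s :: real assume "s \<in> {-1<..<1}"
      then have "s \<in> {-1..1}"
        by auto
      then show "(h \<circ> (T ! i)) s = ((\<lambda>s. curve D (\<kappa> i) (cis s)) \<circ> \<theta> i) s"
        using point_e[OF assms(1), of s] by (simp add: point_def e[OF assms(1)])
    qed (use assms in auto)
    then show ?thesis
      using 1 vector_derivative_unique_at by blast
  qed
  ultimately show ?thesis
    by simp
qed

text \<open>By \<open>velocity_e\<close> the two determinants differ by a positive Jacobian and by
  the signs of both angular derivatives. The sign of strand \<open>j\<close> is absorbed into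
  \<open>to_right\<close>; that of strand \<open>i\<close> remains as the comparison with
  \<open>pos i\<close>.\<close>

lemma leaves_right_e_iff:
  assumes "i < length T" "j < length T" "s \<in> {-1<..<1}" "t \<in> {-1<..<1}" "strand_crosses T i s j t"
  shows "leaves_right D (e i s) (e j t) \<longleftrightarrow> (to_right (pos j) (V j t) (V i s) = pos i)"
proof -
  have T: "(T ! i) s = (T ! j) t"
    using assms(5) by (simp add: strand_crosses_def)
  have st: "s \<in> {-1..1}" "t \<in> {-1..1}"
    using assms(3,4) by auto
  let ?d = "det2 (velocity D (e j t)) (velocity D (e i s))"
  have "crosses D (e j t) (e i s)"
    using crosses_e_iff[OF assms(2) st(2)] assms(5) strand_crosses_commute by blast
  then have "?d \<noteq> 0"
    using vld unfolding virtual_link_diagram_def by blast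
  have eq: "\<theta>' j t * \<theta>' i s * ?d = det2 (h' ((T ! i) s) 1) (h' ((T ! i) s) \<i>) * det2 (V j t) (V i s)"
    using velocity_e[OF assms(1,3)] velocity_e[OF assms(2,4)] h' has_derivative_linear
    by (metis T det2_linear det2_scaleR)
  have pos: "\<theta>' j t > 0 \<longleftrightarrow> pos j" "\<theta>' i s > 0 \<longleftrightarrow> pos i" "\<theta>' j t \<noteq> 0" "\<theta>' i s \<noteq> 0"
    using \<theta>'_pos_iff \<theta>'_nonzero assms st by blast+
  have "sgn (\<theta>' j t) * sgn (\<theta>' i s) * sgn ?d = sgn (det2 (V j t) (V i s))"
    using arg_cong[OF eq, of sgn] det_h'[of "(T ! i) s"] by (simp add: sgn_mult)
  then show ?thesis
    using pos \<open>?d \<noteq> 0\<close> unfolding leaves_right_def to_right_def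
    by (auto simp: sgn_if split: if_splits)
qed

text \<open>Reversing strand \<open>i\<close> flips both the direction of rotation and
  \<open>leaves_right\<close>. The two flips cancel, so \<open>pos i\<close> no longer occurs on the
  right-hand side.\<close>

lemma has_germs_e_iff:
  assumes "i < length T" "j < length T" "s \<in> {-1<..<1}" "t \<in> {-1<..<1}" "strand_crosses T i s j t"
  shows "has_germs F (e i s) u (leaves_right D (e i s) (e j t)) \<longleftrightarrow>
    strand_germs (\<lambda>x. F (e i x)) s u (to_right (pos j) (V j t) (V i s))"
  unfolding has_germs_def strand_germs_def leaves_right_e_iff[OF assms]
  using eventually_at_e[OF assms(1,3), of "\<lambda>p. F p = u _"]
  by (cases "pos i"; cases "to_right (pos j) (V j t) (V i s)") (simp_all, blast+)

lemma tangle_coloring_restrict: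
  assumes "F \<in> point_colorings X D" "confined r T"
  shows "tangle_coloring X T V lev pos (\<lambda>i t. F (e i t))"
  unfolding tangle_coloring_def
proof (intro conjI allI impI ballI)
  fix i t assume i: "i < length T" and t: "t \<in> {-1<..<1::real}" and nc: "\<not> strand_classical T lev i t"
  have "t \<in> {-1..1}"
    using t by auto
  then have reg: "e i t \<in> regular_points D"
    using nc i by (simp add: regular_points_def e_in_circles classical_e_iff)
  then show "F (e i t) \<in> carrier X"
    using assms(1) by (auto simp: point_colorings_def)
  show "\<forall>\<^sub>F s in at t. F (e i s) = F (e i t)"
    using assms(1) reg eventually_at_e_iff[OF i t, of "\<lambda>p. F p = F (e i t)"] by (auto simp: point_colorings_def)
next
  fix i s j t assume *: "strand_crosses T i s j t \<and> lev i s = Under \<and> lev j t = Over"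
  then have ij: "i < length T" "j < length T" "s \<in> {-1..1}" "t \<in> {-1..1}"
    by (auto simp: strand_crosses_def)
  have "\<bar>s\<bar> < 1" "\<bar>t\<bar> < 1"
    using assms(2) * strand_crosses_commute unfolding confined_def by (metis order_le_less_trans)+
  then have st: "s \<in> {-1<..<1}" "t \<in> {-1<..<1}"
    by auto
  have "crosses D (e i s) (e j t)"
    using crosses_e_iff[OF ij(1,3)] * by blast
  then have "crossing_ok X D F (e i s) (e j t)"
    using assms(1) * unfolding point_colorings_def lev_def by blast
  then show "\<exists>u v. crossing_rel X u v \<and> strand_germs (\<lambda>t. F (e i t)) s u (to_right (pos j) (V j t) (V i s)) \<and>
      strand_germs (\<lambda>t. F (e j t)) t v (to_right (pos i) (V i s) (V j t))"
    using has_germs_e_iff[of i j s t F] has_germs_e_iff[of j i t s F] ij st * strand_crosses_commute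
    unfolding crossing_ok_def by blast
qed

lemma continuous_on_e: "i < length T \<Longrightarrow> r \<le> 1 \<Longrightarrow> continuous_on {-r..r} (e i)"
proof -
  assume "i < length T" "r \<le> 1"
  then have "continuous_on {-r..r} (\<lambda>t. (\<kappa> i, cis (\<theta> i t)))"
    using continuous_on_subset[OF \<theta>_continuous, of i "{-r..r}"] by (intro continuous_intros) auto
  then show ?thesis
    by (rule continuous_on_eq) (use \<open>i < length T\<close> \<open>r \<le> 1\<close> in \<open>simp add: e\<close>)
qed

lemma closed_arcs_upto: "r \<le> 1 \<Longrightarrow> closed (arcs_upto r)"
  unfolding arcs_upto_def
proof (intro closed_UN ballI)
  fix i assume "r \<le> 1" "i \<in> {..<length T}"
  then have "compact (e i ` {- r..r})"
    by (intro compact_continuous_image continuous_on_e) auto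
  then show "closed (e i ` {- r..r})"
    by (rule compact_imp_closed)
qed simp

lemma eventually_rot_notin_arcs:
  assumes "p \<notin> arcs_upto r" "r \<le> 1"
  shows "\<forall>\<^sub>F s in at 0. rot p s \<notin> arcs_upto r"
proof -
  have "isCont (rot p) 0"
    using continuous_rot[of UNIV p] by (simp add: continuous_on_eq_continuous_at)
  then have "(rot p \<longlongrightarrow> p) (at 0)"
    by (metis isCont_def rot_0)
  then have "\<forall>\<^sub>F s in at 0. rot p s \<in> - arcs_upto r"
    using closed_arcs_upto[OF assms(2)] assms(1) by (intro topological_tendstoD) auto
  then show ?thesis
    by simp
qed

end

text \<open>Half of a correspondence between two pictures: colorings of \<open>T\<close> are
  determined by their collar values, and collar values realized by \<open>T\<close> are realized by
  \<open>T'\<close>. A move needs it in both orders.\<close>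

definition tangle_extends where
  "tangle_extends X r pos T V lev T' V' lev' \<longleftrightarrow>
     (\<forall>G H. tangle_coloring X T V lev pos G \<and> tangle_coloring X T V lev pos H \<and>
        (\<forall>i<length T. \<forall>t. r < \<bar>t\<bar> \<and> \<bar>t\<bar> < 1 \<longrightarrow> G i t = H i t) \<longrightarrow>
        (\<forall>i<length T. \<forall>t. \<bar>t\<bar> < 1 \<and> \<not> strand_classical T lev i t \<longrightarrow> G i t = H i t)) \<and>
     (\<forall>G. tangle_coloring X T V lev pos G \<longrightarrow> (\<exists>H. tangle_coloring X T' V' lev' pos H \<and>
        (\<forall>i<length T. \<forall>t. r < \<bar>t\<bar> \<and> \<bar>t\<bar> < 1 \<longrightarrow> H i t = G i t)))"

text \<open>The two sides of one move: the same disc and the same arcs of the circles, but different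
  strands inside the disc.\<close>

locale picture_pair =
  P: local_picture D h h' e \<kappa> \<theta> \<theta>' T V + P': local_picture D' h h' e \<kappa> \<theta> \<theta>' T' V'
  for D D' h h' e \<kappa> \<theta> \<theta>' T T' V V' +
  assumes same_ncomp: "ncomp D' = ncomp D" and same_length: "length T' = length T"
    and outside: "\<And>p. p \<in> circles D \<Longrightarrow> p \<notin> P.arcs_upto 1 \<Longrightarrow>
      point D' p = point D p \<and> (p \<in> double_points D \<longrightarrow> level D' p = level D p)"
begin

lemma same_circles: "circles D' = circles D"
  by (simp add: circles_def same_ncomp)

lemma same_arcs_upto: "P'.arcs_upto r = P.arcs_upto r"
  by (simp add: P.arcs_upto_def P'.arcs_upto_def same_length)

lemma not_in_arcs_iff: "p \<in> circles D \<Longrightarrow> p \<notin> P.arcs_upto 1 \<longleftrightarrow> point D p \<notin> h ` square"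
  using P.in_square by (auto simp: P.arcs_upto_def)

lemma not_in_arcs_iff': "p \<in> circles D \<Longrightarrow> p \<notin> P.arcs_upto 1 \<longleftrightarrow> point D' p \<notin> h ` square"
  using P'.in_square by (auto simp: P.arcs_upto_def same_circles same_length)

text \<open>In both diagrams a point off the arcs is mapped outside the disc, so it can only cross
  another such point, and there the two curves agree.\<close>

lemma crosses_outside_iff:
  assumes "p \<notin> P.arcs_upto 1"
  shows "crosses D' p q \<longleftrightarrow> crosses D p q"
  using not_in_arcs_iff[of p] not_in_arcs_iff[of q] not_in_arcs_iff'[of p] not_in_arcs_iff'[of q] outside assms
  unfolding crosses_def same_circles by metis

lemma crosses_outside: "crosses D p q \<Longrightarrow> p \<notin> P.arcs_upto 1 \<Longrightarrow> q \<notin> P.arcs_upto 1"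
  using not_in_arcs_iff[of p] not_in_arcs_iff[of q] unfolding crosses_def by metis

lemma outside_level:
  assumes "crosses D p q" "p \<notin> P.arcs_upto 1"
  shows "level D' p = level D p"
proof -
  have "p \<in> double_points D"
    using assms(1) unfolding double_points_def by blast
  then show ?thesis
    using outside[OF _ assms(2)] crosses_in_circles[OF assms(1)] by blast
qed

lemma picture_pair_commute: "picture_pair D' D h h' e \<kappa> \<theta> \<theta>' T' T V' V"
proof unfold_locales
  fix p assume p: "p \<in> circles D'" "p \<notin> P'.arcs_upto 1"
  then have p': "p \<in> circles D" "p \<notin> P.arcs_upto 1"
    by (simp_all add: same_circles same_arcs_upto)
  show "point D p = point D' p \<and> (p \<in> double_points D' \<longrightarrow> level D p = level D' p)"
    using outside[OF p'] crosses_outside_iff[OF p'(2)] by (auto simp: double_points_def)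
qed (simp_all add: same_ncomp same_length)

text \<open>Agreement of positions at \<open>p\<close> alone would say nothing about derivatives.
  The arcs form a closed set, so the positions agree on a whole neighbourhood of
  \<open>p\<close>.\<close>

lemma velocity_outside:
  assumes "p \<in> circles D" "p \<notin> P.arcs_upto 1"
  shows "velocity D' p = velocity D p"
proof -
  have "\<forall>\<^sub>F s in at 0. point D' (rot p s) = point D (rot p s)"
    using P.eventually_rot_notin_arcs[OF assms(2) order_refl]
    by eventually_elim (use outside assms(1) in simp)
  moreover have "point D' (rot p 0) = point D (rot p 0)"
    using outside assms by simp
  ultimately have "\<forall>\<^sub>F s in nhds 0. point D' (rot p s) = point D (rot p s)"
    by (simp add: eventually_nhds_conv_at)
  then have "vector_derivative (\<lambda>s. point D' (rot p s)) (at 0) = vector_derivative (\<lambda>s. point D (rot p s)) (at 0)"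
    by (intro vector_derivative_cong_eq) auto
  then show ?thesis
    by (simp add: velocity_def point_def rot_def)
qed

context
  fixes r :: real
  assumes confined: "confined r T" "confined r T'"
begin

lemma r: "0 < r" "r < 1"
  using confined by (auto simp: confined_def)

lemma arcs_upto_mono: "P.arcs_upto r \<subseteq> P.arcs_upto 1"
  using r by (force simp: P.arcs_upto_def)

text \<open>A crossing that is not in the core of the picture is not in its collars either, for
  either diagram.\<close>

lemma crosses_not_in_collar:
  assumes "crosses D p q \<or> crosses D' p q" "p \<notin> P.arcs_upto r"
  shows "p \<notin> P.arcs_upto 1"
proof
  assume "p \<in> P.arcs_upto 1"
  then obtain i t where it: "i < length T" "t \<in> {-1..1}" "p = e i t"
    by (auto simp: P.arcs_upto_def)
  then have "\<exists>j s. strand_crosses T i t j s \<or> strand_crosses T' i t j s"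
    using assms(1) P.crosses_e_iff[of i t q] P'.crosses_e_iff[of i t q] same_length by auto
  then have "\<bar>t\<bar> \<le> r"
    using confined unfolding confined_def by blast
  then have "p \<in> P.arcs_upto r"
    using it by (auto simp: P.arcs_upto_def abs_le_iff intro!: bexI[of _ i] imageI)
  then show False
    using assms(2) by simp
qed

lemma regular_outside_iff:
  assumes "p \<notin> P.arcs_upto r"
  shows "p \<in> regular_points D' \<longleftrightarrow> p \<in> regular_points D"
proof -
  have "p \<in> classical_points D' \<longleftrightarrow> p \<in> classical_points D"
    using crosses_not_in_collar[OF _ assms] crosses_outside_iff outside_level
    unfolding classical_points_def double_points_def by (smt (verit) mem_Collect_eq)
  then show ?thesis
    by (simp add: regular_points_def same_circles)
qed

lemma in_arcs_iff: "p \<in> P.arcs_upto r \<longleftrightarrow> (\<exists>i<length T. \<exists>t. \<bar>t\<bar> \<le> r \<and> p = e i t)"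
proof -
  have "{-r..r} = {t. \<bar>t\<bar> \<le> r}"
    by (auto simp: abs_le_iff)
  then show ?thesis
    by (auto simp: P.arcs_upto_def)
qed

lemma e_in_arcs_iff:
  assumes "i < length T" "\<bar>t\<bar> \<le> 1"
  shows "e i t \<in> P.arcs_upto r \<longleftrightarrow> \<bar>t\<bar> \<le> r"
proof
  assume "e i t \<in> P.arcs_upto r"
  then obtain j s where js: "j < length T" "\<bar>s\<bar> \<le> r" "e i t = e j s"
    unfolding in_arcs_iff by blast
  then have "s = t"
    using P.e_eq_iff[of i j t s] assms r by (auto simp: abs_le_iff)
  then show "\<bar>t\<bar> \<le> r"
    using js by simp
qed (use assms in_arcs_iff in blast)

text \<open>The new coloring is \<open>G\<close> on the core and \<open>F\<close> elsewhere. The two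
  agree on the overlapping collars, so every point has a neighbourhood on which a single one of them
  describes the result. All conditions on a coloring concern germs and are inherited.\<close>

lemma glue_point_coloring:
  assumes F: "F \<in> point_colorings X D"
    and G: "tangle_coloring X T' V' P'.lev P.pos G"
    and FG: "\<And>i t. i < length T \<Longrightarrow> r < \<bar>t\<bar> \<Longrightarrow> \<bar>t\<bar> < 1 \<Longrightarrow> G i t = F (e i t)"
  shows "\<exists>F'\<in>point_colorings X D'. \<forall>p\<in>regular_points D - P.arcs_upto r. F' p = F p"
proof -
  \<comment> \<open>Strand and parameter of a core point, well defined because the arcs are
    injective and disjoint.\<close>
  define c where "c p = (SOME it. fst it < length T \<and> \<bar>snd it\<bar> \<le> r \<and> p = e (fst it) (snd it))" for p
  define F' where "F' p = (if p \<notin> regular_points D' then undefined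
      else if p \<in> P.arcs_upto r then G (fst (c p)) (snd (c p)) else F p)" for p
  have c: "c (e i t) = (i, t)" if "i < length T" "\<bar>t\<bar> \<le> r" for i t
  proof -
    have "fst (c (e i t)) < length T \<and> \<bar>snd (c (e i t))\<bar> \<le> r \<and> e i t = e (fst (c (e i t))) (snd (c (e i t)))"
      unfolding c_def by (rule someI[of _ "(i, t)"]) (use that in simp)
    then have "i = fst (c (e i t))" "t = snd (c (e i t))"
      using P.e_eq_iff[of i "fst (c (e i t))" t "snd (c (e i t))"] that r by (auto simp: abs_le_iff)
    then show ?thesis
      by (metis prod.collapse)
  qed
  \<comment> \<open>The description by \<open>G\<close> extends from the core to the open arcs by
    agreement on the collars.\<close>
  have F'_e: "F' (e i t) = G i t" if "i < length T" "\<bar>t\<bar> < 1" "e i t \<in> regular_points D'" for i t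
    using that e_in_arcs_iff[of i t] c[of i t] FG[of i t] by (auto simp: F'_def)
  have F'_out: "F' p = F p" if "p \<notin> P.arcs_upto r" for p
    using that regular_outside_iff[OF that] F PiE_arb[of F "regular_points D" "\<lambda>_. carrier X" p]
    by (auto simp: F'_def point_colorings_def)
  have near_out: "\<forall>\<^sub>F s in at 0. F' (rot p s) = F (rot p s)" if "p \<notin> P.arcs_upto r" for p
    using P.eventually_rot_notin_arcs[OF that] r by (auto elim!: eventually_mono intro: F'_out)
  \<comment> \<open>At classical points \<open>F'\<close> is \<open>undefined\<close> while
    \<open>G\<close> is arbitrary; such points are absent from a punctured neighbourhood.\<close>
  have near_in: "\<forall>\<^sub>F s in at t. F' (e i s) = G i s" if i: "i < length T" and t: "\<bar>t\<bar> < 1" for i t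
  proof -
    have t': "t \<in> {-1..1}" "t \<in> {-1<..<1}"
      using t by (auto simp: abs_less_iff)
    have "\<forall>\<^sub>F s in at 0. rot (e i t) s \<in> regular_points D'"
      by (intro eventually_rot_regular finite_classical_points P'.vld) (use P.e_in_circles i t' same_circles in auto)
    then have "\<forall>\<^sub>F s in at t. e i s \<in> regular_points D'"
      using P.eventually_at_e_iff[OF i t'(2), of "\<lambda>p. p \<in> regular_points D'"] by blast
    moreover have "\<forall>\<^sub>F s in at t. s \<in> {-1<..<1}"
      using t' by (intro eventually_at_in_open') auto
    ultimately show ?thesis
      by eventually_elim (use F'_e i in auto)
  qed
  have in_core: "\<exists>i t. i < length T \<and> \<bar>t\<bar> \<le> r \<and> t \<in> {-1<..<1} \<and> t \<in> {-1..1} \<and> p = e i t" if "p \<in> P.arcs_upto r" for p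
    using that r unfolding in_arcs_iff by (fastforce simp: abs_le_iff)
  have "F' \<in> point_colorings X D'"
    unfolding point_colorings_def
  proof (intro CollectI conjI ballI allI impI)
    have car: "F' p \<in> carrier X \<and> (\<forall>\<^sub>F s in at 0. F' (rot p s) = F' p)" if p: "p \<in> regular_points D'" for p
    proof (cases "p \<in> P.arcs_upto r")
      case True
      then obtain i t where it: "i < length T" "\<bar>t\<bar> \<le> r" "t \<in> {-1<..<1}" "t \<in> {-1..1}" "p = e i t"
        using in_core by blast
      have "\<not> strand_classical T' P'.lev i t"
        using p P'.classical_e_iff[of i t] it same_length by (auto simp: regular_points_def)
      then have g: "G i t \<in> carrier X" "\<forall>\<^sub>F s in at t. G i s = G i t"
        using G it same_length unfolding tangle_coloring_def by auto
      have F'p: "F' p = G i t"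
        using F'_e[of i t] it p r by auto
      have "\<forall>\<^sub>F s in at t. F' (e i s) = G i s"
        using near_in[of i t] it r by auto
      then have "\<forall>\<^sub>F s in at t. F' (e i s) = F' p"
        using g(2) by eventually_elim (simp add: F'p)
      then show ?thesis
        using P.eventually_at_e_iff[OF it(1,3), of "\<lambda>q. F' q = F' p"] g(1) F'p it(5) by simp
    next
      case False
      then have pD: "p \<in> regular_points D"
        using p regular_outside_iff by blast
      then have "\<forall>\<^sub>F s in at 0. F (rot p s) = F p"
        using F by (auto simp: point_colorings_def)
      then have "\<forall>\<^sub>F s in at 0. F' (rot p s) = F' p"
        using near_out[OF False] by eventually_elim (simp add: F'_out[OF False])
      then show ?thesis
        using F pD by (auto simp: F'_out[OF False] point_colorings_def)
    qed
    show "F' \<in> regular_points D' \<rightarrow>\<^sub>E carrier X"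
      using car by (auto simp: F'_def)
    show "\<forall>\<^sub>F s in at 0. F' (rot p s) = F' p" if "p \<in> regular_points D'" for p
      using car that by blast
  next
    fix p q assume *: "crosses D' p q \<and> level D' p = Under \<and> level D' q = Over"
    show "crossing_ok X D' F' p q"
    proof (cases "p \<in> P.arcs_upto r")
      case True
      then obtain i s where i: "i < length T" "\<bar>s\<bar> \<le> r" "s \<in> {-1<..<1}" "s \<in> {-1..1}" "p = e i s"
        using in_core by blast
      then obtain j t where j: "q = e j t" "strand_crosses T' i s j t"
        using * P'.crosses_e_iff[of i s q] same_length by auto
      then have "\<bar>t\<bar> \<le> r" "j < length T"
        using confined(2) strand_crosses_commute same_length unfolding confined_def by (blast, auto simp: strand_crosses_def)
      then have t: "t \<in> {-1<..<1}" "\<bar>t\<bar> < 1" "\<bar>s\<bar> < 1"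
        using r i(2) by (auto simp: abs_less_iff abs_le_iff)
      obtain u v where uv: "crossing_rel X u v" "strand_germs (G i) s u (to_right (P.pos j) (V' j t) (V' i s))"
        "strand_germs (G j) t v (to_right (P.pos i) (V' i s) (V' j t))"
        using G j(2) * i(5) j(1) unfolding tangle_coloring_def P'.lev_def by blast
      have sg: "strand_germs (\<lambda>x. F' (e i x)) s u b" if "strand_germs (G i) s u b" "i < length T" "\<bar>s\<bar> < 1" for i s u b
        using that(1) near_in[OF that(2,3)] unfolding strand_germs_def eventually_at_split
        by (auto elim: eventually_elim2)
      have "has_germs F' p u (leaves_right D' p q)"
        unfolding i(5) j(1)
        using P'.has_germs_e_iff[of i j s t F' u] sg[OF uv(2) i(1) t(3)] i j t \<open>j < length T\<close> same_length by simp
      moreover have "has_germs F' q v (leaves_right D' q p)"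
        unfolding i(5) j(1)
        using P'.has_germs_e_iff[of j i t s F' v] sg[OF uv(3) \<open>j < length T\<close> t(2)] i j t \<open>j < length T\<close> same_length
          strand_crosses_commute by auto
      ultimately show ?thesis
        using uv(1) unfolding crossing_ok_def by blast
    next
      case False
      then have p1: "p \<notin> P.arcs_upto 1"
        using crosses_not_in_collar * by blast
      then have c: "crosses D p q"
        using crosses_outside_iff * by blast
      then have q1: "q \<notin> P.arcs_upto 1"
        using crosses_outside p1 by blast
      have c': "crosses D q p"
        using c by (auto simp: crosses_def)
      have "crossing_ok X D F p q"
        using F * c unfolding outside_level[OF c p1] outside_level[OF c' q1] point_colorings_def by blast
      then obtain u v where uv: "crossing_rel X u v" "has_germs F p u (leaves_right D p q)"
          "has_germs F q v (leaves_right D q p)"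
        unfolding crossing_ok_def by blast
      have hg: "has_germs F' p u b" if "has_germs F p u b" "p \<notin> P.arcs_upto 1" for p u b
      proof -
        have "\<forall>\<^sub>F s in at 0. F' (rot p s) = F (rot p s)"
          using near_out that(2) arcs_upto_mono by blast
        then show ?thesis
          using that(1) unfolding has_germs_def eventually_at_0_cases by (auto elim: eventually_elim2)
      qed
      have "leaves_right D' p q = leaves_right D p q" "leaves_right D' q p = leaves_right D q p"
        using velocity_outside p1 q1 crosses_in_circles[OF c] by (simp_all add: leaves_right_def)
      then show ?thesis
        using uv(1) hg[OF uv(2) p1] hg[OF uv(3) q1] unfolding crossing_ok_def by auto
    qed
  qed
  moreover have "\<forall>p\<in>regular_points D - P.arcs_upto r. F' p = F p"
    using F'_out by blast
  ultimately show ?thesis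
    by blast
qed

text \<open>Lifts \<open>tangle_extends\<close> from the picture to the diagram: a coloring is
  restricted to the arcs, treated there, and for existence glued to the unchanged outside.\<close>

lemma point_coloring_extends:
  assumes "tangle_extends X r P.pos T V P.lev T' V' P'.lev"
  shows "\<lbrakk>F \<in> point_colorings X D; F2 \<in> point_colorings X D;
      \<forall>p\<in>regular_points D - P.arcs_upto r. F p = F2 p\<rbrakk> \<Longrightarrow> F = F2"
    and "F \<in> point_colorings X D \<Longrightarrow>
      \<exists>F'\<in>point_colorings X D'. \<forall>p\<in>regular_points D - P.arcs_upto r. F p = F' p"
proof -
  assume F: "F \<in> point_colorings X D" "F2 \<in> point_colorings X D"
    and eq: "\<forall>p\<in>regular_points D - P.arcs_upto r. F p = F2 p"
  have tc: "tangle_coloring X T V P.lev P.pos (\<lambda>i t. F (e i t))" "tangle_coloring X T V P.lev P.pos (\<lambda>i t. F2 (e i t))"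
    using P.tangle_coloring_restrict F confined by blast+
  have "F (e i t) = F2 (e i t)" if "i < length T" "r < \<bar>t\<bar>" "\<bar>t\<bar> < 1" for i t
  proof -
    have "t \<in> {-1..1}"
      using that by auto
    have "\<not> strand_classical T P.lev i t"
      using that confined unfolding strand_classical_def confined_def by (metis leD)
    then have "e i t \<in> regular_points D"
      using \<open>t \<in> _\<close> that P.classical_e_iff P.e_in_circles by (simp add: regular_points_def)
    then show ?thesis
      using eq e_in_arcs_iff[of i t] that by auto
  qed
  then have inner: "F (e i t) = F2 (e i t)" if "i < length T" "\<bar>t\<bar> < 1" "\<not> strand_classical T P.lev i t" for i t
    using assms tc that unfolding tangle_extends_def by blast
  show "F = F2"
  proof (rule PiE_ext[of F "regular_points D" "\<lambda>_. carrier X" F2])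
    fix p assume p: "p \<in> regular_points D"
    show "F p = F2 p"
    proof (cases "p \<in> P.arcs_upto r")
      case True
      then obtain i t where it: "i < length T" "\<bar>t\<bar> \<le> r" "p = e i t"
        unfolding in_arcs_iff by blast
      then have "t \<in> {-1..1}"
        using r by auto
      then show ?thesis
        using inner[of i t] p it r P.classical_e_iff[of i t] by (auto simp: regular_points_def)
    qed (use p eq in auto)
  qed (use F in \<open>simp_all add: point_colorings_def\<close>)
next
  assume F: "F \<in> point_colorings X D"
  then have "tangle_coloring X T V P.lev P.pos (\<lambda>i t. F (e i t))"
    using P.tangle_coloring_restrict confined by blast
  then obtain G where "tangle_coloring X T' V' P'.lev P.pos G"
      "\<forall>i<length T. \<forall>t. r < \<bar>t\<bar> \<and> \<bar>t\<bar> < 1 \<longrightarrow> G i t = F (e i t)"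
    using assms unfolding tangle_extends_def by blast
  then show "\<exists>F'\<in>point_colorings X D'. \<forall>p\<in>regular_points D - P.arcs_upto r. F p = F' p"
    using glue_point_coloring[OF F] by metis
qed

end

text \<open>The test points are the regular points outside the core. They are the same for both
  diagrams, and include the regular points of the collars.\<close>

lemma link_barcode_eq:
  assumes conf: "confined r T" "confined r T'"
    and ext: "tangle_extends X r P.pos T V P.lev T' V' P'.lev"
    and ext': "tangle_extends X r P.pos T' V' P'.lev T V P.lev"
    and "is_filtration m S (biquandle_End X)" "finite (carrier X)"
  shows "link_barcode N X m S D = link_barcode N X m S D'"
proof -
  interpret Q: picture_pair D' D h h' e \<kappa> \<theta> \<theta>' T' T V' V
    by (rule picture_pair_commute)
  have Z: "regular_points D' - P'.arcs_upto r = regular_points D - P.arcs_upto r"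
    using regular_outside_iff[OF conf] same_arcs_upto by auto
  show ?thesis
  proof (rule link_barcode_eqI[OF assms(5,6) P.vld P'.vld, of "regular_points D - P.arcs_upto r" "\<lambda>p. p"])
    show "regular_points D - P.arcs_upto r \<subseteq> regular_points D"
      by blast
    show "(\<lambda>p. p) ` (regular_points D - P.arcs_upto r) \<subseteq> regular_points D'"
      using Z by auto
    show "\<And>F G. F \<in> point_colorings X D \<Longrightarrow> G \<in> point_colorings X D \<Longrightarrow>
        \<forall>z\<in>regular_points D - P.arcs_upto r. F z = G z \<Longrightarrow> F = G"
      by (rule point_coloring_extends(1)[OF conf ext])
    show "\<And>F G. F \<in> point_colorings X D' \<Longrightarrow> G \<in> point_colorings X D' \<Longrightarrow>
        \<forall>z\<in>regular_points D - P.arcs_upto r. F z = G z \<Longrightarrow> F = G"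
      using Q.point_coloring_extends(1)[OF conf(2,1) ext', unfolded Z] by blast
    show "\<And>F. F \<in> point_colorings X D \<Longrightarrow>
        \<exists>G\<in>point_colorings X D'. \<forall>z\<in>regular_points D - P.arcs_upto r. F z = G z"
      by (rule point_coloring_extends(2)[OF conf ext])
    show "\<And>G. G \<in> point_colorings X D' \<Longrightarrow>
        \<exists>F\<in>point_colorings X D. \<forall>z\<in>regular_points D - P.arcs_upto r. F z = G z"
      using Q.point_coloring_extends(2)[OF conf(2,1) ext', unfolded Z] by metis
  qed
qed

end

section \<open>Colorings of crossings by a biquandle\<close>

text \<open>The flag \<open>w\<close> says that the strand of \<open>u\<close> is the over-strand,
  so the two strands of a crossing may be listed in either order.\<close>

definition face_rel :: "('a, 'm) biquandle_ops_scheme \<Rightarrow> bool \<Rightarrow> (bool \<Rightarrow> 'a) \<Rightarrow> (bool \<Rightarrow> 'a) \<Rightarrow> bool" where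
  "face_rel X w u v \<longleftrightarrow> (if w then crossing_rel X v u else crossing_rel X u v)"

lemma face_rel_commute: "face_rel X w u v \<longleftrightarrow> face_rel X (\<not> w) v u"
  by (simp add: face_rel_def)

context biquandle
begin

text \<open>One known color on each strand determines the crossing. Each invertibility axiom serves
  one position of the known colors: \<open>switch_bij\<close> when both are on the left,
  \<open>over_bij\<close> and \<open>under_bij\<close> when only the over-color or only the
  under-color is.\<close>

lemma crossing_rel_unique:
  assumes "crossing_rel X u v" "crossing_rel X u' v'" "u s = u' s" "v t = v' t"
    and "\<And>b. u b \<in> carrier X" "\<And>b. v b \<in> carrier X" "\<And>b. u' b \<in> carrier X" "\<And>b. v' b \<in> carrier X"
  shows "u = u' \<and> v = v'"
proof -
  have "u True = u' True \<and> v True = v' True"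
  proof (cases s; cases t)
    assume "\<not> s" "\<not> t"
    then have eq: "v True \<rhd> u True = v' True \<rhd> u' True" "u True \<unrhd> v True = u' True \<unrhd> v' True"
      using assms(1-4) by (auto simp: crossing_rel_def)
    have "(u True, v True) = (u' True, v' True)"
      by (rule inj_onD[OF bij_betw_imp_inj_on[OF switch_bij]]) (use eq assms in auto)
    then show ?thesis by simp
  next
    assume s: "s" "\<not> t"
    then have eq: "v True \<rhd> u True = v' True \<rhd> u True"
      using assms(1-4) by (auto simp: crossing_rel_def)
    then have "v True = v' True"
      using inj_onD[OF bij_betw_imp_inj_on[OF over_bij[of "u True"]]] assms by blast
    then show ?thesis
      using s assms by simp
  next
    assume s: "\<not> s" "t"
    then have eq: "u True \<unrhd> v True = u' True \<unrhd> v True"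
      using assms(1-4) by (auto simp: crossing_rel_def)
    then have "u True = u' True"
      using inj_onD[OF bij_betw_imp_inj_on[OF under_bij[of "v True"]]] assms by blast
    then show ?thesis
      using s assms by simp
  qed (use assms in simp)
  then have "u b = u' b \<and> v b = v' b" for b
    using assms(1,2) by (cases b) (simp_all add: crossing_rel_def)
  then show ?thesis
    by (simp add: fun_eq_iff)
qed

text \<open>The same four positions as for uniqueness, now using that the maps of the invertibility
  axioms are onto.\<close>

lemma crossing_rel_exists:
  assumes "a \<in> carrier X" "b \<in> carrier X"
  shows "\<exists>u v. crossing_rel X u v \<and> (\<forall>c. u c \<in> carrier X \<and> v c \<in> carrier X) \<and> u s = a \<and> v t = b"
proof -
  have ex: "\<exists>x\<in>carrier X. \<exists>y\<in>carrier X. (if s then x else x \<unrhd> y) = a \<and> (if t then y else y \<rhd> x) = b"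
  proof (cases s; cases t)
    assume st: "\<not> s" "\<not> t"
    have "(b, a) \<in> (\<lambda>(x, y). (y \<rhd> x, x \<unrhd> y)) ` (carrier X \<times> carrier X)"
      using bij_betw_imp_surj_on[OF switch_bij] assms by auto
    then show ?thesis
      using st by auto
  next
    assume st: "s" "\<not> t"
    have "b \<in> (\<lambda>x. x \<rhd> a) ` carrier X"
      using bij_betw_imp_surj_on[OF over_bij] assms by auto
    then show ?thesis
      using st assms by auto
  next
    assume st: "\<not> s" "t"
    have "a \<in> (\<lambda>x. x \<unrhd> b) ` carrier X"
      using bij_betw_imp_surj_on[OF under_bij] assms by auto
    then show ?thesis
      using st assms by auto
  qed (use assms in auto)
  then obtain x y where xy: "x \<in> carrier X" "y \<in> carrier X"
      "(if s then x else x \<unrhd> y) = a" "(if t then y else y \<rhd> x) = b"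
    by blast
  show ?thesis
    by (rule exI[of _ "\<lambda>c. if c then x else x \<unrhd> y"], rule exI[of _ "\<lambda>c. if c then y else y \<rhd> x"])
      (use xy in \<open>auto simp: crossing_rel_def under_closed over_closed\<close>)
qed

lemma face_rel_unique:
  assumes "face_rel X w u v" "face_rel X w u' v'" "u s = u' s" "v t = v' t"
    and "\<And>b. u b \<in> carrier X" "\<And>b. v b \<in> carrier X" "\<And>b. u' b \<in> carrier X" "\<And>b. v' b \<in> carrier X"
  shows "u = u'" "v = v'"
  using crossing_rel_unique[of u v u' v' s t] crossing_rel_unique[of v u v' u' t s] assms
  by (simp_all add: face_rel_def split: if_splits)

lemma face_rel_exists:
  assumes "a \<in> carrier X" "b \<in> carrier X"
  shows "\<exists>u v. face_rel X w u v \<and> (\<forall>c. u c \<in> carrier X \<and> v c \<in> carrier X) \<and> u s = a \<and> v t = b"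
proof (cases w)
  case True
  then show ?thesis
    using crossing_rel_exists[OF assms(2,1), of t s] by (auto simp: face_rel_def)
next
  case False
  then show ?thesis
    using crossing_rel_exists[OF assms, of s t] by (auto simp: face_rel_def)
qed

text \<open>The switch map sends the diagonal injectively, hence for finite carriers bijectively, to itself.\<close>

lemma crossing_rel_diagonal_exists:
  assumes "finite (carrier X)" "x \<in> carrier X"
  shows "\<exists>w. crossing_rel X w w \<and> (\<forall>c. w c \<in> carrier X) \<and> w b = x"
proof -
  have "\<exists>y\<in>carrier X. (if b then y else y \<unrhd> y) = x"
  proof (cases b)
    case False
    have "inj_on (\<lambda>y. y \<unrhd> y) (carrier X)"
    proof (rule inj_onI)
      fix y z assume yz: "y \<in> carrier X" "z \<in> carrier X" "y \<unrhd> y = z \<unrhd> z"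
      have "(y, y) = (z, z)"
        by (rule inj_onD[OF bij_betw_imp_inj_on[OF switch_bij]]) (use yz diagonal in auto)
      then show "y = z" by simp
    qed
    then have "(\<lambda>y. y \<unrhd> y) ` carrier X = carrier X"
      using assms(1) by (intro endo_inj_surj) (auto simp: under_closed)
    then have "x \<in> (\<lambda>y. y \<unrhd> y) ` carrier X"
      using assms(2) by simp
    then show ?thesis
      using False by auto
  qed (use assms in auto)
  then obtain y where "y \<in> carrier X" "(if b then y else y \<unrhd> y) = x"
    by blast
  then show ?thesis
    by (intro exI[of _ "\<lambda>c. if c then y else y \<unrhd> y"]) (auto simp: crossing_rel_def under_closed diagonal[symmetric])
qed

text \<open>The diagonal solution with color \<open>u b\<close> on side \<open>b\<close> agrees with
  the given one on that side of both strands; a crossing with these two colors is unique.\<close>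

lemma crossing_rel_diagonal_unique:
  assumes "finite (carrier X)" "crossing_rel X u v" "u b = v b"
    and "\<And>b. u b \<in> carrier X" "\<And>b. v b \<in> carrier X"
  shows "u = v"
proof -
  obtain w where w: "crossing_rel X w w" "\<And>c. w c \<in> carrier X" "w b = u b"
    using crossing_rel_diagonal_exists[OF assms(1) assms(4)] by metis
  have "u = w \<and> v = w"
    by (rule crossing_rel_unique[OF assms(2) w(1), of b b]) (use w assms in auto)
  then show ?thesis by simp
qed

section \<open>The cube of colors for the third move\<close>

definition act :: "bool \<Rightarrow> 'a \<Rightarrow> 'a \<Rightarrow> 'a" where
  "act w x y = (if w then x \<rhd> y else x \<unrhd> y)"

lemma act_closed: "x \<in> carrier X \<Longrightarrow> y \<in> carrier X \<Longrightarrow> act w x y \<in> carrier X"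
  by (simp add: act_def under_closed over_closed)

text \<open>\<open>act w x y\<close> is the color that a strand colored \<open>x\<close> on the
  right takes on the left of a strand colored \<open>y\<close>; \<open>w\<close> tells whether it
  passes over.\<close>

lemma face_rel_act: "face_rel X w u v \<longleftrightarrow> u False = act w (u True) (v True) \<and> v False = act (\<not> w) (v True) (u True)"
  by (auto simp: face_rel_def crossing_rel_def act_def)

text \<open>
  The flags say for each pair of three strands which one is above; two of the eight
  combinations are cyclic.
\<close>

lemma act_exchange:
  assumes "\<not> (wxy \<and> wyz \<and> \<not> wxz)" "\<not> (\<not> wxy \<and> \<not> wyz \<and> wxz)"
    and "x \<in> carrier X" "y \<in> carrier X" "z \<in> carrier X"
  shows "act wxz (act wxy x y) (act (\<not> wyz) z y) = act wxy (act wxz x z) (act wyz y z)"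
  using assms exchange_under[of x y z] exchange_under[of x z y] exchange_mixed[of x y z] exchange_mixed[of x z y]
    exchange_over[of x y z] exchange_over[of x z y]
  by (cases wxy; cases wxz; cases wyz) (simp_all add: act_def)

text \<open>
  The colors of the three strands of a Reidemeister-3 picture are indexed by the sides
  (\<open>True\<close> is right) of the two other strands: they label the edges of a cube, whose faces
  are the crossings.  The three crossings on either side of the move are the faces at one of
  two opposite vertices.
\<close>

definition cube ::
  "bool \<Rightarrow> bool \<Rightarrow> bool \<Rightarrow> (bool \<Rightarrow> bool \<Rightarrow> 'a) \<Rightarrow> (bool \<Rightarrow> bool \<Rightarrow> 'a) \<Rightarrow> (bool \<Rightarrow> bool \<Rightarrow> 'a) \<Rightarrow> bool" where
  "cube w01 w02 w12 c0 c1 c2 \<longleftrightarrow>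
     (\<forall>a b. c0 a b \<in> carrier X \<and> c1 a b \<in> carrier X \<and> c2 a b \<in> carrier X) \<and>
     (\<forall>s. face_rel X w01 (\<lambda>b. c0 b s) (\<lambda>b. c1 b s)) \<and>
     (\<forall>s. face_rel X w02 (\<lambda>b. c0 s b) (\<lambda>b. c2 b s)) \<and>
     (\<forall>s. face_rel X w12 (\<lambda>b. c1 s b) (\<lambda>b. c2 s b))"

text \<open>Excludes the two cyclic arrangements: 0 over 1 over 2 over 0, and its reverse.\<close>

definition acyclic_flags :: "bool \<Rightarrow> bool \<Rightarrow> bool \<Rightarrow> bool" where
  "acyclic_flags w01 w02 w12 \<longleftrightarrow> \<not> (w01 \<and> w12 \<and> \<not> w02) \<and> \<not> (\<not> w01 \<and> \<not> w12 \<and> w02)"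

text \<open>From the three edges at the vertex to the right of all strands \<open>act\<close>
  computes the others. Each of the three edges at the opposite vertex is reached through two faces;
  the exchange laws \<open>e0\<close>, \<open>e1\<close>, \<open>e2\<close> say that both ways give
  the same color.\<close>

lemma cube_exists_right:
  assumes "acyclic_flags w01 w02 w12" "x0 \<in> carrier X" "x1 \<in> carrier X" "x2 \<in> carrier X"
  shows "\<exists>c0 c1 c2. cube w01 w02 w12 c0 c1 c2 \<and> c0 True True = x0 \<and> c1 True True = x1 \<and> c2 True True = x2"
proof -
  define c0 where "c0 a b = (if a then if b then x0 else act w02 x0 x2
      else if b then act w01 x0 x1 else act w02 (act w01 x0 x1) (act (\<not> w12) x2 x1))" for a b
  define c1 where "c1 a b = (if a then if b then x1 else act w12 x1 x2
      else if b then act (\<not> w01) x1 x0 else act w12 (act (\<not> w01) x1 x0) (act (\<not> w02) x2 x0))" for a b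
  define c2 where "c2 a b = (if a then if b then x2 else act (\<not> w12) x2 x1
      else if b then act (\<not> w02) x2 x0 else act (\<not> w12) (act (\<not> w02) x2 x0) (act (\<not> w01) x1 x0))" for a b
  have e0: "act w02 (act w01 x0 x1) (act (\<not> w12) x2 x1) = act w01 (act w02 x0 x2) (act w12 x1 x2)"
    by (rule act_exchange) (use assms in \<open>auto simp: acyclic_flags_def\<close>)
  have e1: "act w12 (act (\<not> w01) x1 x0) (act (\<not> w02) x2 x0) = act (\<not> w01) (act w12 x1 x2) (act w02 x0 x2)"
    by (rule act_exchange) (use assms in \<open>auto simp: acyclic_flags_def\<close>)
  have e2: "act (\<not> w12) (act (\<not> w02) x2 x0) (act (\<not> w01) x1 x0) = act (\<not> w02) (act (\<not> w12) x2 x1) (act w01 x0 x1)"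
    using act_exchange[of "\<not> w02" "w01" "\<not> w12" x2 x0 x1] assms by (auto simp: acyclic_flags_def)
  have "cube w01 w02 w12 c0 c1 c2"
    unfolding cube_def
  proof (intro conjI allI)
    fix s
    show "face_rel X w01 (\<lambda>b. c0 b s) (\<lambda>b. c1 b s)" "face_rel X w02 (\<lambda>b. c0 s b) (\<lambda>b. c2 b s)"
      "face_rel X w12 (\<lambda>b. c1 s b) (\<lambda>b. c2 s b)"
      using e0 e1 e2 by (cases s; simp add: face_rel_act c0_def c1_def c2_def)+
  qed (use assms in \<open>simp_all add: c0_def c1_def c2_def act_closed\<close>)
  then show ?thesis
    by (intro exI[of _ c0] exI[of _ c1] exI[of _ c2]) (simp add: c0_def c1_def c2_def)
qed

lemma cube_unique_faces:
  assumes "cube w01 w02 w12 c0 c1 c2"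
  shows "face_rel X w01 u v \<Longrightarrow> (\<And>b. u b \<in> carrier X \<and> v b \<in> carrier X) \<Longrightarrow>
      u s = c0 s t \<Longrightarrow> v s' = c1 s' t \<Longrightarrow> u b = c0 b t \<and> v b = c1 b t"
    and "face_rel X w02 u v \<Longrightarrow> (\<And>b. u b \<in> carrier X \<and> v b \<in> carrier X) \<Longrightarrow>
      u s = c0 t s \<Longrightarrow> v s' = c2 s' t \<Longrightarrow> u b = c0 t b \<and> v b = c2 b t"
    and "face_rel X w12 u v \<Longrightarrow> (\<And>b. u b \<in> carrier X \<and> v b \<in> carrier X) \<Longrightarrow>
      u s = c1 t s \<Longrightarrow> v s' = c2 t s' \<Longrightarrow> u b = c1 t b \<and> v b = c2 t b"
proof -
  show "u b = c0 b t \<and> v b = c1 b t" if "face_rel X w01 u v" "\<And>b. u b \<in> carrier X \<and> v b \<in> carrier X"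
      "u s = c0 s t" "v s' = c1 s' t"
    using face_rel_unique[of w01 u v "\<lambda>b. c0 b t" "\<lambda>b. c1 b t" s s'] that assms by (simp add: cube_def)
  show "u b = c0 t b \<and> v b = c2 b t" if "face_rel X w02 u v" "\<And>b. u b \<in> carrier X \<and> v b \<in> carrier X"
      "u s = c0 t s" "v s' = c2 s' t"
    using face_rel_unique[of w02 u v "\<lambda>b. c0 t b" "\<lambda>b. c2 b t" s s'] that assms by (simp add: cube_def)
  show "u b = c1 t b \<and> v b = c2 t b" if "face_rel X w12 u v" "\<And>b. u b \<in> carrier X \<and> v b \<in> carrier X"
      "u s = c1 t s" "v s' = c2 t s'"
    using face_rel_unique[of w12 u v "\<lambda>b. c1 t b" "\<lambda>b. c2 t b" s s'] that assms by (simp add: cube_def)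
qed

definition cubes_at where
  "cubes_at w01 w02 w12 v0 v1 v2 \<longleftrightarrow> (\<forall>x0\<in>carrier X. \<forall>x1\<in>carrier X. \<forall>x2\<in>carrier X.
     \<exists>c0 c1 c2. cube w01 w02 w12 c0 c1 c2 \<and> c0 v1 v2 = x0 \<and> c1 v0 v2 = x1 \<and> c2 v0 v1 = x2)"

text \<open>Two neighbouring vertices share an edge. The other two edges at the new vertex are
  carried along the faces containing the shared edge to edges at the old vertex. The cube found
  there has the prescribed colors, because a face is determined by one edge of each strand.\<close>

lemma cubes_at_flip:
  assumes "cubes_at w01 w02 w12 v0 v1 v2"
  shows "cubes_at w01 w02 w12 (\<not> v0) v1 v2" "cubes_at w01 w02 w12 v0 (\<not> v1) v2" "cubes_at w01 w02 w12 v0 v1 (\<not> v2)"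
proof -
  show "cubes_at w01 w02 w12 (\<not> v0) v1 v2"
    unfolding cubes_at_def
  proof (intro ballI)
    fix x0 x1 x2 assume x: "x0 \<in> carrier X" "x1 \<in> carrier X" "x2 \<in> carrier X"
    obtain u v where uv: "face_rel X w01 u v" "\<And>b. u b \<in> carrier X \<and> v b \<in> carrier X" "u v1 = x0" "v (\<not> v0) = x1"
      using face_rel_exists[OF x(1,2), of w01 v1 "\<not> v0"] by blast
    obtain u' v' where uv': "face_rel X w02 u' v'" "\<And>b. u' b \<in> carrier X \<and> v' b \<in> carrier X" "u' v2 = x0" "v' (\<not> v0) = x2"
      using face_rel_exists[OF x(1,3), of w02 v2 "\<not> v0"] by blast
    obtain c0 c1 c2 where c: "cube w01 w02 w12 c0 c1 c2" "c0 v1 v2 = x0" "c1 v0 v2 = v v0" "c2 v0 v1 = v' v0"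
      using assms x uv(2) uv'(2) unfolding cubes_at_def by blast
    have "c1 (\<not> v0) v2 = x1" "c2 (\<not> v0) v1 = x2"
      using cube_unique_faces(1)[OF c(1) uv(1,2), of v1 v2 v0 "\<not> v0"]
        cube_unique_faces(2)[OF c(1) uv'(1,2), of v2 v1 v0 "\<not> v0"] uv uv' c by auto
    then show "\<exists>c0 c1 c2. cube w01 w02 w12 c0 c1 c2 \<and> c0 v1 v2 = x0 \<and> c1 (\<not> v0) v2 = x1 \<and> c2 (\<not> v0) v1 = x2"
      using c by blast
  qed
  show "cubes_at w01 w02 w12 v0 (\<not> v1) v2"
    unfolding cubes_at_def
  proof (intro ballI)
    fix x0 x1 x2 assume x: "x0 \<in> carrier X" "x1 \<in> carrier X" "x2 \<in> carrier X"
    obtain u v where uv: "face_rel X w01 u v" "\<And>b. u b \<in> carrier X \<and> v b \<in> carrier X" "u (\<not> v1) = x0" "v v0 = x1"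
      using face_rel_exists[OF x(1,2), of w01 "\<not> v1" v0] by blast
    obtain u' v' where uv': "face_rel X w12 u' v'" "\<And>b. u' b \<in> carrier X \<and> v' b \<in> carrier X" "u' v2 = x1" "v' (\<not> v1) = x2"
      using face_rel_exists[OF x(2,3), of w12 v2 "\<not> v1"] by blast
    obtain c0 c1 c2 where c: "cube w01 w02 w12 c0 c1 c2" "c0 v1 v2 = u v1" "c1 v0 v2 = x1" "c2 v0 v1 = v' v1"
      using assms x uv(2) uv'(2) unfolding cubes_at_def by blast
    have "c0 (\<not> v1) v2 = x0" "c2 v0 (\<not> v1) = x2"
      using cube_unique_faces(1)[OF c(1) uv(1,2), of v1 v2 v0 "\<not> v1"]
        cube_unique_faces(3)[OF c(1) uv'(1,2), of v2 v0 v1 "\<not> v1"] uv uv' c by auto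
    then show "\<exists>c0 c1 c2. cube w01 w02 w12 c0 c1 c2 \<and> c0 (\<not> v1) v2 = x0 \<and> c1 v0 v2 = x1 \<and> c2 v0 (\<not> v1) = x2"
      using c by blast
  qed
  show "cubes_at w01 w02 w12 v0 v1 (\<not> v2)"
    unfolding cubes_at_def
  proof (intro ballI)
    fix x0 x1 x2 assume x: "x0 \<in> carrier X" "x1 \<in> carrier X" "x2 \<in> carrier X"
    obtain u v where uv: "face_rel X w02 u v" "\<And>b. u b \<in> carrier X \<and> v b \<in> carrier X" "u (\<not> v2) = x0" "v v0 = x2"
      using face_rel_exists[OF x(1,3), of w02 "\<not> v2" v0] by blast
    obtain u' v' where uv': "face_rel X w12 u' v'" "\<And>b. u' b \<in> carrier X \<and> v' b \<in> carrier X" "u' (\<not> v2) = x1" "v' v1 = x2"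
      using face_rel_exists[OF x(2,3), of w12 "\<not> v2" v1] by blast
    obtain c0 c1 c2 where c: "cube w01 w02 w12 c0 c1 c2" "c0 v1 v2 = u v2" "c1 v0 v2 = u' v2" "c2 v0 v1 = x2"
      using assms x uv(2) uv'(2) unfolding cubes_at_def by blast
    have "c0 v1 (\<not> v2) = x0" "c1 v0 (\<not> v2) = x1"
      using cube_unique_faces(2)[OF c(1) uv(1,2), of v2 v1 v0 "\<not> v2"]
        cube_unique_faces(3)[OF c(1) uv'(1,2), of v2 v0 v1 "\<not> v2"] uv uv' c by auto
    then show "\<exists>c0 c1 c2. cube w01 w02 w12 c0 c1 c2 \<and> c0 v1 (\<not> v2) = x0 \<and> c1 v0 (\<not> v2) = x1 \<and> c2 v0 v1 = x2"
      using c by blast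
  qed
qed

text \<open>The vertex to the right of all strands is connected to every other vertex by at most
  three flips.\<close>

lemma cubes_at:
  assumes "acyclic_flags w01 w02 w12"
  shows "cubes_at w01 w02 w12 v0 v1 v2"
proof -
  have *: "cubes_at w01 w02 w12 True True True"
    unfolding cubes_at_def using cube_exists_right[OF assms] by blast
  then have "cubes_at w01 w02 w12 v0 True True"
    using cubes_at_flip(1)[OF *] by (cases v0) simp_all
  then have **: "cubes_at w01 w02 w12 v0 v1 True"
    using cubes_at_flip(2) by (cases v1) force+
  then show ?thesis
    using cubes_at_flip(3)[OF **] by (cases v2) simp_all
qed

text \<open>The crossing condition in the order of the parameter: the first strand passes from color
  \<open>x\<close> to \<open>x'\<close>, arriving on side \<open>b\<close> of the second, which
  passes from \<open>y\<close> to \<open>y'\<close>, arriving on side \<open>b'\<close> of the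
  first.\<close>

definition face where
  "face w b x x' b' y y' \<longleftrightarrow> (\<exists>u v. face_rel X w u v \<and> u b = x' \<and> u (\<not> b) = x \<and> v b' = y' \<and> v (\<not> b') = y)"

lemma faceD:
  assumes "face w b x x' b' y y'" "x \<in> carrier X" "x' \<in> carrier X" "y \<in> carrier X" "y' \<in> carrier X"
  obtains u v where "face_rel X w u v" "\<And>c. u c \<in> carrier X \<and> v c \<in> carrier X" "u b = x'" "u (\<not> b) = x" "v b' = y'" "v (\<not> b') = y"
proof -
  obtain u v where uv: "face_rel X w u v" "u b = x'" "u (\<not> b) = x" "v b' = y'" "v (\<not> b') = y"
    using assms(1) unfolding face_def by blast
  have "u c \<in> carrier X \<and> v c \<in> carrier X" for c
    using uv assms by (cases "c = b"; cases "c = b'") auto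
  then show ?thesis
    using that uv by blast
qed

text \<open>The two faces may list the pieces of a strand in opposite orders, namely when their
  sides differ; hence the case distinctions, which always compare colors on the same side. The
  reversed order occurs in the second move.\<close>

lemma face_unique:
  assumes "face w b x1 x2 b' y1 y2" "face w c x1' x2' c' y1' y2'"
    and "{x1, x2, y1, y2} \<subseteq> carrier X" "{x1', x2', y1', y2'} \<subseteq> carrier X"
    and "c = b \<Longrightarrow> x1 = x1' \<or> x2 = x2'" "c \<noteq> b \<Longrightarrow> x1 = x2' \<or> x2 = x1'"
    and "c' = b' \<Longrightarrow> y1 = y1' \<or> y2 = y2'" "c' \<noteq> b' \<Longrightarrow> y1 = y2' \<or> y2 = y1'"
  shows "(if c = b then x1 = x1' \<and> x2 = x2' else x1 = x2' \<and> x2 = x1') \<and>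
    (if c' = b' then y1 = y1' \<and> y2 = y2' else y1 = y2' \<and> y2 = y1')"
proof -
  obtain u v where uv: "face_rel X w u v" "\<And>c. u c \<in> carrier X \<and> v c \<in> carrier X" "u b = x2" "u (\<not> b) = x1" "v b' = y2" "v (\<not> b') = y1"
    using faceD[OF assms(1)] assms(3) by auto
  obtain u' v' where uv': "face_rel X w u' v'" "\<And>c. u' c \<in> carrier X \<and> v' c \<in> carrier X" "u' c = x2'" "u' (\<not> c) = x1'" "v' c' = y2'" "v' (\<not> c') = y1'"
    using faceD[OF assms(2)] assms(4) by auto
  have "u b = u' b \<or> u (\<not> b) = u' (\<not> b)"
    using uv(3,4) uv'(3,4) assms(5,6) by (cases b; cases c) auto
  moreover have "v b' = v' b' \<or> v (\<not> b') = v' (\<not> b')"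
    using uv(5,6) uv'(5,6) assms(7,8) by (cases b'; cases c') auto
  ultimately have "u = u'" "v = v'"
    using face_rel_unique[OF uv(1) uv'(1)] uv(2) uv'(2) by blast+
  then show ?thesis
    using uv uv' by (cases "c = b"; cases "c' = b'") auto
qed

text \<open>
  The colors of the three pieces of each strand when the crossings are met in the order of
  \<^term>\<open>R3_above\<close>; the \<open>\<pi>\<close>s tell whether the strands are oriented from left to right.  With
  reversed pieces and negated \<open>\<pi>\<close>s this is also the condition for \<^term>\<open>R3_below\<close>.
\<close>

definition triangle where
  "triangle w01 w02 w12 \<pi>0 \<pi>1 \<pi>2 p0 p1 p2 q0 q1 q2 s0 s1 s2 \<longleftrightarrow>
     {p0, p1, p2, q0, q1, q2, s0, s1, s2} \<subseteq> carrier X \<and>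
     face w01 (\<not> \<pi>1) p0 p1 \<pi>0 q1 q2 \<and> face w02 (\<not> \<pi>2) p1 p2 \<pi>0 s1 s2 \<and> face w12 \<pi>2 q0 q1 (\<not> \<pi>1) s0 s1"

text \<open>The middle pieces \<open>p1\<close>, \<open>q1\<close>, \<open>s1\<close> are the sides
  of the small triangle, that is, the edges at one vertex of the cube: the region inside the
  triangle. A cube with these edges exists, and each crossing is then forced to be its face.\<close>

lemma triangle_iff_cube:
  assumes "acyclic_flags w01 w02 w12"
  shows "triangle w01 w02 w12 \<pi>0 \<pi>1 \<pi>2 p0 p1 p2 q0 q1 q2 s0 s1 s2 \<longleftrightarrow>
    (\<exists>c0 c1 c2. cube w01 w02 w12 c0 c1 c2 \<and>
       p0 = c0 \<pi>1 \<pi>2 \<and> p1 = c0 (\<not> \<pi>1) \<pi>2 \<and> p2 = c0 (\<not> \<pi>1) (\<not> \<pi>2) \<and>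
       q0 = c1 (\<not> \<pi>0) (\<not> \<pi>2) \<and> q1 = c1 (\<not> \<pi>0) \<pi>2 \<and> q2 = c1 \<pi>0 \<pi>2 \<and>
       s0 = c2 (\<not> \<pi>0) \<pi>1 \<and> s1 = c2 (\<not> \<pi>0) (\<not> \<pi>1) \<and> s2 = c2 \<pi>0 (\<not> \<pi>1))" (is "?L \<longleftrightarrow> ?R")
proof
  assume L: ?L
  then have car: "p0 \<in> carrier X" "p1 \<in> carrier X" "p2 \<in> carrier X" "q0 \<in> carrier X" "q1 \<in> carrier X"
    "q2 \<in> carrier X" "s0 \<in> carrier X" "s1 \<in> carrier X" "s2 \<in> carrier X"
    by (simp_all add: triangle_def)
  obtain c0 c1 c2 where c: "cube w01 w02 w12 c0 c1 c2" "c0 (\<not> \<pi>1) \<pi>2 = p1" "c1 (\<not> \<pi>0) \<pi>2 = q1" "c2 (\<not> \<pi>0) (\<not> \<pi>1) = s1"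
    using cubes_at[OF assms, of "\<not> \<pi>0" "\<not> \<pi>1" \<pi>2] car unfolding cubes_at_def by blast
  obtain u v where 1: "face_rel X w01 u v" "\<And>c. u c \<in> carrier X \<and> v c \<in> carrier X" "u (\<not> \<pi>1) = p1" "u (\<not> \<not> \<pi>1) = p0" "v \<pi>0 = q2" "v (\<not> \<pi>0) = q1"
    using L faceD[of w01 "\<not> \<pi>1" p0 p1 \<pi>0 q1 q2] car unfolding triangle_def by metis
  have "u \<pi>1 = c0 \<pi>1 \<pi>2" "v \<pi>0 = c1 \<pi>0 \<pi>2"
    using cube_unique_faces(1)[OF c(1) 1(1,2), of "\<not> \<pi>1" \<pi>2 "\<not> \<pi>0"] 1 c by auto
  then have a: "p0 = c0 \<pi>1 \<pi>2" "q2 = c1 \<pi>0 \<pi>2"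
    using 1 by simp_all
  obtain u v where 2: "face_rel X w02 u v" "\<And>c. u c \<in> carrier X \<and> v c \<in> carrier X" "u (\<not> \<pi>2) = p2" "u (\<not> \<not> \<pi>2) = p1" "v \<pi>0 = s2" "v (\<not> \<pi>0) = s1"
    using L faceD[of w02 "\<not> \<pi>2" p1 p2 \<pi>0 s1 s2] car unfolding triangle_def by metis
  have b: "p2 = c0 (\<not> \<pi>1) (\<not> \<pi>2)" "s2 = c2 \<pi>0 (\<not> \<pi>1)"
    using cube_unique_faces(2)[OF c(1) 2(1,2), of \<pi>2 "\<not> \<pi>1" "\<not> \<pi>0"] 2 c by auto
  obtain u v where 3: "face_rel X w12 u v" "\<And>c. u c \<in> carrier X \<and> v c \<in> carrier X" "u \<pi>2 = q1" "u (\<not> \<pi>2) = q0" "v (\<not> \<pi>1) = s1" "v (\<not> \<not> \<pi>1) = s0"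
    using L faceD[of w12 "\<pi>2" q0 q1 "\<not> \<pi>1" s0 s1] car unfolding triangle_def by metis
  have d: "q0 = c1 (\<not> \<pi>0) (\<not> \<pi>2)" "s0 = c2 (\<not> \<pi>0) \<pi>1"
    using cube_unique_faces(3)[OF c(1) 3(1,2), of \<pi>2 "\<not> \<pi>0" "\<not> \<pi>1"] 3 c by auto
  show ?R
    using c a b d by blast
next
  assume ?R
  then obtain c0 c1 c2 where c: "cube w01 w02 w12 c0 c1 c2"
    "p0 = c0 \<pi>1 \<pi>2" "p1 = c0 (\<not> \<pi>1) \<pi>2" "p2 = c0 (\<not> \<pi>1) (\<not> \<pi>2)"
    "q0 = c1 (\<not> \<pi>0) (\<not> \<pi>2)" "q1 = c1 (\<not> \<pi>0) \<pi>2" "q2 = c1 \<pi>0 \<pi>2"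
    "s0 = c2 (\<not> \<pi>0) \<pi>1" "s1 = c2 (\<not> \<pi>0) (\<not> \<pi>1)" "s2 = c2 \<pi>0 (\<not> \<pi>1)"
    by blast
  have "face w01 (\<not> \<pi>1) p0 p1 \<pi>0 q1 q2"
    unfolding face_def using c
    by (intro exI[of _ "\<lambda>b. c0 b \<pi>2"] exI[of _ "\<lambda>b. c1 b \<pi>2"]) (simp add: cube_def)
  moreover have "face w02 (\<not> \<pi>2) p1 p2 \<pi>0 s1 s2"
    unfolding face_def using c
    by (intro exI[of _ "\<lambda>b. c0 (\<not> \<pi>1) b"] exI[of _ "\<lambda>b. c2 b (\<not> \<pi>1)"]) (simp add: cube_def)
  moreover have "face w12 \<pi>2 q0 q1 (\<not> \<pi>1) s0 s1"
    unfolding face_def using c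
    by (intro exI[of _ "\<lambda>b. c1 (\<not> \<pi>0) b"] exI[of _ "\<lambda>b. c2 (\<not> \<pi>0) b"]) (simp add: cube_def)
  ultimately show ?L
    using c by (simp add: triangle_def cube_def)
qed

text \<open>Of the twelve edges three lie at the vertex of the triangle, three at the opposite
  vertex, and the other six are the outer pieces. The move keeps the cube and its outer edges and
  replaces the middle pieces by the edges at the opposite vertex.\<close>

lemma triangle_move:
  assumes "acyclic_flags w01 w02 w12" "triangle w01 w02 w12 \<pi>0 \<pi>1 \<pi>2 p0 p1 p2 q0 q1 q2 s0 s1 s2"
  shows "\<exists>p q s. triangle w01 w02 w12 (\<not> \<pi>0) (\<not> \<pi>1) (\<not> \<pi>2) p2 p p0 q2 q q0 s2 s s0"
proof -
  obtain c0 c1 c2 where c: "cube w01 w02 w12 c0 c1 c2"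
    "p0 = c0 \<pi>1 \<pi>2" "p2 = c0 (\<not> \<pi>1) (\<not> \<pi>2)"
    "q0 = c1 (\<not> \<pi>0) (\<not> \<pi>2)" "q2 = c1 \<pi>0 \<pi>2"
    "s0 = c2 (\<not> \<pi>0) \<pi>1" "s2 = c2 \<pi>0 (\<not> \<pi>1)"
    using assms(2) unfolding triangle_iff_cube[OF assms(1)] by blast
  show ?thesis
    unfolding triangle_iff_cube[OF assms(1)] using c
    by (intro exI[of _ "c0 \<pi>1 (\<not> \<pi>2)"] exI[of _ "c1 \<pi>0 (\<not> \<pi>2)"] exI[of _ "c2 \<pi>0 \<pi>1"] exI[of _ c0] exI[of _ c1] exI[of _ c2]) simp
qed

text \<open>Two crossings suffice: the first has known outer colors \<open>p0\<close> and
  \<open>q2\<close>, the second \<open>p2\<close> and \<open>s2\<close>.\<close>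

lemma triangle_unique:
  assumes "triangle w01 w02 w12 \<pi>0 \<pi>1 \<pi>2 p0 p1 p2 q0 q1 q2 s0 s1 s2"
    and "triangle w01 w02 w12 \<pi>0 \<pi>1 \<pi>2 p0 p1' p2 q0 q1' q2 s0 s1' s2"
  shows "p1 = p1' \<and> q1 = q1' \<and> s1 = s1'"
  using face_unique[of w01 "\<not> \<pi>1" p0 p1 \<pi>0 q1 q2 "\<not> \<pi>1" p0 p1' \<pi>0 q1' q2]
    face_unique[of w02 "\<not> \<pi>2" p1 p2 \<pi>0 s1 s2 "\<not> \<pi>2" p1' p2 \<pi>0 s1' s2] assms
  by (simp add: triangle_def)

end

section \<open>Colorings of strands as step functions\<close>

text \<open>The value at a cut is that of the following piece. At a classical crossing
  \<open>tangle_coloring\<close> does not look at it.\<close>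

definition step :: "real \<Rightarrow> real \<Rightarrow> 'a \<Rightarrow> 'a \<Rightarrow> 'a \<Rightarrow> real \<Rightarrow> 'a" where
  "step c1 c2 x0 x1 x2 t = (if t < c1 then x0 else if t < c2 then x1 else x2)"

lemma strand_germs_const:
  assumes "\<forall>\<^sub>F x in at_right s. g x = y" "\<forall>\<^sub>F x in at_left s. g x = y'"
  shows "strand_germs g s u b \<longleftrightarrow> u b = y \<and> u (\<not> b) = y'"
proof -
  have const: "(\<forall>\<^sub>F x in F. g x = z) \<longleftrightarrow> z = w" if "\<forall>\<^sub>F x in F. g x = w" "F \<noteq> bot" for F :: "real filter" and z w
  proof
    assume "\<forall>\<^sub>F x in F. g x = z"
    then have "\<forall>\<^sub>F x in F. z = w"
      using that(1) by (rule eventually_elim2) simp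
    then show "z = w"
      using that(2) by (simp add: eventually_const_iff)
  qed (use that in simp)
  show ?thesis
    unfolding strand_germs_def using const[OF assms(1)] const[OF assms(2)] by simp
qed

lemma strand_germs_cong:
  assumes "\<forall>\<^sub>F x in at s. g x = g' x"
  shows "strand_germs g s u b \<longleftrightarrow> strand_germs g' s u b"
proof -
  have "\<forall>\<^sub>F x in at_right s. (g x = y) = (g' x = y)" "\<forall>\<^sub>F x in at_left s. (g x = y) = (g' x = y)" for y
    using assms by (auto simp: eventually_at_split elim: eventually_mono)
  then show ?thesis
    unfolding strand_germs_def by (intro arg_cong2[where f = "(\<and>)"] eventually_subst)
qed

lemma strand_germs_step:
  assumes "c1 < c2"
  shows "strand_germs (step c1 c2 x0 x1 x2) c1 u b \<longleftrightarrow> u b = x1 \<and> u (\<not> b) = x0"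
    and "strand_germs (step c1 c2 x0 x1 x2) c2 u b \<longleftrightarrow> u b = x2 \<and> u (\<not> b) = x1"
proof -
  show "strand_germs (step c1 c2 x0 x1 x2) c1 u b \<longleftrightarrow> u b = x1 \<and> u (\<not> b) = x0"
  proof (rule strand_germs_const)
    show "\<forall>\<^sub>F x in at_right c1. step c1 c2 x0 x1 x2 x = x1"
      by (rule eventually_at_rightI[OF _ assms]) (simp add: step_def)
    show "\<forall>\<^sub>F x in at_left c1. step c1 c2 x0 x1 x2 x = x0"
      by (rule eventually_at_leftI[of "c1 - 1"]) (simp_all add: step_def)
  qed
  show "strand_germs (step c1 c2 x0 x1 x2) c2 u b \<longleftrightarrow> u b = x2 \<and> u (\<not> b) = x1"
  proof (rule strand_germs_const)
    show "\<forall>\<^sub>F x in at_right c2. step c1 c2 x0 x1 x2 x = x2"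
      by (rule eventually_at_rightI[of _ "c2 + 1"]) (use assms in \<open>simp_all add: step_def\<close>)
    show "\<forall>\<^sub>F x in at_left c2. step c1 c2 x0 x1 x2 x = x1"
      by (rule eventually_at_leftI[OF _ assms]) (simp add: step_def)
  qed
qed

lemma locally_constant_interval:
  fixes g :: "real \<Rightarrow> 'a"
  assumes "\<And>t. t \<in> {a<..<b} \<Longrightarrow> \<forall>\<^sub>F s in at t. g s = g t" "s \<in> {a<..<b}" "t \<in> {a<..<b}"
  shows "g s = g t"
proof (rule connected_local_const[of "{a<..<b}"])
  show "\<forall>x\<in>{a<..<b}. \<forall>\<^sub>F y in at x within {a<..<b}. g x = g y"
  proof
    fix x assume "x \<in> {a<..<b}"
    then have "\<forall>\<^sub>F y in at x. g x = g y"
      by (intro eventually_mono[OF assms(1)]) simp_all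
    then show "\<forall>\<^sub>F y in at x within {a<..<b}. g x = g y"
      using at_le[of "{a<..<b}" UNIV x] filter_leD by blast
  qed
qed (use assms in auto)

lemma tangle_coloring_interval:
  assumes "tangle_coloring X T V lev pos G" "i < length T" "- 1 \<le> a" "a < b" "b \<le> 1"
    and "\<And>t. t \<in> {a<..<b} \<Longrightarrow> \<not> strand_classical T lev i t"
  shows "\<exists>x\<in>carrier X. \<forall>t\<in>{a<..<b}. G i t = x"
proof -
  have *: "G i t \<in> carrier X \<and> (\<forall>\<^sub>F s in at t. G i s = G i t)" if "t \<in> {a<..<b}" for t
    using assms that unfolding tangle_coloring_def by auto
  have m: "(a + b) / 2 \<in> {a<..<b}"
    using assms by auto
  have "G i t = G i ((a + b) / 2)" if "t \<in> {a<..<b}" for t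
    by (rule locally_constant_interval[of a b]) (use * that m in auto)
  then show ?thesis
    using * m by blast
qed

definition valid_levels :: "(real \<Rightarrow> complex) list \<Rightarrow> (nat \<Rightarrow> real \<Rightarrow> level) \<Rightarrow> bool" where
  "valid_levels T lev \<longleftrightarrow> (\<forall>i s j t. strand_crosses T i s j t \<longrightarrow>
     (lev i s, lev j t) \<in> {(Over, Under), (Under, Over), (Virtual, Virtual)})"

text \<open>Allows a crossing to be read with its strands in the order of their numbers, whichever
  of them is over.\<close>

definition crossing_face where
  "crossing_face X V lev pos G i s j t \<longleftrightarrow> (\<exists>u v. face_rel X (lev i s = Over) u v \<and>
     strand_germs (G i) s u (to_right (pos j) (V j t) (V i s)) \<and>
     strand_germs (G j) t v (to_right (pos i) (V i s) (V j t)))"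

lemma crossing_face_commute:
  assumes "(lev i s, lev j t) \<in> {(Over, Under), (Under, Over)}"
  shows "crossing_face X V lev pos G i s j t \<longleftrightarrow> crossing_face X V lev pos G j t i s"
proof -
  have "(lev j t = Over) = (\<not> lev i s = Over)"
    using assms by auto
  then show ?thesis
    unfolding crossing_face_def face_rel_commute[of X "lev i s = Over"] by auto
qed

lemma tangle_coloring_iff:
  assumes "valid_levels T lev"
  shows "tangle_coloring X T V lev pos G \<longleftrightarrow>
     (\<forall>i<length T. \<forall>t\<in>{-1<..<1}. \<not> strand_classical T lev i t \<longrightarrow>
        G i t \<in> carrier X \<and> (\<forall>\<^sub>F s in at t. G i s = G i t)) \<and>
     (\<forall>i s j t. strand_crosses T i s j t \<and> lev i s \<noteq> Virtual \<longrightarrow> crossing_face X V lev pos G i s j t)"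
proof -
  let ?C = "\<lambda>i s j t. \<exists>u v. crossing_rel X u v \<and> strand_germs (G i) s u (to_right (pos j) (V j t) (V i s)) \<and>
           strand_germs (G j) t v (to_right (pos i) (V i s) (V j t))"
  have 1: "crossing_face X V lev pos G i s j t = ?C i s j t" if "lev i s = Under" for i s j t
    using that by (simp add: crossing_face_def face_rel_def)
  have "(\<forall>i s j t. strand_crosses T i s j t \<and> lev i s = Under \<and> lev j t = Over \<longrightarrow> ?C i s j t) \<longleftrightarrow>
     (\<forall>i s j t. strand_crosses T i s j t \<and> lev i s \<noteq> Virtual \<longrightarrow> crossing_face X V lev pos G i s j t)"
  proof (intro iffI allI impI)
    fix i s j t assume *: "\<forall>i s j t. strand_crosses T i s j t \<and> lev i s = Under \<and> lev j t = Over \<longrightarrow> ?C i s j t"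
      and c: "strand_crosses T i s j t \<and> lev i s \<noteq> Virtual"
    have lev: "(lev i s, lev j t) \<in> {(Over, Under), (Under, Over)}"
      using assms c unfolding valid_levels_def by force
    show "crossing_face X V lev pos G i s j t"
    proof (cases "lev i s = Under")
      case True
      then show ?thesis
        using * c lev 1 by auto
    next
      case False
      then have "crossing_face X V lev pos G j t i s"
        using * c lev strand_crosses_commute 1[of j t] by auto
      then show ?thesis
        using crossing_face_commute[of lev i s j t] lev by blast
    qed
  next
    fix i s j t assume *: "\<forall>i s j t. strand_crosses T i s j t \<and> lev i s \<noteq> Virtual \<longrightarrow> crossing_face X V lev pos G i s j t"
      and c: "strand_crosses T i s j t \<and> lev i s = Under \<and> lev j t = Over"
    then have "crossing_face X V lev pos G i s j t"
      by auto
    then show "?C i s j t"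
      using 1 c by blast
  qed
  then show ?thesis
    unfolding tangle_coloring_def by blast
qed

abbreviation steps where
  "steps c1 c2 x0 x1 x2 \<equiv> (\<lambda>i. step (c1 i) (c2 i) (x0 i) (x1 i) (x2 i))"

text \<open>
  \<open>P x0 x1 x2\<close> characterizes the colors \<open>x0 i\<close>, \<open>x1 i\<close>, \<open>x2 i\<close> of the pieces into which
  strand \<open>i\<close> is cut at the parameters \<open>c1 i < c2 i\<close>.
\<close>

definition stepwise where
  "stepwise X r pos T V lev c1 c2 P \<longleftrightarrow>
     (\<forall>i<length T. c1 i < c2 i \<and> \<bar>c1 i\<bar> \<le> r \<and> \<bar>c2 i\<bar> \<le> r) \<and>
     (\<forall>G. tangle_coloring X T V lev pos G \<longrightarrow> (\<exists>x0 x1 x2. P x0 x1 x2 \<and>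
        (\<forall>i<length T. \<forall>t. \<bar>t\<bar> < 1 \<and> \<not> strand_classical T lev i t \<longrightarrow> G i t = steps c1 c2 x0 x1 x2 i t))) \<and>
     (\<forall>x0 x1 x2. P x0 x1 x2 \<longrightarrow> tangle_coloring X T V lev pos (steps c1 c2 x0 x1 x2))"

lemma stepwise_pieces:
  assumes "stepwise X r pos T V lev c1 c2 P" "tangle_coloring X T V lev pos G"
  shows "\<exists>x0 x1 x2. P x0 x1 x2 \<and>
    (\<forall>i<length T. \<forall>t. \<bar>t\<bar> < 1 \<and> \<not> strand_classical T lev i t \<longrightarrow> G i t = steps c1 c2 x0 x1 x2 i t)"
  using assms(1)[unfolded stepwise_def, THEN conjunct2, THEN conjunct1, THEN spec, THEN mp, OF assms(2)] .

lemma stepwise_coloring: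
  assumes "stepwise X r pos T V lev c1 c2 P" "P x0 x1 x2"
  shows "tangle_coloring X T V lev pos (steps c1 c2 x0 x1 x2)"
  using assms by (simp add: stepwise_def)

lemma not_strand_classical:
  "confined r T \<Longrightarrow> r < \<bar>t\<bar> \<Longrightarrow> \<not> strand_classical T lev i t"
  unfolding confined_def strand_classical_def by (metis leD)

text \<open>Leaves only finite data: the collar values on strand \<open>i\<close> are the outer
  colors \<open>x0 i\<close> and \<open>x2 i\<close>, so the claim becomes one about triples of
  colors.\<close>

lemma tangle_extends_stepwise:
  assumes "confined r T" "length T' = length T"
    and st: "stepwise X r pos T V lev c1 c2 P" "stepwise X r pos T' V' lev' c1' c2' P'"
    and uniq: "\<And>x0 x1 x2 y0 y1 y2. \<lbrakk>P x0 x1 x2; P y0 y1 y2; \<And>i. i < length T \<Longrightarrow> y0 i = x0 i \<and> y2 i = x2 i\<rbrakk>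
      \<Longrightarrow> \<forall>i<length T. y1 i = x1 i"
    and ex: "\<And>x0 x1 x2. P x0 x1 x2 \<Longrightarrow> \<exists>y0 y1 y2. P' y0 y1 y2 \<and> (\<forall>i<length T. y0 i = x0 i \<and> y2 i = x2 i)"
  shows "tangle_extends X r pos T V lev T' V' lev'"
proof -
  have r: "0 < r" "r < 1"
    using assms(1) by (auto simp: confined_def)
  have cuts: "c1 i < c2 i \<and> \<bar>c1 i\<bar> \<le> r \<and> \<bar>c2 i\<bar> \<le> r" "c1' i < c2' i \<and> \<bar>c1' i\<bar> \<le> r \<and> \<bar>c2' i\<bar> \<le> r"
    if "i < length T" for i
    using st that assms(2) unfolding stepwise_def by auto
  have outer: "steps c1 c2 x0 x1 x2 i t = (if t < 0 then x0 i else x2 i)"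
    "steps c1' c2' x0 x1 x2 i t = (if t < 0 then x0 i else x2 i)" if "i < length T" "r < \<bar>t\<bar>" for i t and x0 x1 x2 :: "nat \<Rightarrow> 'a"
    using cuts[OF that(1)] that(2) r by (auto simp: step_def)
  show ?thesis
    unfolding tangle_extends_def
  proof (intro conjI allI impI)
    fix G H i t
    assume "tangle_coloring X T V lev pos G \<and> tangle_coloring X T V lev pos H \<and>
        (\<forall>i<length T. \<forall>t. r < \<bar>t\<bar> \<and> \<bar>t\<bar> < 1 \<longrightarrow> G i t = H i t)"
    then have GH: "tangle_coloring X T V lev pos G" "tangle_coloring X T V lev pos H"
        "\<And>i t. i < length T \<Longrightarrow> r < \<bar>t\<bar> \<Longrightarrow> \<bar>t\<bar> < 1 \<Longrightarrow> G i t = H i t"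
      by simp_all
    assume i: "i < length T" and t: "\<bar>t\<bar> < 1 \<and> \<not> strand_classical T lev i t"
    obtain x0 x1 x2 where x: "P x0 x1 x2"
      "\<And>i t. i < length T \<Longrightarrow> \<bar>t\<bar> < 1 \<Longrightarrow> \<not> strand_classical T lev i t \<Longrightarrow> G i t = steps c1 c2 x0 x1 x2 i t"
      using stepwise_pieces[OF st(1) GH(1)] by auto
    obtain y0 y1 y2 where y: "P y0 y1 y2"
      "\<And>i t. i < length T \<Longrightarrow> \<bar>t\<bar> < 1 \<Longrightarrow> \<not> strand_classical T lev i t \<Longrightarrow> H i t = steps c1 c2 y0 y1 y2 i t"
      using stepwise_pieces[OF st(1) GH(2)] by auto
    have eq: "y0 i = x0 i \<and> y2 i = x2 i" if i: "i < length T" for i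
    proof -
      have "G i t = (if t < 0 then x0 i else x2 i) \<and> H i t = (if t < 0 then y0 i else y2 i)" if "r < \<bar>t\<bar>" "\<bar>t\<bar> < 1" for t
        using x(2)[of i t] y(2)[of i t] not_strand_classical[OF assms(1) that(1)] outer[OF i that(1)] i that by simp
      note val = this
      \<comment> \<open>The midpoint of a collar, used as a sample point at which the outer colors
        are read off.\<close>
      define c where "c = (r + 1) / 2"
      have c: "r < \<bar>c\<bar>" "\<bar>c\<bar> < 1" "0 < c" "r < \<bar>- c\<bar>" "\<bar>- c\<bar> < 1"
        using r by (auto simp: c_def)
      have "G i c = H i c" "G i (- c) = H i (- c)"
        using GH(3)[OF i] c by blast+
      then show ?thesis
        using val[OF c(1,2)] val[OF c(4,5)] c(3) by simp
    qed
    have "y1 i = x1 i"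
      using uniq[OF x(1) y(1) eq] i by blast
    then show "G i t = H i t"
      using x(2)[OF i, of t] y(2)[OF i, of t] t eq[OF i] by simp
  next
    fix G assume G: "tangle_coloring X T V lev pos G"
    obtain x0 x1 x2 where x: "P x0 x1 x2"
      "\<And>i t. i < length T \<Longrightarrow> \<bar>t\<bar> < 1 \<Longrightarrow> \<not> strand_classical T lev i t \<Longrightarrow> G i t = steps c1 c2 x0 x1 x2 i t"
      using stepwise_pieces[OF st(1) G] by auto
    obtain y0 y1 y2 where y: "P' y0 y1 y2" "\<And>i. i < length T \<Longrightarrow> y0 i = x0 i \<and> y2 i = x2 i"
      using ex[OF x(1)] by blast
    have "tangle_coloring X T' V' lev' pos (steps c1' c2' y0 y1 y2)"
      using y(1) by (rule stepwise_coloring[OF st(2)])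
    moreover have "steps c1' c2' y0 y1 y2 i t = G i t" if "i < length T" "r < \<bar>t\<bar>" "\<bar>t\<bar> < 1" for i t
      using x(2)[of i t] not_strand_classical[OF assms(1) that(2)] outer[OF that(1,2)] y(2)[OF that(1)] that by simp
    ultimately show "\<exists>H. tangle_coloring X T' V' lev' pos H \<and>
        (\<forall>i<length T. \<forall>t. r < \<bar>t\<bar> \<and> \<bar>t\<bar> < 1 \<longrightarrow> H i t = G i t)"
      by (intro exI[of _ "steps c1' c2' y0 y1 y2"]) simp
  qed
qed

text \<open>For moves that leave the classical crossings in place the same function colors both
  pictures. Uniqueness: away from parameter 0 a strand falls into two intervals, each reaching a
  collar. If 0 is not classical, the color there is the one nearby.\<close>

lemma tangle_extends_same:
  assumes "confined r T" "length T' = length T"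
    and cl: "\<And>i t. i < length T \<Longrightarrow> strand_classical T' lev' i t = strand_classical T lev i t"
    and zero: "\<And>i t. i < length T \<Longrightarrow> strand_classical T lev i t \<Longrightarrow> t = 0"
    and cr: "\<And>i s j t. strand_crosses T' i s j t \<Longrightarrow> lev' i s = Under \<Longrightarrow> lev' j t = Over \<Longrightarrow>
      strand_crosses T i s j t \<and> lev i s = Under \<and> lev j t = Over \<and> V' i s = V i s \<and> V' j t = V j t"
  shows "tangle_extends X r pos T V lev T' V' lev'"
  unfolding tangle_extends_def
proof (intro conjI allI impI)
  have r: "0 < r" "r < 1"
    using assms(1) by (auto simp: confined_def)
  fix G H i t
  assume GH: "tangle_coloring X T V lev pos G \<and> tangle_coloring X T V lev pos H \<and>
      (\<forall>i<length T. \<forall>t. r < \<bar>t\<bar> \<and> \<bar>t\<bar> < 1 \<longrightarrow> G i t = H i t)"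
    and i: "i < length T" and t: "\<bar>t\<bar> < 1 \<and> \<not> strand_classical T lev i t"
  have near: "\<forall>\<^sub>F s in at t. G i s = G i t" "\<forall>\<^sub>F s in at t. H i s = H i t"
    using GH i t unfolding tangle_coloring_def by (auto simp: abs_less_iff)
  have "G i s = H i s" if s: "s \<noteq> 0" "\<bar>s\<bar> < 1" for s
  proof -
    obtain a b m where ab: "- 1 \<le> a" "a < b" "b \<le> 1" "0 \<notin> {a<..<b}" "s \<in> {a<..<b}"
        "m \<in> {a<..<b}" "r < \<bar>m\<bar>" "\<bar>m\<bar> < 1"
    proof (cases "s < 0")
      case True
      show ?thesis
        by (rule that[of "- 1" 0 "- (r + 1) / 2"]) (use True s r in auto)
    next
      case False
      show ?thesis
        by (rule that[of 0 1 "(r + 1) / 2"]) (use False s r in auto)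
    qed
    have nc: "\<not> strand_classical T lev i x" if "x \<in> {a<..<b}" for x
      using zero[OF i] that ab(4) by blast
    obtain x where x: "\<forall>t\<in>{a<..<b}. G i t = x"
      using tangle_coloring_interval[of X T V lev pos G i a b] GH i nc ab(1-3) by blast
    obtain y where y: "\<forall>t\<in>{a<..<b}. H i t = y"
      using tangle_coloring_interval[of X T V lev pos H i a b] GH i nc ab(1-3) by blast
    have "G i m = H i m"
      using GH i ab by blast
    then show ?thesis
      using x y ab by metis
  qed
  note eq = this
  have "\<forall>\<^sub>F s in at t. s \<in> {-1<..<1}"
    using t by (intro eventually_at_in_open') (auto simp: abs_less_iff)
  moreover have "\<forall>\<^sub>F s in at t. s \<noteq> 0"
    by (rule eventually_neq_at_within)
  ultimately have "\<forall>\<^sub>F s in at t. G i s = H i s"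
    by eventually_elim (use eq in \<open>simp add: abs_less_iff\<close>)
  \<comment> \<open>Both functions are locally constant at \<open>t\<close>, so agreement at nearby
    parameters forces agreement at \<open>t\<close> itself, also for \<open>t = 0\<close>.\<close>
  then have "\<forall>\<^sub>F s in at t. G i t = H i t"
    using near by eventually_elim simp
  then show "G i t = H i t"
    by (simp add: eventually_const_iff)
next
  fix G assume "tangle_coloring X T V lev pos G"
  then have "tangle_coloring X T' V' lev' pos G"
    unfolding tangle_coloring_def using cl cr assms(2) by metis
  then show "\<exists>H. tangle_coloring X T' V' lev' pos H \<and>
      (\<forall>i<length T. \<forall>t. r < \<bar>t\<bar> \<and> \<bar>t\<bar> < 1 \<longrightarrow> H i t = G i t)"
    by blast
qed

text \<open>The cuts at \<open>- r\<close> and \<open>r\<close> are artificial. They give the strand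
  the same format of three pieces as the other side of the move.\<close>

lemma stepwise_no_crossing:
  assumes "\<And>i s j t. \<not> strand_crosses T i s j t" "0 < r"
  shows "stepwise X r pos T V lev (\<lambda>_. - r) (\<lambda>_. r)
    (\<lambda>x0 x1 x2. \<forall>i<length T. x0 i \<in> carrier X \<and> x1 i = x0 i \<and> x2 i = x0 i)"
  unfolding stepwise_def
proof (intro conjI allI impI)
  have nc: "\<not> strand_classical T lev i t" for i t
    using assms(1) by (simp add: strand_classical_def)
  show "\<exists>x0 x1 x2. (\<forall>i<length T. x0 i \<in> carrier X \<and> x1 i = x0 i \<and> x2 i = x0 i) \<and>
      (\<forall>i<length T. \<forall>t. \<bar>t\<bar> < 1 \<and> \<not> strand_classical T lev i t \<longrightarrow>
        G i t = steps (\<lambda>_. - r) (\<lambda>_. r) x0 x1 x2 i t)" if "tangle_coloring X T V lev pos G" for G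
  proof -
    have "\<exists>x. x \<in> carrier X \<and> (\<forall>t\<in>{-1<..<1}. G i t = x)" if "i < length T" for i
      using tangle_coloring_interval[OF \<open>tangle_coloring X T V lev pos G\<close> that, of "-1" 1] nc by auto
    then obtain x where "\<And>i. i < length T \<Longrightarrow> x i \<in> carrier X \<and> (\<forall>t\<in>{-1<..<1}. G i t = x i)"
      by metis
    then show ?thesis
      by (intro exI[of _ x]) (auto simp: step_def abs_less_iff)
  qed
  fix x0 x1 x2 assume x: "\<forall>i<length T. x0 i \<in> carrier X \<and> x1 i = x0 i \<and> x2 i = x0 i"
  then have "steps (\<lambda>_. - r) (\<lambda>_. r) x0 x1 x2 i = (\<lambda>_. x0 i)" if "i < length T" for i
    using that by (auto simp: step_def)
  then show "tangle_coloring X T V lev pos (steps (\<lambda>_. - r) (\<lambda>_. r) x0 x1 x2)"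
    using assms(1) x by (simp add: tangle_coloring_def)
qed (use assms in simp_all)

lemma eventually_step_eq:
  assumes "c1 < c2" "t \<noteq> c1" "t \<noteq> c2"
  shows "\<forall>\<^sub>F s in at t. step c1 c2 x0 x1 x2 s = step c1 c2 x0 x1 x2 t"
proof -
  have "(t < c1 \<longrightarrow> (\<forall>\<^sub>F s in at t. s < c1)) \<and> (t > c1 \<longrightarrow> (\<forall>\<^sub>F s in at t. s > c1)) \<and>
      (t < c2 \<longrightarrow> (\<forall>\<^sub>F s in at t. s < c2)) \<and> (t > c2 \<longrightarrow> (\<forall>\<^sub>F s in at t. s > c2))"
    by (auto intro: order_tendstoD[OF tendsto_ident_at])
  then consider "\<forall>\<^sub>F s in at t. s < c1" "t < c1" | "\<forall>\<^sub>F s in at t. s > c1" "\<forall>\<^sub>F s in at t. s < c2" "t > c1" "t < c2"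
    | "\<forall>\<^sub>F s in at t. s > c2" "t > c2"
    using assms by linarith
  then show ?thesis
  proof cases
    case 1
    from this(1) show ?thesis
      by eventually_elim (use 1 in \<open>simp add: step_def\<close>)
  next
    case 2
    from this(1,2) show ?thesis
      by eventually_elim (use 2 in \<open>simp add: step_def\<close>)
  next
    case 3
    from this(1) show ?thesis
      by eventually_elim (use 3 assms in \<open>simp add: step_def\<close>)
  qed
qed

text \<open>Exactly two classical parameters per strand leave three intervals, on each of which the
  color is constant; crossing conditions see only germs and so only these constants.\<close>

lemma stepwise_classical:
  assumes vl: "valid_levels T lev"
    and cuts: "\<And>i. i < length T \<Longrightarrow> c1 i < c2 i \<and> \<bar>c1 i\<bar> \<le> r \<and> \<bar>c2 i\<bar> \<le> r" and r: "r < 1"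
    and cl: "\<And>i t. i < length T \<Longrightarrow> strand_classical T lev i t \<longleftrightarrow> t = c1 i \<or> t = c2 i"
  shows "stepwise X r pos T V lev c1 c2
    (\<lambda>x0 x1 x2. (\<forall>i<length T. {x0 i, x1 i, x2 i} \<subseteq> carrier X) \<and>
       (\<forall>i s j t. strand_crosses T i s j t \<and> lev i s \<noteq> Virtual \<longrightarrow>
          crossing_face X V lev pos (steps c1 c2 x0 x1 x2) i s j t))"
  unfolding stepwise_def
proof (intro conjI allI impI)
  fix i assume "i < length T"
  then show "c1 i < c2 i" "\<bar>c1 i\<bar> \<le> r" "\<bar>c2 i\<bar> \<le> r"
    using cuts by auto
next
  fix G assume tc: "tangle_coloring X T V lev pos G"
  have "\<exists>x0 x1 x2. {x0, x1, x2} \<subseteq> carrier X \<and> (\<forall>t\<in>{-1<..<1}. t \<noteq> c1 i \<and> t \<noteq> c2 i \<longrightarrow> G i t = step (c1 i) (c2 i) x0 x1 x2 t)"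
    if i: "i < length T" for i
  proof -
    have c: "- 1 < c1 i" "c1 i < c2 i" "c2 i < 1"
      using cuts[OF i] r by (auto simp: abs_le_iff)
    obtain x0 where x0: "x0 \<in> carrier X" "\<forall>t\<in>{-1<..<c1 i}. G i t = x0"
      using tangle_coloring_interval[OF tc i, of "- 1" "c1 i"] c cl[OF i] by auto
    obtain x1 where x1: "x1 \<in> carrier X" "\<forall>t\<in>{c1 i<..<c2 i}. G i t = x1"
      using tangle_coloring_interval[OF tc i, of "c1 i" "c2 i"] c cl[OF i] by auto
    obtain x2 where x2: "x2 \<in> carrier X" "\<forall>t\<in>{c2 i<..<1}. G i t = x2"
      using tangle_coloring_interval[OF tc i, of "c2 i" "1"] c cl[OF i] by auto
    show ?thesis
      using x0 x1 x2 by (intro exI[of _ x0] exI[of _ x1] exI[of _ x2]) (auto simp: step_def)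
  qed
  then obtain x0 x1 x2 where x: "\<And>i. i < length T \<Longrightarrow> {x0 i, x1 i, x2 i} \<subseteq> carrier X \<and>
      (\<forall>t\<in>{-1<..<1}. t \<noteq> c1 i \<and> t \<noteq> c2 i \<longrightarrow> G i t = step (c1 i) (c2 i) (x0 i) (x1 i) (x2 i) t)"
    by metis
  \<comment> \<open>The coloring and its step function may differ at the cuts, but not in a
    punctured neighbourhood of a cut.\<close>
  have germs: "strand_germs (G i) s u b = strand_germs (steps c1 c2 x0 x1 x2 i) s u b"
    if "i < length T" "strand_classical T lev i s" for i s u b
  proof (rule strand_germs_cong)
    have "\<bar>s\<bar> < 1"
      using cl[OF that(1), of s] that(2) cuts[OF that(1)] r by auto
    then have "\<forall>\<^sub>F x in at s. x \<in> {-1<..<1}"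
      by (intro eventually_at_in_open') auto
    moreover have "\<forall>\<^sub>F x in at s. x \<noteq> c1 i" "\<forall>\<^sub>F x in at s. x \<noteq> c2 i"
      by (rule eventually_neq_at_within)+
    ultimately show "\<forall>\<^sub>F x in at s. G i x = steps c1 c2 x0 x1 x2 i x"
      by eventually_elim (use x[OF that(1)] in blast)
  qed
  show "\<exists>x0 x1 x2. ((\<forall>i<length T. {x0 i, x1 i, x2 i} \<subseteq> carrier X) \<and>
       (\<forall>i s j t. strand_crosses T i s j t \<and> lev i s \<noteq> Virtual \<longrightarrow>
          crossing_face X V lev pos (steps c1 c2 x0 x1 x2) i s j t)) \<and>
     (\<forall>i<length T. \<forall>t. \<bar>t\<bar> < 1 \<and> \<not> strand_classical T lev i t \<longrightarrow> G i t = steps c1 c2 x0 x1 x2 i t)"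
  proof (rule exI[of _ x0], rule exI[of _ x1], rule exI[of _ x2], intro conjI allI impI)
    fix i s j t assume c: "strand_crosses T i s j t \<and> lev i s \<noteq> Virtual"
    then have "crossing_face X V lev pos G i s j t"
      using tc tangle_coloring_iff[OF vl] by blast
    moreover have "i < length T" "j < length T"
      using c by (auto simp: strand_crosses_def)
    moreover have "lev j t \<noteq> Virtual"
      using c vl unfolding valid_levels_def by force
    moreover from this have "strand_classical T lev i s" "strand_classical T lev j t"
      using c strand_crosses_commute unfolding strand_classical_def by blast+
    ultimately show "crossing_face X V lev pos (steps c1 c2 x0 x1 x2) i s j t"
      unfolding crossing_face_def using germs by simp
  next
    fix i t assume "i < length T" "\<bar>t\<bar> < 1 \<and> \<not> strand_classical T lev i t"
    then show "G i t = steps c1 c2 x0 x1 x2 i t"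
      using x[of i] cl[of i t] by (simp add: abs_less_iff)
  qed (use x in blast)
next
  fix x0 x1 x2
  assume P: "(\<forall>i<length T. {x0 i, x1 i, x2 i} \<subseteq> carrier X) \<and>
       (\<forall>i s j t. strand_crosses T i s j t \<and> lev i s \<noteq> Virtual \<longrightarrow>
          crossing_face X V lev pos (steps c1 c2 x0 x1 x2) i s j t)"
  show "tangle_coloring X T V lev pos (steps c1 c2 x0 x1 x2)"
    unfolding tangle_coloring_iff[OF vl]
  proof (intro conjI ballI allI impI)
    fix i t assume i: "i < length T" and t: "t \<in> {-1<..<1::real}" "\<not> strand_classical T lev i t"
    show "steps c1 c2 x0 x1 x2 i t \<in> carrier X"
      using P i by (simp add: step_def)
    show "\<forall>\<^sub>F s in at t. steps c1 c2 x0 x1 x2 i s = steps c1 c2 x0 x1 x2 i t"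
      using cuts[OF i] cl[OF i, of t] t by (intro eventually_step_eq) auto
  qed (use P in blast)
qed

section \<open>The pictures of the Reidemeister moves\<close>

definition strand_velocity :: "(real \<Rightarrow> complex) list \<Rightarrow> nat \<Rightarrow> real \<Rightarrow> complex" where
  "strand_velocity T i t = vector_derivative (T ! i) (at t)"

lemma has_vector_derivative_Complex:
  assumes "(f has_real_derivative f') (at t)" "(g has_real_derivative g') (at t)"
  shows "((\<lambda>t. Complex (f t) (g t)) has_vector_derivative Complex f' g') (at t)"
proof -
  have "((\<lambda>t. f t *\<^sub>R 1 + g t *\<^sub>R \<i>) has_vector_derivative f' *\<^sub>R 1 + g' *\<^sub>R \<i>) (at t)"
    using assms by (intro has_vector_derivative_add has_vector_derivative_scaleR[where g' = 0, simplified]) auto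
  moreover have "Complex x y = x *\<^sub>R 1 + y *\<^sub>R \<i>" for x y
    by (simp add: complex_eq_iff)
  ultimately show ?thesis
    by simp
qed

lemma bump_deriv: "(bump has_real_derivative - (4 * t * (1 - t\<^sup>2))) (at t)"
  unfolding bump_def by (auto intro!: derivative_eq_intros simp: power2_eq_square)

lemma R1_straight_derivative: "((R1_straight ! 0) has_vector_derivative Complex 1 0) (at t)"
  by (auto simp: R1_straight_def intro!: has_vector_derivative_Complex derivative_eq_intros)

lemma R1_kink_derivative:
  "((R1_kink ! 0) has_vector_derivative Complex (1 - 2 * bump t + 8 * t\<^sup>2 * (1 - t\<^sup>2)) (- (2 * t * (1 - t\<^sup>2)))) (at t)"
  by (auto simp: R1_kink_def field_simps power2_eq_square
      intro!: has_vector_derivative_Complex derivative_eq_intros DERIV_chain2[OF bump_deriv])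

lemma R2_derivative:
  "((R2_apart ! 0) has_vector_derivative Complex 1 0) (at t)"
  "((R2_apart ! 1) has_vector_derivative Complex 1 0) (at t)"
  "((R2_overlap ! 0) has_vector_derivative Complex 1 0) (at t)"
  "((R2_overlap ! 1) has_vector_derivative Complex 1 (4 * t * (1 - t\<^sup>2))) (at t)"
  by (auto simp: R2_apart_def R2_overlap_def
      intro!: has_vector_derivative_Complex derivative_eq_intros DERIV_chain2[OF bump_deriv])

lemma R3_derivative:
  "((R3_above ! 0) has_vector_derivative Complex 1 (1 / 2)) (at t)"
  "((R3_above ! 1) has_vector_derivative Complex 1 (- (1 / 2))) (at t)"
  "((R3_above ! 2) has_vector_derivative Complex 1 (- (2 * t * (1 - t\<^sup>2)))) (at t)"
  "((R3_below ! 0) has_vector_derivative Complex 1 (1 / 2)) (at t)"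
  "((R3_below ! 1) has_vector_derivative Complex 1 (- (1 / 2))) (at t)"
  "((R3_below ! 2) has_vector_derivative Complex 1 (2 * t * (1 - t\<^sup>2))) (at t)"
  by (auto simp: R3_above_def R3_below_def
      intro!: has_vector_derivative_Complex derivative_eq_intros DERIV_chain2[OF bump_deriv])

section \<open>Crossing parameters of the standard pictures\<close>

lemma bump_minus [simp]: "bump (- t) = bump t"
  by (simp add: bump_def)

text \<open>The positive solution in the interval of \<open>bump t = 1 / 2\<close>. There the real
  part \<open>t - 2 * t * bump t\<close> of the kink vanishes, which closes the loop, and there the
  second strand of \<open>R2_overlap\<close> meets the real axis; one constant serves both
  moves.\<close>

definition kink_cut :: real where
  "kink_cut = sqrt (1 - sqrt (1 / 2))"

lemma kink_cut_bounds: "0 < kink_cut" "kink_cut < 1"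
proof -
  have "0 < sqrt (1 / 2 :: real)" "sqrt (1 / 2 :: real) < 1"
    by (simp, subst real_sqrt_lt_1_iff) simp
  then show "0 < kink_cut" "kink_cut < 1"
    unfolding kink_cut_def by (simp, subst real_sqrt_lt_1_iff) simp
qed

lemma abs_eq_kink_cut: "\<bar>s\<bar> = kink_cut \<longleftrightarrow> s = kink_cut \<or> s = - kink_cut"
  using kink_cut_bounds by auto

lemma bump_eq_half_iff:
  assumes "\<bar>t\<bar> \<le> 1"
  shows "bump t = 1 / 2 \<longleftrightarrow> \<bar>t\<bar> = kink_cut"
proof -
  have t: "t\<^sup>2 \<le> 1"
    using assms by (simp add: abs_square_le_1)
  have "sqrt (1 / 2 :: real) < 1"
    by (subst real_sqrt_lt_1_iff) simp
  then have k: "kink_cut\<^sup>2 = 1 - sqrt (1 / 2)"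
    by (simp add: kink_cut_def)
  have "bump t = 1 / 2 \<longleftrightarrow> 1 - t\<^sup>2 = sqrt (1 / 2)"
  proof
    assume "bump t = 1 / 2"
    then show "1 - t\<^sup>2 = sqrt (1 / 2)"
      using t by (metis bump_def diff_ge_0_iff_ge real_sqrt_abs abs_of_nonneg)
  next
    assume "1 - t\<^sup>2 = sqrt (1 / 2)"
    then show "bump t = 1 / 2"
      by (simp add: bump_def)
  qed
  also have "\<dots> \<longleftrightarrow> t\<^sup>2 = kink_cut\<^sup>2"
    unfolding k by auto
  also have "\<dots> \<longleftrightarrow> \<bar>t\<bar> = kink_cut"
    using kink_cut_bounds(1) by (metis abs_of_pos power2_eq_iff abs_eq_iff)
  finally show ?thesis .
qed

text \<open>The parameter at which the curved strand meets the line of slope 1/2. It is a root of a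
  quartic polynomial, so it is chosen rather than written out; \<open>bump\<close> being even, the
  line of slope -1/2 is met at the negative.\<close>

definition R3_cut :: real where
  "R3_cut = (SOME a. 0 < a \<and> a < 1 \<and> bump a = a)"

lemma R3_cut: "0 < R3_cut" "R3_cut < 1" "bump R3_cut = R3_cut"
proof -
  have "continuous_on {0..1} (\<lambda>t. t - bump t)"
    unfolding bump_def by (intro continuous_intros)
  then obtain a where a: "0 \<le> a" "a \<le> 1" "a - bump a = 0"
    using IVT'[of "\<lambda>t. t - bump t" 0 0 1] by (auto simp: bump_def)
  then have "a \<noteq> 0" "a \<noteq> 1"
    by (auto simp: bump_def)
  then have "0 < a \<and> a < 1 \<and> bump a = a"
    using a by auto
  then have "0 < R3_cut \<and> R3_cut < 1 \<and> bump R3_cut = R3_cut"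
    unfolding R3_cut_def by (rule someI)
  then show "0 < R3_cut" "R3_cut < 1" "bump R3_cut = R3_cut"
    by blast+
qed

text \<open>On the unit interval \<open>bump\<close> decreases strictly while the identity
  increases, and a fixed point cannot be negative because \<open>bump\<close> is a square. The
  second claim follows since \<open>bump\<close> is even.\<close>

lemma bump_eq_iff:
  assumes "\<bar>t\<bar> \<le> 1"
  shows "bump t = t \<longleftrightarrow> t = R3_cut" "bump t = - t \<longleftrightarrow> t = - R3_cut"
proof -
  have mono: "bump y < bump x" if "0 \<le> x" "x < y" "y \<le> 1" for x y
  proof -
    have "x\<^sup>2 < y\<^sup>2" "y\<^sup>2 \<le> 1"
      using that by (auto intro: power_strict_mono simp: power_le_one)
    then show ?thesis
      unfolding bump_def by (intro power_strict_mono) auto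
  qed
  have *: "x = R3_cut" if "bump x = x" "\<bar>x\<bar> \<le> 1" for x
  proof -
    have "0 \<le> bump x"
      by (simp add: bump_def)
    then have "0 \<le> x" "x \<le> 1"
      using that by auto
    then show ?thesis
      using mono[of x R3_cut] mono[of R3_cut x] R3_cut that(1) by linarith
  qed
  show "bump t = t \<longleftrightarrow> t = R3_cut"
    using *[of t] assms R3_cut by auto
  have "bump (- t) = - t \<longleftrightarrow> - t = R3_cut"
    using *[of "- t"] assms R3_cut(3) by (auto simp del: bump_minus)
  then show "bump t = - t \<longleftrightarrow> t = - R3_cut"
    by auto
qed

lemma length_R: "length R1_straight = 1" "length R1_kink = 1" "length R2_apart = 2" "length R2_overlap = 2"
  "length R3_above = 3" "length R3_below = 3"
  by (simp_all add: R1_straight_def R1_kink_def R2_apart_def R2_overlap_def R3_above_def R3_below_def)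

lemma less_2_iff: "i < (2::nat) \<longleftrightarrow> i = 0 \<or> i = 1"
  by auto

lemma less_3_iff: "i < (3::nat) \<longleftrightarrow> i = 0 \<or> i = 1 \<or> i = 2"
  by auto

lemma R1_straight_crosses: "\<not> strand_crosses R1_straight i s j t"
  by (auto simp: strand_crosses_def R1_straight_def)

lemma R2_apart_crosses: "\<not> strand_crosses R2_apart i s j t"
  by (auto simp: strand_crosses_def length_R less_2_iff) (auto simp: R2_apart_def)

lemma R1_kink_crosses:
  "strand_crosses R1_kink i s j t \<longleftrightarrow> i = 0 \<and> j = 0 \<and> \<bar>s\<bar> = kink_cut \<and> t = - s"
proof
  assume c: "strand_crosses R1_kink i s j t"
  then have ij: "i = 0" "j = 0" "s \<noteq> t" "\<bar>s\<bar> \<le> 1" "\<bar>t\<bar> \<le> 1"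
    by (auto simp: strand_crosses_def R1_kink_def)
  have "s - 2 * s * bump s = t - 2 * t * bump t" "bump s = bump t"
    using c ij by (auto simp: strand_crosses_def R1_kink_def)
  \<comment> \<open>Equal heights give \<open>bump s = bump t\<close>; the difference of the real
    parts then factors, and \<open>s \<noteq> t\<close> leaves only the value 1/2.\<close>
  then have "(s - t) * (1 - 2 * bump s) = 0"
    by (simp add: algebra_simps)
  then have "bump s = 1 / 2" "bump t = 1 / 2"
    using ij \<open>bump s = bump t\<close> by auto
  then have "\<bar>s\<bar> = kink_cut" "\<bar>t\<bar> = kink_cut"
    using bump_eq_half_iff ij by auto
  then show "i = 0 \<and> j = 0 \<and> \<bar>s\<bar> = kink_cut \<and> t = - s"
    using ij by auto
next
  assume c: "i = 0 \<and> j = 0 \<and> \<bar>s\<bar> = kink_cut \<and> t = - s"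
  then have s: "\<bar>s\<bar> \<le> 1" "s \<noteq> 0"
    using kink_cut_bounds by auto
  then have "bump s = 1 / 2"
    using bump_eq_half_iff[OF s(1)] c by blast
  then show "strand_crosses R1_kink i s j t"
    using c s by (auto simp: strand_crosses_def R1_kink_def)
qed

text \<open>Both strands are graphs over the real axis, so a crossing has equal parameters on
  them.\<close>

lemma R2_overlap_crosses:
  "strand_crosses R2_overlap i s j t \<longleftrightarrow> t = s \<and> \<bar>s\<bar> = kink_cut \<and> (i = 0 \<and> j = 1 \<or> i = 1 \<and> j = 0)"
proof -
  have *: "bump s = 1 / 2 \<and> s \<in> {-1..1} \<longleftrightarrow> \<bar>s\<bar> = kink_cut"
    using bump_eq_half_iff[of s] kink_cut_bounds by auto
  show ?thesis
    unfolding *[symmetric] by (auto simp: strand_crosses_def length_R less_2_iff) (auto simp: R2_overlap_def)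
qed

text \<open>From above to below, the crossings with the curved strand change the sign of their
  parameter. This reverses the order of the crossings along each of the three strands.\<close>

lemma R3_crosses:
  "strand_crosses R3_above i s j t \<longleftrightarrow> t = s \<and>
     ((i, j, s) \<in> {(0, 1, 0), (1, 0, 0), (0, 2, R3_cut), (2, 0, R3_cut), (1, 2, - R3_cut), (2, 1, - R3_cut)})"
  "strand_crosses R3_below i s j t \<longleftrightarrow> t = s \<and>
     ((i, j, s) \<in> {(0, 1, 0), (1, 0, 0), (0, 2, - R3_cut), (2, 0, - R3_cut), (1, 2, R3_cut), (2, 1, R3_cut)})"
proof -
  \<comment> \<open>Propositional regrouping that turns conditions on strands and parameters into
    membership in a list of triples.\<close>
  have taut: "(T \<and> I \<and> ((a0 \<and> b1 \<or> a1 \<and> b0) \<and> e1 \<or> (a0 \<and> b2 \<or> a2 \<and> b0) \<and> e2 \<or> (a1 \<and> b2 \<or> a2 \<and> b1) \<and> e3)) \<longleftrightarrow>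
    (T \<and> ((a0 \<and> b1 \<and> I \<and> e1) \<or> (a1 \<and> b0 \<and> I \<and> e1) \<or> (a0 \<and> b2 \<and> I \<and> e2) \<or> (a2 \<and> b0 \<and> I \<and> e2) \<or>
      (a1 \<and> b2 \<and> I \<and> e3) \<or> (a2 \<and> b1 \<and> I \<and> e3) \<or> False))" for T I a0 a1 a2 b0 b1 b2 e1 e2 e3
    by blast
  have above: "(R3_above ! 0) x = Complex x (x / 2)" "(R3_above ! 1) x = Complex x (- x / 2)"
    "(R3_above ! 2) x = Complex x (bump x / 2)"
    and below: "(R3_below ! 0) x = Complex x (x / 2)" "(R3_below ! 1) x = Complex x (- x / 2)"
    "(R3_below ! 2) x = Complex x (- bump x / 2)" for x
    by (simp_all add: R3_above_def R3_below_def)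
  have cut: "s \<in> {-1..1} \<and> s = - s \<longleftrightarrow> s = 0" "s \<in> {-1..1} \<and> bump s = s \<longleftrightarrow> s = R3_cut"
    "s \<in> {-1..1} \<and> bump s = - s \<longleftrightarrow> s = - R3_cut"
    using bump_eq_iff[of s] R3_cut(1,2) by auto
  have "strand_crosses R3_above i s j t \<longleftrightarrow> t = s \<and> s \<in> {-1..1} \<and>
      ((i = 0 \<and> j = 1 \<or> i = 1 \<and> j = 0) \<and> s = - s \<or>
       (i = 0 \<and> j = 2 \<or> i = 2 \<and> j = 0) \<and> bump s = s \<or>
       (i = 1 \<and> j = 2 \<or> i = 2 \<and> j = 1) \<and> bump s = - s)"
  proof (cases "i < 3 \<and> j < 3")
    case True
    then show ?thesis
      unfolding less_3_iff by (elim conjE disjE) (auto simp: strand_crosses_def length_R above above[unfolded One_nat_def])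
  qed (auto simp: strand_crosses_def length_R)
  also have "\<dots> \<longleftrightarrow> t = s \<and> ((i, j, s) \<in> {(0, 1, 0), (1, 0, 0), (0, 2, R3_cut), (2, 0, R3_cut), (1, 2, - R3_cut), (2, 1, - R3_cut)})"
    unfolding cut[symmetric] insert_iff empty_iff prod.inject by (rule taut)
  finally show "strand_crosses R3_above i s j t \<longleftrightarrow> t = s \<and>
     ((i, j, s) \<in> {(0, 1, 0), (1, 0, 0), (0, 2, R3_cut), (2, 0, R3_cut), (1, 2, - R3_cut), (2, 1, - R3_cut)})" .
  have "strand_crosses R3_below i s j t \<longleftrightarrow> t = s \<and> s \<in> {-1..1} \<and>
      ((i = 0 \<and> j = 1 \<or> i = 1 \<and> j = 0) \<and> s = - s \<or>
       (i = 0 \<and> j = 2 \<or> i = 2 \<and> j = 0) \<and> bump s = - s \<or>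
       (i = 1 \<and> j = 2 \<or> i = 2 \<and> j = 1) \<and> bump s = s)"
  proof (cases "i < 3 \<and> j < 3")
    case True
    then show ?thesis
      unfolding less_3_iff by (elim conjE disjE) (auto simp: strand_crosses_def length_R below below[unfolded One_nat_def])
  qed (auto simp: strand_crosses_def length_R)
  also have "\<dots> \<longleftrightarrow> t = s \<and> ((i, j, s) \<in> {(0, 1, 0), (1, 0, 0), (0, 2, - R3_cut), (2, 0, - R3_cut), (1, 2, R3_cut), (2, 1, R3_cut)})"
    unfolding cut[symmetric] insert_iff empty_iff prod.inject by (rule taut)
  finally show "strand_crosses R3_below i s j t \<longleftrightarrow> t = s \<and>
     ((i, j, s) \<in> {(0, 1, 0), (1, 0, 0), (0, 2, - R3_cut), (2, 0, - R3_cut), (1, 2, R3_cut), (2, 1, R3_cut)})" .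
qed

lemma confined_R: "confined kink_cut R1_straight" "confined kink_cut R1_kink" "confined kink_cut R2_apart"
  "confined kink_cut R2_overlap" "confined R3_cut R3_above" "confined R3_cut R3_below"
  using kink_cut_bounds R3_cut
  by (auto simp: confined_def R1_straight_crosses R1_kink_crosses R2_apart_crosses R2_overlap_crosses R3_crosses)

section \<open>Crossing conditions on pieces of strands\<close>

lemma to_right_if_det2_pos:
  assumes "det2 w v > 0"
  shows "to_right \<pi> w v \<longleftrightarrow> \<not> \<pi>" "to_right \<pi> v w \<longleftrightarrow> \<pi>"
  using assms det2_commute[of v w] by (auto simp: to_right_def)

lemma to_right_if_det2_neg:
  assumes "det2 w v < 0"
  shows "to_right \<pi> w v \<longleftrightarrow> \<pi>" "to_right \<pi> v w \<longleftrightarrow> \<not> \<pi>"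
  using assms det2_commute[of v w] by (auto simp: to_right_def)

context biquandle
begin

lemma crossing_face_steps:
  assumes "c1 i < c2 i" "c1 j < c2 j"
  shows "crossing_face X V lev pos (steps c1 c2 x0 x1 x2) i (c1 i) j (c1 j) \<longleftrightarrow>
      face (lev i (c1 i) = Over) (to_right (pos j) (V j (c1 j)) (V i (c1 i))) (x0 i) (x1 i)
        (to_right (pos i) (V i (c1 i)) (V j (c1 j))) (x0 j) (x1 j)"
    and "crossing_face X V lev pos (steps c1 c2 x0 x1 x2) i (c1 i) j (c2 j) \<longleftrightarrow>
      face (lev i (c1 i) = Over) (to_right (pos j) (V j (c2 j)) (V i (c1 i))) (x0 i) (x1 i)
        (to_right (pos i) (V i (c1 i)) (V j (c2 j))) (x1 j) (x2 j)"
    and "crossing_face X V lev pos (steps c1 c2 x0 x1 x2) i (c2 i) j (c1 j) \<longleftrightarrow>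
      face (lev i (c2 i) = Over) (to_right (pos j) (V j (c1 j)) (V i (c2 i))) (x1 i) (x2 i)
        (to_right (pos i) (V i (c2 i)) (V j (c1 j))) (x0 j) (x1 j)"
    and "crossing_face X V lev pos (steps c1 c2 x0 x1 x2) i (c2 i) j (c2 j) \<longleftrightarrow>
      face (lev i (c2 i) = Over) (to_right (pos j) (V j (c2 j)) (V i (c2 i))) (x1 i) (x2 i)
        (to_right (pos i) (V i (c2 i)) (V j (c2 j))) (x1 j) (x2 j)"
  unfolding crossing_face_def face_def strand_germs_step[OF assms(1)] strand_germs_step[OF assms(2)]
  by blast+

text \<open>Reversing both parametrizations reverses the pieces and the sides reached; the crossing
  itself is unchanged.\<close>

lemma face_flip: "face w b x x' b' y y' \<longleftrightarrow> face w (\<not> b) x' x (\<not> b') y' y"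
  unfolding face_def by auto

text \<open>In a kink the loop colored \<open>y\<close> lies on the same side at both passages,
  which makes the crossing diagonal. The ends entering and leaving the kink therefore have the same
  color.\<close>

lemma face_same_color:
  assumes "finite (carrier X)" "face w b x y (\<not> b) y z" "x \<in> carrier X" "y \<in> carrier X" "z \<in> carrier X"
  shows "z = x"
proof -
  obtain u v where uv: "face_rel X w u v" "\<And>c. u c \<in> carrier X \<and> v c \<in> carrier X"
      "u b = y" "u (\<not> b) = x" "v (\<not> b) = z" "v (\<not> \<not> b) = y"
    using faceD[OF assms(2,3,4,4,5)] by blast
  have "u = v"
    using crossing_rel_diagonal_unique[OF assms(1), of u v b] crossing_rel_diagonal_unique[OF assms(1), of v u b] uv
    by (simp add: face_rel_def split: if_splits)
  then show ?thesis
    using uv by simp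
qed

lemma face_same_color_exists:
  assumes "finite (carrier X)" "x \<in> carrier X"
  shows "\<exists>y\<in>carrier X. face w b x y (\<not> b) y x"
proof -
  obtain v where v: "crossing_rel X v v" "\<And>c. v c \<in> carrier X" "v (\<not> b) = x"
    using crossing_rel_diagonal_exists[OF assms, of "\<not> b"] by blast
  then have "face w b x (v b) (\<not> b) (v b) x"
    unfolding face_def face_rel_def by (intro exI[of _ v]) simp
  then show ?thesis
    using v(2) by blast
qed

lemma face_exists:
  assumes "x \<in> carrier X" "y \<in> carrier X"
  shows "\<exists>x'\<in>carrier X. \<exists>y'\<in>carrier X. face w b x x' b' y y'"
proof -
  obtain u v where "face_rel X w u v" "\<And>c. u c \<in> carrier X \<and> v c \<in> carrier X" "u (\<not> b) = x" "v (\<not> b') = y"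
    using face_rel_exists[OF assms] by blast
  then show ?thesis
    unfolding face_def by (intro bexI[of _ "u b"] bexI[of _ "v b'"] exI[of _ u] exI[of _ v]) auto
qed

section \<open>The first move\<close>

lemma R1_kink_velocity:
  "det2 (strand_velocity R1_kink 0 kink_cut) (strand_velocity R1_kink 0 (- kink_cut)) > 0"
proof -
  let ?k = "kink_cut"
  have k: "0 < ?k" "?k < 1" "bump ?k = 1 / 2"
    using kink_cut_bounds bump_eq_half_iff[of ?k] by auto
  have v: "strand_velocity R1_kink 0 t = Complex (1 - 2 * bump t + 8 * t\<^sup>2 * (1 - t\<^sup>2)) (- (2 * t * (1 - t\<^sup>2)))" for t
    unfolding strand_velocity_def by (rule vector_derivative_at[OF R1_kink_derivative])
  have "?k\<^sup>2 < 1"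
    using k by (simp add: power_less_one_iff)
  \<comment> \<open>At both cuts \<open>1 - 2 * bump t\<close> vanishes. The velocities have equal
    positive real parts and opposite imaginary parts, so the determinant is this product.\<close>
  then have "0 < (8 * ?k\<^sup>2 * (1 - ?k\<^sup>2)) * (4 * ?k * (1 - ?k\<^sup>2))"
    using k by (intro mult_pos_pos) auto
  then show ?thesis
    using k by (simp add: v det2_def algebra_simps)
qed

text \<open>The single strand plays both roles: it passes from \<open>x0\<close> to
  \<open>x1\<close> at the first cut and from \<open>x1\<close> to \<open>x2\<close> at the second,
  so the loop color \<open>x1\<close> occurs twice in the face. The two listings of the crossing
  give the same condition.\<close>

lemma stepwise_R1_kink:
  assumes vl: "valid_levels R1_kink lev" and nv: "lev 0 kink_cut \<noteq> Virtual"
  shows "stepwise X kink_cut pos R1_kink (strand_velocity R1_kink) lev (\<lambda>_. - kink_cut) (\<lambda>_. kink_cut)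
    (\<lambda>x0 x1 x2. {x0 0, x1 0, x2 0} \<subseteq> carrier X \<and>
      face (lev 0 (- kink_cut) = Over) (\<not> pos 0) (x0 0) (x1 0) (pos 0) (x1 0) (x2 0))"
proof -
  let ?V = "strand_velocity R1_kink"
  have k: "- kink_cut < kink_cut"
    using kink_cut_bounds by simp
  have c: "strand_crosses R1_kink 0 (- kink_cut) 0 kink_cut"
    using kink_cut_bounds by (simp add: R1_kink_crosses)
  have lev: "(lev 0 (- kink_cut), lev 0 kink_cut) \<in> {(Over, Under), (Under, Over)}"
    using vl nv c unfolding valid_levels_def by force
  have cl: "strand_classical R1_kink lev i t \<longleftrightarrow> t = - kink_cut \<or> t = kink_cut" if "i < length R1_kink" for i t
    using that lev kink_cut_bounds by (auto simp: strand_classical_def R1_kink_crosses length_R)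
  have st: "stepwise X kink_cut pos R1_kink ?V lev (\<lambda>_. - kink_cut) (\<lambda>_. kink_cut)
    (\<lambda>x0 x1 x2. (\<forall>i<length R1_kink. {x0 i, x1 i, x2 i} \<subseteq> carrier X) \<and>
       (\<forall>i s j t. strand_crosses R1_kink i s j t \<and> lev i s \<noteq> Virtual \<longrightarrow>
          crossing_face X ?V lev pos (steps (\<lambda>_. - kink_cut) (\<lambda>_. kink_cut) x0 x1 x2) i s j t))"
    by (rule stepwise_classical[OF vl]) (use kink_cut_bounds cl in auto)
  have d: "det2 (?V 0 kink_cut) (?V 0 (- kink_cut)) > 0" "det2 (?V 0 (- kink_cut)) (?V 0 kink_cut) < 0"
    using R1_kink_velocity det2_commute[of "?V 0 (- kink_cut)" "?V 0 kink_cut"] by linarith+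
  have "((\<forall>i<length R1_kink. {x0 i, x1 i, x2 i} \<subseteq> carrier X) \<and>
       (\<forall>i s j t. strand_crosses R1_kink i s j t \<and> lev i s \<noteq> Virtual \<longrightarrow>
          crossing_face X ?V lev pos (steps (\<lambda>_. - kink_cut) (\<lambda>_. kink_cut) x0 x1 x2) i s j t)) \<longleftrightarrow>
     {x0 0, x1 0, x2 0} \<subseteq> carrier X \<and>
      face (lev 0 (- kink_cut) = Over) (\<not> pos 0) (x0 0) (x1 0) (pos 0) (x1 0) (x2 0)" (is "_ \<and> ?A \<longleftrightarrow> _ \<and> ?B")
    for x0 x1 x2
  proof -
    let ?F = "crossing_face X ?V lev pos (steps (\<lambda>_. - kink_cut) (\<lambda>_. kink_cut) x0 x1 x2)"
    have "?F 0 (- kink_cut) 0 kink_cut \<longleftrightarrow> ?B"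
      using crossing_face_steps(2)[of "\<lambda>_. - kink_cut" 0 "\<lambda>_. kink_cut" 0 ?V lev pos x0 x1 x2] k
      by (simp add: to_right_if_det2_pos(1)[OF d(1)] to_right_if_det2_neg(1)[OF d(2)])
    moreover have "?F 0 kink_cut 0 (- kink_cut) \<longleftrightarrow> ?F 0 (- kink_cut) 0 kink_cut"
      by (rule crossing_face_commute[symmetric]) (rule lev)
    moreover have "?A \<longleftrightarrow> ?F 0 (- kink_cut) 0 kink_cut \<and> ?F 0 kink_cut 0 (- kink_cut)"
      using lev kink_cut_bounds by (auto simp: R1_kink_crosses abs_eq_kink_cut)
    ultimately show ?thesis
      by (simp add: length_R)
  qed
  then show ?thesis
    using st by simp
qed

text \<open>A virtual kink imposes no condition. For a classical one the ends have equal colors by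
  \<open>face_same_color\<close>, and every end color extends over the loop by
  \<open>face_same_color_exists\<close>.\<close>

lemma R1_extends:
  assumes fin: "finite (carrier X)" and vl: "valid_levels R1_kink lev'"
  shows "tangle_extends X kink_cut pos R1_straight (strand_velocity R1_straight) lev R1_kink (strand_velocity R1_kink) lev'"
    and "tangle_extends X kink_cut pos R1_kink (strand_velocity R1_kink) lev' R1_straight (strand_velocity R1_straight) lev"
proof -
  have "tangle_extends X kink_cut pos R1_straight (strand_velocity R1_straight) lev R1_kink (strand_velocity R1_kink) lev' \<and>
    tangle_extends X kink_cut pos R1_kink (strand_velocity R1_kink) lev' R1_straight (strand_velocity R1_straight) lev"
  proof (cases "lev' 0 kink_cut = Virtual")
    case True
    have "strand_crosses R1_kink 0 kink_cut 0 (- kink_cut)"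
      using kink_cut_bounds by (simp add: R1_kink_crosses)
    then have "lev' 0 (- kink_cut) = Virtual"
      using vl True unfolding valid_levels_def by force
    then have v: "lev' i s = Virtual" if "strand_crosses R1_kink i s j t" for i s j t
      using that True by (auto simp: R1_kink_crosses abs_eq_kink_cut)
    then have nc: "\<not> strand_classical R1_kink lev' i t" "\<not> strand_classical R1_straight lev i t" for i t
      by (auto simp: strand_classical_def R1_straight_crosses)
    show ?thesis
      using v nc by (intro conjI tangle_extends_same confined_R) (auto simp: R1_straight_crosses length_R)
  next
    case False
    note st = stepwise_R1_kink[OF vl False, of pos] stepwise_no_crossing[OF R1_straight_crosses kink_cut_bounds(1), of X pos "strand_velocity R1_straight" lev]
    show ?thesis
    proof
      show "tangle_extends X kink_cut pos R1_straight (strand_velocity R1_straight) lev R1_kink (strand_velocity R1_kink) lev'"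
      proof (rule tangle_extends_stepwise[OF confined_R(1) _ st(2,1)])
        fix x0 x1 x2 :: "nat \<Rightarrow> 'a"
        assume x: "\<forall>i<length R1_straight. x0 i \<in> carrier X \<and> x1 i = x0 i \<and> x2 i = x0 i"
        then obtain y where y: "y \<in> carrier X" "face (lev' 0 (- kink_cut) = Over) (\<not> pos 0) (x0 0) y (\<not> \<not> pos 0) y (x0 0)"
          using face_same_color_exists[OF fin, of "x0 0" _ "\<not> pos 0"] by (auto simp: length_R)
        show "\<exists>y0 y1 y2. ({y0 0, y1 0, y2 0} \<subseteq> carrier X \<and>
            face (lev' 0 (- kink_cut) = Over) (\<not> pos 0) (y0 0) (y1 0) (pos 0) (y1 0) (y2 0)) \<and>
            (\<forall>i<length R1_straight. y0 i = x0 i \<and> y2 i = x2 i)"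
          by (rule exI[of _ x0], rule exI[of _ "\<lambda>_. y"], rule exI[of _ x0]) (use x y in \<open>simp add: length_R\<close>)
      qed (auto simp: length_R)
      show "tangle_extends X kink_cut pos R1_kink (strand_velocity R1_kink) lev' R1_straight (strand_velocity R1_straight) lev"
      proof (rule tangle_extends_stepwise[OF confined_R(2) _ st(1,2)])
        fix x0 x1 x2 y0 y1 y2 :: "nat \<Rightarrow> 'a"
        assume x: "{x0 0, x1 0, x2 0} \<subseteq> carrier X \<and>
            face (lev' 0 (- kink_cut) = Over) (\<not> pos 0) (x0 0) (x1 0) (pos 0) (x1 0) (x2 0)"
          and y: "{y0 0, y1 0, y2 0} \<subseteq> carrier X \<and>
            face (lev' 0 (- kink_cut) = Over) (\<not> pos 0) (y0 0) (y1 0) (pos 0) (y1 0) (y2 0)"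
          and xy: "\<And>i. i < length R1_kink \<Longrightarrow> y0 i = x0 i \<and> y2 i = x2 i"
        show "\<forall>i<length R1_kink. y1 i = x1 i"
          using face_unique[of "lev' 0 (- kink_cut) = Over" "\<not> pos 0" "x0 0" "x1 0" "pos 0" "x1 0" "x2 0" "\<not> pos 0" "y0 0" "y1 0" "pos 0" "y1 0" "y2 0"]
            x y xy[of 0] by (auto simp: length_R)
      next
        fix x0 x1 x2 :: "nat \<Rightarrow> 'a"
        assume x: "{x0 0, x1 0, x2 0} \<subseteq> carrier X \<and>
            face (lev' 0 (- kink_cut) = Over) (\<not> pos 0) (x0 0) (x1 0) (pos 0) (x1 0) (x2 0)"
        then have "x2 0 = x0 0"
          using face_same_color[OF fin, of "lev' 0 (- kink_cut) = Over" "\<not> pos 0" "x0 0" "x1 0" "x2 0"] by simp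
        then show "\<exists>y0 y1 y2. (\<forall>i<length R1_straight. y0 i \<in> carrier X \<and> y1 i = y0 i \<and> y2 i = y0 i) \<and>
            (\<forall>i<length R1_kink. y0 i = x0 i \<and> y2 i = x2 i)"
          by (intro exI[of _ x0]) (use x in \<open>simp add: length_R\<close>)
      qed (simp add: length_R)
    qed
  qed
  then show "tangle_extends X kink_cut pos R1_straight (strand_velocity R1_straight) lev R1_kink (strand_velocity R1_kink) lev'"
    "tangle_extends X kink_cut pos R1_kink (strand_velocity R1_kink) lev' R1_straight (strand_velocity R1_straight) lev"
    by blast+
qed

section \<open>The second move\<close>

lemma R2_velocity:
  "det2 (strand_velocity R2_overlap 1 t) (strand_velocity R2_overlap 0 t) = - (4 * t * (1 - t\<^sup>2))"
  "det2 (strand_velocity R2_overlap 0 t) (strand_velocity R2_overlap 1 t) = 4 * t * (1 - t\<^sup>2)"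
  using vector_derivative_at[OF R2_derivative(3)] vector_derivative_at[OF R2_derivative(4)]
  by (simp_all add: strand_velocity_def det2_def)

text \<open>The levels are the same at both crossings but the determinant changes sign, so the
  second face has all sides negated relative to the first.\<close>

lemma stepwise_R2_overlap:
  assumes vl: "valid_levels R2_overlap lev"
    and lev: "lev 0 (- kink_cut) = lev 0 kink_cut" "lev 1 (- kink_cut) = lev 1 kink_cut" and nv: "lev 0 kink_cut \<noteq> Virtual"
  shows "stepwise X kink_cut pos R2_overlap (strand_velocity R2_overlap) lev (\<lambda>_. - kink_cut) (\<lambda>_. kink_cut)
    (\<lambda>x0 x1 x2. {x0 0, x1 0, x2 0, x0 1, x1 1, x2 1} \<subseteq> carrier X \<and>
      face (lev 0 kink_cut = Over) (\<not> pos 1) (x0 0) (x1 0) (pos 0) (x0 1) (x1 1) \<and>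
      face (lev 0 kink_cut = Over) (pos 1) (x1 0) (x2 0) (\<not> pos 0) (x1 1) (x2 1))"
proof -
  let ?V = "strand_velocity R2_overlap" and ?k = "kink_cut"
  have k: "- ?k < ?k" "0 < ?k" "?k\<^sup>2 < 1"
    using kink_cut_bounds by (simp_all add: power_less_one_iff)
  have "strand_crosses R2_overlap 0 ?k 1 ?k"
    using kink_cut_bounds by (simp add: R2_overlap_crosses)
  then have lv: "(lev 0 ?k, lev 1 ?k) \<in> {(Over, Under), (Under, Over)}"
    using vl nv unfolding valid_levels_def by force
  have cl: "strand_classical R2_overlap lev i t \<longleftrightarrow> t = - ?k \<or> t = ?k" if "i < length R2_overlap" for i t
    using that lv lev kink_cut_bounds
    by (auto simp: strand_classical_def R2_overlap_crosses length_R less_2_iff abs_eq_kink_cut)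
  have st: "stepwise X ?k pos R2_overlap ?V lev (\<lambda>_. - ?k) (\<lambda>_. ?k)
    (\<lambda>x0 x1 x2. (\<forall>i<length R2_overlap. {x0 i, x1 i, x2 i} \<subseteq> carrier X) \<and>
       (\<forall>i s j t. strand_crosses R2_overlap i s j t \<and> lev i s \<noteq> Virtual \<longrightarrow>
          crossing_face X ?V lev pos (steps (\<lambda>_. - ?k) (\<lambda>_. ?k) x0 x1 x2) i s j t))"
    by (rule stepwise_classical[OF vl]) (use kink_cut_bounds cl in auto)
  have "0 < 4 * ?k * (1 - ?k\<^sup>2)"
    using k by simp
  then have d: "det2 (?V 1 ?k) (?V 0 ?k) < 0" "det2 (?V 0 ?k) (?V 1 ?k) > 0"
    "det2 (?V 1 (- ?k)) (?V 0 (- ?k)) > 0" "det2 (?V 0 (- ?k)) (?V 1 (- ?k)) < 0"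
    unfolding R2_velocity by simp_all
  have "((\<forall>i<length R2_overlap. {x0 i, x1 i, x2 i} \<subseteq> carrier X) \<and>
       (\<forall>i s j t. strand_crosses R2_overlap i s j t \<and> lev i s \<noteq> Virtual \<longrightarrow>
          crossing_face X ?V lev pos (steps (\<lambda>_. - ?k) (\<lambda>_. ?k) x0 x1 x2) i s j t)) \<longleftrightarrow>
     {x0 0, x1 0, x2 0, x0 1, x1 1, x2 1} \<subseteq> carrier X \<and>
      face (lev 0 ?k = Over) (\<not> pos 1) (x0 0) (x1 0) (pos 0) (x0 1) (x1 1) \<and>
      face (lev 0 ?k = Over) (pos 1) (x1 0) (x2 0) (\<not> pos 0) (x1 1) (x2 1)" (is "?C \<and> ?A \<longleftrightarrow> ?C' \<and> ?B1 \<and> ?B2")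
    for x0 x1 x2
  proof -
    let ?F = "crossing_face X ?V lev pos (steps (\<lambda>_. - ?k) (\<lambda>_. ?k) x0 x1 x2)"
    have "?F 0 (- ?k) 1 (- ?k) \<longleftrightarrow> ?B1"
      using crossing_face_steps(1)[of "\<lambda>_. - ?k" 0 "\<lambda>_. ?k" 1 ?V lev pos x0 x1 x2] k(1) lev(1)
        to_right_if_det2_pos(1)[OF d(3), of "pos 1"] to_right_if_det2_neg(1)[OF d(4), of "pos 0"] by simp
    moreover have "?F 0 ?k 1 ?k \<longleftrightarrow> ?B2"
      using crossing_face_steps(4)[of "\<lambda>_. - ?k" 0 "\<lambda>_. ?k" 1 ?V lev pos x0 x1 x2] k(1)
        to_right_if_det2_pos(1)[OF d(2), of "pos 0"] to_right_if_det2_neg(1)[OF d(1), of "pos 1"] by simp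
    moreover have "?F 1 t 0 t \<longleftrightarrow> ?F 0 t 1 t" if "t = - ?k \<or> t = ?k" for t
      by (rule crossing_face_commute[symmetric]) (use that lev lv in auto)
    moreover have "?A \<longleftrightarrow> ?F 0 (- ?k) 1 (- ?k) \<and> ?F 0 ?k 1 ?k \<and> ?F 1 (- ?k) 0 (- ?k) \<and> ?F 1 ?k 0 ?k"
      using lv lev kink_cut_bounds by (auto simp: R2_overlap_crosses abs_eq_kink_cut)
    moreover have "?C \<longleftrightarrow> ?C'"
      by (auto simp: length_R less_2_iff)
    ultimately show ?thesis
      by blast
  qed
  then show ?thesis
    using st by simp
qed

lemma R2_extends:
  assumes vl: "valid_levels R2_overlap lev'"
    and lev: "lev' 0 (- kink_cut) = lev' 0 kink_cut" "lev' 1 (- kink_cut) = lev' 1 kink_cut"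
  shows "tangle_extends X kink_cut pos R2_apart (strand_velocity R2_apart) lev R2_overlap (strand_velocity R2_overlap) lev'"
    and "tangle_extends X kink_cut pos R2_overlap (strand_velocity R2_overlap) lev' R2_apart (strand_velocity R2_apart) lev"
proof -
  have "tangle_extends X kink_cut pos R2_apart (strand_velocity R2_apart) lev R2_overlap (strand_velocity R2_overlap) lev' \<and>
    tangle_extends X kink_cut pos R2_overlap (strand_velocity R2_overlap) lev' R2_apart (strand_velocity R2_apart) lev"
  proof (cases "lev' 0 kink_cut = Virtual")
    case True
    have "strand_crosses R2_overlap 0 kink_cut 1 kink_cut"
      using kink_cut_bounds by (simp add: R2_overlap_crosses)
    then have "lev' 1 kink_cut = Virtual"
      using vl True unfolding valid_levels_def by force
    then have v: "lev' i s = Virtual" if "strand_crosses R2_overlap i s j t" for i s j t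
      using that True lev by (auto simp: R2_overlap_crosses abs_eq_kink_cut)
    then have nc: "\<not> strand_classical R2_overlap lev' i t" "\<not> strand_classical R2_apart lev i t" for i t
      by (auto simp: strand_classical_def R2_apart_crosses)
    show ?thesis
      using v nc by (intro conjI tangle_extends_same confined_R) (auto simp: R2_apart_crosses length_R)
  next
    case False
    note st = stepwise_R2_overlap[OF vl lev False, of pos] stepwise_no_crossing[OF R2_apart_crosses kink_cut_bounds(1), of X pos "strand_velocity R2_apart" lev]
    let ?w = "lev' 0 kink_cut = Over"
    let ?P = "\<lambda>(x0 :: nat \<Rightarrow> 'a) (x1 :: nat \<Rightarrow> 'a) (x2 :: nat \<Rightarrow> 'a). {x0 0, x1 0, x2 0, x0 1, x1 1, x2 1} \<subseteq> carrier X \<and>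
      face ?w (\<not> pos 1) (x0 0) (x1 0) (pos 0) (x0 1) (x1 1) \<and>
      face ?w (pos 1) (x1 0) (x2 0) (\<not> pos 0) (x1 1) (x2 1)"
    show ?thesis
    proof
      show "tangle_extends X kink_cut pos R2_apart (strand_velocity R2_apart) lev R2_overlap (strand_velocity R2_overlap) lev'"
      proof (rule tangle_extends_stepwise[OF confined_R(3) _ st(2,1)])
        fix x0 x1 x2 :: "nat \<Rightarrow> 'a"
        assume "\<forall>i<length R2_apart. x0 i \<in> carrier X \<and> x1 i = x0 i \<and> x2 i = x0 i"
        then have x: "x0 0 \<in> carrier X" "x0 1 \<in> carrier X" "x2 0 = x0 0" "x2 1 = x0 1"
          by (simp_all add: length_R)
        obtain y z where yz: "y \<in> carrier X" "z \<in> carrier X" "face ?w (\<not> pos 1) (x0 0) y (pos 0) (x0 1) z"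
          using face_exists[OF x(1,2)] by blast
        \<comment> \<open>The second crossing is the first one read backwards; it restores the
          original colors.\<close>
        then have f: "face ?w (pos 1) y (x0 0) (\<not> pos 0) z (x0 1)"
          using face_flip[of ?w "\<not> pos 1"] by simp
        show "\<exists>y0 y1 y2. ?P y0 y1 y2 \<and> (\<forall>i<length R2_apart. y0 i = x0 i \<and> y2 i = x2 i)"
          by (rule exI[of _ x0], rule exI[of _ "\<lambda>i::nat. if i = 0 then y else z"], rule exI[of _ x0])
            (use x yz f in \<open>auto simp: length_R less_2_iff\<close>)
      qed (auto simp: length_R)
      show "tangle_extends X kink_cut pos R2_overlap (strand_velocity R2_overlap) lev' R2_apart (strand_velocity R2_apart) lev"
      proof (rule tangle_extends_stepwise[OF confined_R(4) _ st(1,2)])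
        fix x0 x1 x2 y0 y1 y2 :: "nat \<Rightarrow> 'a"
        assume x: "?P x0 x1 x2" and y: "?P y0 y1 y2" and xy: "\<And>i. i < length R2_overlap \<Longrightarrow> y0 i = x0 i \<and> y2 i = x2 i"
        show "\<forall>i<length R2_overlap. y1 i = x1 i"
          using face_unique[of ?w "\<not> pos 1" "x0 0" "x1 0" "pos 0" "x0 1" "x1 1" "\<not> pos 1" "y0 0" "y1 0" "pos 0" "y0 1" "y1 1"]
            x y xy[of 0] xy[of 1] by (auto simp: length_R less_2_iff)
      next
        fix x0 x1 x2 :: "nat \<Rightarrow> 'a"
        assume x: "?P x0 x1 x2"
        \<comment> \<open>Both faces carry the middle colors on the same sides, so they are the same
          face, and the colors beyond the second crossing are those before the first.\<close>
        then have "x2 0 = x0 0 \<and> x2 1 = x0 1"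
          using face_unique[of ?w "\<not> pos 1" "x0 0" "x1 0" "pos 0" "x0 1" "x1 1" "pos 1" "x1 0" "x2 0" "\<not> pos 0" "x1 1" "x2 1"]
          by auto
        then show "\<exists>y0 y1 y2. (\<forall>i<length R2_apart. y0 i \<in> carrier X \<and> y1 i = y0 i \<and> y2 i = y0 i) \<and>
            (\<forall>i<length R2_overlap. y0 i = x0 i \<and> y2 i = x2 i)"
          by (intro exI[of _ x0]) (use x in \<open>auto simp: length_R less_2_iff\<close>)
      qed (simp add: length_R)
    qed
  qed
  then show "tangle_extends X kink_cut pos R2_apart (strand_velocity R2_apart) lev R2_overlap (strand_velocity R2_overlap) lev'"
    "tangle_extends X kink_cut pos R2_overlap (strand_velocity R2_overlap) lev' R2_apart (strand_velocity R2_apart) lev"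
    by blast+
qed

end

section \<open>The third move\<close>

lemma R3_velocity:
  "strand_velocity R3_above 0 t = Complex 1 (1 / 2)" "strand_velocity R3_above 1 t = Complex 1 (- (1 / 2))"
  "strand_velocity R3_above 2 t = Complex 1 (- (2 * t * (1 - t\<^sup>2)))"
  "strand_velocity R3_below 0 t = Complex 1 (1 / 2)" "strand_velocity R3_below 1 t = Complex 1 (- (1 / 2))"
  "strand_velocity R3_below 2 t = Complex 1 (2 * t * (1 - t\<^sup>2))"
  by (simp_all only: strand_velocity_def R3_derivative[THEN vector_derivative_at])

lemma R3_det2:
  "det2 (strand_velocity R3_above 1 0) (strand_velocity R3_above 0 0) > 0"
  "det2 (strand_velocity R3_above 2 R3_cut) (strand_velocity R3_above 0 R3_cut) > 0"
  "det2 (strand_velocity R3_above 2 (- R3_cut)) (strand_velocity R3_above 1 (- R3_cut)) < 0"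
  "det2 (strand_velocity R3_below 1 0) (strand_velocity R3_below 0 0) > 0"
  "det2 (strand_velocity R3_below 2 (- R3_cut)) (strand_velocity R3_below 0 (- R3_cut)) > 0"
  "det2 (strand_velocity R3_below 2 R3_cut) (strand_velocity R3_below 1 R3_cut) < 0"
proof -
  have "R3_cut\<^sup>2 < 1"
    using R3_cut by (simp add: power_less_one_iff)
  then have "0 < 2 * R3_cut * (1 - R3_cut\<^sup>2)"
    using R3_cut(1) by simp
  then show "det2 (strand_velocity R3_above 1 0) (strand_velocity R3_above 0 0) > 0"
    "det2 (strand_velocity R3_above 2 R3_cut) (strand_velocity R3_above 0 R3_cut) > 0"
    "det2 (strand_velocity R3_above 2 (- R3_cut)) (strand_velocity R3_above 1 (- R3_cut)) < 0"
    "det2 (strand_velocity R3_below 1 0) (strand_velocity R3_below 0 0) > 0"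
    "det2 (strand_velocity R3_below 2 (- R3_cut)) (strand_velocity R3_below 0 (- R3_cut)) > 0"
    "det2 (strand_velocity R3_below 2 R3_cut) (strand_velocity R3_below 1 R3_cut) < 0"
    unfolding R3_velocity det2_def by auto
qed

lemma layered_cases:
  assumes "layered M" "i < 3" "j < 3" "i \<noteq> j"
  shows "(M i j, M j i) \<in> {(Over, Under), (Under, Over)}"
proof -
  obtain height :: "nat \<Rightarrow> nat" where h: "inj_on height {..<3}"
    "\<And>i j. i < 3 \<Longrightarrow> j < 3 \<Longrightarrow> i \<noteq> j \<Longrightarrow> M i j = (if height j < height i then Over else Under)"
    using assms(1) unfolding layered_def by blast
  have "height i \<noteq> height j"
    using inj_onD[OF h(1), of i j] assms by auto
  then show ?thesis
    using h(2)[of i j] h(2)[of j i] assms by auto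
qed

context biquandle
begin

text \<open>Comparison of heights is transitive, which rules out both cyclic arrangements.\<close>

lemma layered_acyclic:
  assumes "layered M"
  shows "acyclic_flags (M 0 1 = Over) (M 0 2 = Over) (M 1 2 = Over)"
proof -
  obtain height :: "nat \<Rightarrow> nat" where
    h: "\<forall>i<3. \<forall>j<3. i \<noteq> j \<longrightarrow> M i j = (if height j < height i then Over else Under)"
    using assms unfolding layered_def by blast
  have "M 0 1 = (if height 1 < height 0 then Over else Under)" "M 0 2 = (if height 2 < height 0 then Over else Under)"
    "M 1 2 = (if height 2 < height 1 then Over else Under)"
    using h by simp_all
  then show ?thesis
    by (auto simp: acyclic_flags_def)
qed

text \<open>Treats both pictures at once: \<open>a\<close> is \<open>R3_cut\<close> for the strand
  above and \<open>- R3_cut\<close> for the strand below. The cuts are given as unordered pairs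
  because their order depends on the sign of \<open>a\<close>.\<close>

lemma stepwise_R3:
  assumes lay: "layered M" and vl: "valid_levels T lev"
    and T: "length T = 3"
    and crosses: "\<And>i s j t. strand_crosses T i s j t \<longleftrightarrow> t = s \<and>
     ((i, j, s) \<in> {(0, 1, 0), (1, 0, 0), (0, 2, a), (2, 0, a), (1, 2, - a), (2, 1, - a)})"
    and lev: "\<forall>i s j t. strand_crosses T i s j t \<longrightarrow> lev i s = M i j"
    and a: "a \<noteq> 0" "\<bar>a\<bar> < 1"
    and cuts: "\<And>i. i < 3 \<Longrightarrow> c1 i < c2 i" "{c1 0, c2 0} = {0, a}" "{c1 1, c2 1} = {0, - a}" "{c1 2, c2 2} = {a, - a}"
    and P: "\<And>x0 x1 x2. P x0 x1 x2 \<longleftrightarrow> (\<forall>i<3. {x0 i, x1 i, x2 i} \<subseteq> carrier X) \<and>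
      crossing_face X V lev pos (steps c1 c2 x0 x1 x2) 0 0 1 0 \<and>
      crossing_face X V lev pos (steps c1 c2 x0 x1 x2) 0 a 2 a \<and>
      crossing_face X V lev pos (steps c1 c2 x0 x1 x2) 1 (- a) 2 (- a)"
  shows "stepwise X \<bar>a\<bar> pos T V lev c1 c2 P"
proof -
  have nv: "lev i s \<noteq> Virtual" if "strand_crosses T i s j t" for i s j t
    using lev[rule_format, OF that] layered_cases[OF lay, of i j] that by (auto simp: crosses)
  have cl: "strand_classical T lev i t \<longleftrightarrow> t = c1 i \<or> t = c2 i" if i: "i < length T" for i t
  proof -
    have "strand_classical T lev i t \<longleftrightarrow> (\<exists>j s. strand_crosses T i t j s)"
      using nv by (auto simp: strand_classical_def)
    also have "\<dots> \<longleftrightarrow> t \<in> (if i = 0 then {0, a} else if i = 1 then {0, - a} else {a, - a})"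
      using i unfolding T less_3_iff crosses by auto
    also have "\<dots> \<longleftrightarrow> t \<in> {c1 i, c2 i}"
      using i cuts(2-4) unfolding T less_3_iff by auto
    finally show ?thesis by simp
  qed
  have bounds: "c1 i < c2 i \<and> \<bar>c1 i\<bar> \<le> \<bar>a\<bar> \<and> \<bar>c2 i\<bar> \<le> \<bar>a\<bar>" if i: "i < length T" for i
  proof -
    have "{c1 i, c2 i} \<subseteq> {0, a, - a}"
      using i cuts(2-4) unfolding T less_3_iff by auto
    then show ?thesis
      using cuts(1) i T by auto
  qed
  have st: "stepwise X \<bar>a\<bar> pos T V lev c1 c2
    (\<lambda>x0 x1 x2. (\<forall>i<length T. {x0 i, x1 i, x2 i} \<subseteq> carrier X) \<and>
       (\<forall>i s j t. strand_crosses T i s j t \<and> lev i s \<noteq> Virtual \<longrightarrow>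
          crossing_face X V lev pos (steps c1 c2 x0 x1 x2) i s j t))"
    by (rule stepwise_classical[OF vl bounds a(2) cl])
  have red: "(\<forall>i s j t. strand_crosses T i s j t \<and> lev i s \<noteq> Virtual \<longrightarrow> F i s j t) \<longleftrightarrow> F 0 0 1 0 \<and> F 0 a 2 a \<and> F 1 (- a) 2 (- a)"
    if F: "\<And>i s j t. (lev i s, lev j t) \<in> {(Over, Under), (Under, Over)} \<Longrightarrow> F i s j t \<longleftrightarrow> F j t i s" for F
  proof -
    have "(\<forall>i s j t. strand_crosses T i s j t \<and> lev i s \<noteq> Virtual \<longrightarrow> F i s j t) \<longleftrightarrow> (\<forall>i s j t. strand_crosses T i s j t \<longrightarrow> F i s j t)"
      using nv by blast
    also have "\<dots> \<longleftrightarrow> F 0 0 1 0 \<and> F 1 0 0 0 \<and> F 0 a 2 a \<and> F 2 a 0 a \<and> F 1 (- a) 2 (- a) \<and> F 2 (- a) 1 (- a)"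
      unfolding crosses by auto
    also have "\<dots> \<longleftrightarrow> F 0 0 1 0 \<and> F 0 a 2 a \<and> F 1 (- a) 2 (- a)"
    proof -
      have "F i s j s \<longleftrightarrow> F j s i s" if "strand_crosses T i s j s" "i < 3" "j < 3" "i \<noteq> j" for i s j
      proof (rule F)
        have "strand_crosses T j s i s"
          using that(1) strand_crosses_commute by blast
        then show "(lev i s, lev j s) \<in> {(Over, Under), (Under, Over)}"
          using lev[rule_format, of i s j s] lev[rule_format, of j s i s] that(1) layered_cases[OF lay that(2-4)] by simp
      qed
      from this[of 0 0 1] this[of 0 a 2] this[of 1 "- a" 2] show ?thesis
        by (auto simp: crosses)
    qed
    finally show ?thesis .
  qed
  have "P x0 x1 x2 \<longleftrightarrow> (\<forall>i<length T. {x0 i, x1 i, x2 i} \<subseteq> carrier X) \<and>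
       (\<forall>i s j t. strand_crosses T i s j t \<and> lev i s \<noteq> Virtual \<longrightarrow>
          crossing_face X V lev pos (steps c1 c2 x0 x1 x2) i s j t)" (is "_ = ?Q x0 x1 x2") for x0 x1 x2
  proof -
    have "(\<forall>i s j t. strand_crosses T i s j t \<and> lev i s \<noteq> Virtual \<longrightarrow>
          crossing_face X V lev pos (steps c1 c2 x0 x1 x2) i s j t) \<longleftrightarrow>
        crossing_face X V lev pos (steps c1 c2 x0 x1 x2) 0 0 1 0 \<and>
        crossing_face X V lev pos (steps c1 c2 x0 x1 x2) 0 a 2 a \<and>
        crossing_face X V lev pos (steps c1 c2 x0 x1 x2) 1 (- a) 2 (- a)"
      by (rule red) (rule crossing_face_commute)
    then show ?thesis
      unfolding P T by blast
  qed
  then have "P = ?Q"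
    by (intro ext)
  then show ?thesis
    using st by metis
qed

text \<open>Strand 0 meets 1 before 2, strand 1 meets 2 before 0, and strand 2 meets 1 before 0;
  this is the order of the pieces in \<open>triangle\<close>.\<close>

lemma stepwise_R3_above:
  assumes lay: "layered M" and vl: "valid_levels R3_above lev"
    and lev: "\<forall>i s j t. strand_crosses R3_above i s j t \<longrightarrow> lev i s = M i j"
  shows "stepwise X R3_cut pos R3_above (strand_velocity R3_above) lev
    (\<lambda>i. if i = 0 then 0 else - R3_cut) (\<lambda>i. if i = 1 then 0 else R3_cut)
    (\<lambda>x0 x1 x2. triangle (M 0 1 = Over) (M 0 2 = Over) (M 1 2 = Over) (pos 0) (pos 1) (pos 2)
       (x0 0) (x1 0) (x2 0) (x0 1) (x1 1) (x2 1) (x0 2) (x1 2) (x2 2))"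
proof -
  let ?c1 = "\<lambda>i::nat. if i = 0 then 0 else - R3_cut" and ?c2 = "\<lambda>i::nat. if i = 1 then 0 else R3_cut"
  let ?V = "strand_velocity R3_above"
  have a: "0 < R3_cut" "R3_cut < 1"
    using R3_cut by auto
  have lv: "lev 0 0 = M 0 1" "lev 0 R3_cut = M 0 2" "lev 1 (- R3_cut) = M 1 2"
    using lev[rule_format, of 0 0 1 0] lev[rule_format, of 0 R3_cut 2 R3_cut] lev[rule_format, of 1 "- R3_cut" 2 "- R3_cut"] by (simp_all add: R3_crosses)
  have st: "stepwise X \<bar>R3_cut\<bar> pos R3_above ?V lev ?c1 ?c2
    (\<lambda>x0 x1 x2. triangle (M 0 1 = Over) (M 0 2 = Over) (M 1 2 = Over) (pos 0) (pos 1) (pos 2)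
       (x0 0) (x1 0) (x2 0) (x0 1) (x1 1) (x2 1) (x0 2) (x1 2) (x2 2))"
  proof (rule stepwise_R3[OF lay vl length_R(5) R3_crosses(1) lev])
    fix x0 x1 x2 :: "nat \<Rightarrow> 'a"
    let ?F = "crossing_face X ?V lev pos (steps ?c1 ?c2 x0 x1 x2)"
    have "?F 0 0 1 0 \<longleftrightarrow> face (M 0 1 = Over) (\<not> pos 1) (x0 0) (x1 0) (pos 0) (x1 1) (x2 1)"
      using crossing_face_steps(2)[of ?c1 0 ?c2 1 ?V lev pos x0 x1 x2] a lv
      unfolding to_right_if_det2_pos[OF R3_det2(1)] by (simp add: to_right_if_det2_pos[OF R3_det2(1), unfolded One_nat_def])
    moreover have "?F 0 R3_cut 2 R3_cut \<longleftrightarrow> face (M 0 2 = Over) (\<not> pos 2) (x1 0) (x2 0) (pos 0) (x1 2) (x2 2)"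
      using crossing_face_steps(4)[of ?c1 0 ?c2 2 ?V lev pos x0 x1 x2] a lv
      by (simp add: to_right_if_det2_pos[OF R3_det2(2)])
    moreover have "?F 1 (- R3_cut) 2 (- R3_cut) \<longleftrightarrow> face (M 1 2 = Over) (pos 2) (x0 1) (x1 1) (\<not> pos 1) (x0 2) (x1 2)"
      using crossing_face_steps(1)[of ?c1 1 ?c2 2 ?V lev pos x0 x1 x2] a lv
      by (simp add: to_right_if_det2_neg[OF R3_det2(3), unfolded One_nat_def])
    moreover have "(\<forall>i<3. {x0 i, x1 i, x2 i} \<subseteq> carrier X) \<longleftrightarrow>
        {x0 0, x1 0, x2 0, x0 1, x1 1, x2 1, x0 2, x1 2, x2 2} \<subseteq> carrier X"
      by (auto simp: less_3_iff)
    ultimately show "triangle (M 0 1 = Over) (M 0 2 = Over) (M 1 2 = Over) (pos 0) (pos 1) (pos 2)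
       (x0 0) (x1 0) (x2 0) (x0 1) (x1 1) (x2 1) (x0 2) (x1 2) (x2 2) \<longleftrightarrow>
       (\<forall>i<3. {x0 i, x1 i, x2 i} \<subseteq> carrier X) \<and> ?F 0 0 1 0 \<and> ?F 0 R3_cut 2 R3_cut \<and> ?F 1 (- R3_cut) 2 (- R3_cut)"
      by (simp only: triangle_def)
  qed (use a in auto)
  then show ?thesis
    using a by simp
qed

text \<open>All orders are opposite to those of the other picture. Reading each strand backwards by
  \<open>face_flip\<close> restores the form of \<open>triangle\<close>, with negated
  directions.\<close>

lemma stepwise_R3_below:
  assumes lay: "layered M" and vl: "valid_levels R3_below lev"
    and lev: "\<forall>i s j t. strand_crosses R3_below i s j t \<longrightarrow> lev i s = M i j"
  shows "stepwise X R3_cut pos R3_below (strand_velocity R3_below) lev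
    (\<lambda>i. if i = 1 then 0 else - R3_cut) (\<lambda>i. if i = 0 then 0 else R3_cut)
    (\<lambda>x0 x1 x2. triangle (M 0 1 = Over) (M 0 2 = Over) (M 1 2 = Over) (\<not> pos 0) (\<not> pos 1) (\<not> pos 2)
       (x2 0) (x1 0) (x0 0) (x2 1) (x1 1) (x0 1) (x2 2) (x1 2) (x0 2))"
proof -
  let ?c1 = "\<lambda>i::nat. if i = 1 then 0 else - R3_cut" and ?c2 = "\<lambda>i::nat. if i = 0 then 0 else R3_cut"
  let ?V = "strand_velocity R3_below"
  have a: "0 < R3_cut" "R3_cut < 1"
    using R3_cut by auto
  have lv: "lev 0 0 = M 0 1" "lev 0 (- R3_cut) = M 0 2" "lev 1 R3_cut = M 1 2"
    using lev[rule_format, of 0 0 1 0] lev[rule_format, of 0 "- R3_cut" 2 "- R3_cut"] lev[rule_format, of 1 R3_cut 2 R3_cut] by (simp_all add: R3_crosses)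
  have crosses: "strand_crosses R3_below i s j t \<longleftrightarrow> t = s \<and>
     ((i, j, s) \<in> {(0, 1, 0), (1, 0, 0), (0, 2, - R3_cut), (2, 0, - R3_cut), (1, 2, - (- R3_cut)), (2, 1, - (- R3_cut))})" for i s j t
    by (simp add: R3_crosses(2))
  have st: "stepwise X \<bar>- R3_cut\<bar> pos R3_below ?V lev ?c1 ?c2
    (\<lambda>x0 x1 x2. triangle (M 0 1 = Over) (M 0 2 = Over) (M 1 2 = Over) (\<not> pos 0) (\<not> pos 1) (\<not> pos 2)
       (x2 0) (x1 0) (x0 0) (x2 1) (x1 1) (x0 1) (x2 2) (x1 2) (x0 2))"
  proof (rule stepwise_R3[OF lay vl length_R(6) crosses lev])
    fix x0 x1 x2 :: "nat \<Rightarrow> 'a"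
    let ?F = "crossing_face X ?V lev pos (steps ?c1 ?c2 x0 x1 x2)"
    have "?F 0 0 1 0 \<longleftrightarrow> face (M 0 1 = Over) (\<not> pos 1) (x1 0) (x2 0) (pos 0) (x0 1) (x1 1)"
      using crossing_face_steps(3)[of ?c1 0 ?c2 1 ?V lev pos x0 x1 x2] a lv
      by (simp add: to_right_if_det2_pos[OF R3_det2(4), unfolded One_nat_def])
    then have "?F 0 0 1 0 \<longleftrightarrow> face (M 0 1 = Over) (\<not> \<not> pos 1) (x2 0) (x1 0) (\<not> pos 0) (x1 1) (x0 1)"
      using face_flip[of "M 0 1 = Over" "\<not> pos 1" "x1 0" "x2 0" "pos 0" "x0 1" "x1 1"] by blast
    moreover have "?F 0 (- R3_cut) 2 (- R3_cut) \<longleftrightarrow> face (M 0 2 = Over) (\<not> pos 2) (x0 0) (x1 0) (pos 0) (x0 2) (x1 2)"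
      using crossing_face_steps(1)[of ?c1 0 ?c2 2 ?V lev pos x0 x1 x2] a lv
      by (simp add: to_right_if_det2_pos[OF R3_det2(5)])
    then have "?F 0 (- R3_cut) 2 (- R3_cut) \<longleftrightarrow> face (M 0 2 = Over) (\<not> \<not> pos 2) (x1 0) (x0 0) (\<not> pos 0) (x1 2) (x0 2)"
      using face_flip[of "M 0 2 = Over" "\<not> pos 2" "x0 0" "x1 0" "pos 0" "x0 2" "x1 2"] by blast
    moreover have "?F 1 R3_cut 2 R3_cut \<longleftrightarrow> face (M 1 2 = Over) (pos 2) (x1 1) (x2 1) (\<not> pos 1) (x1 2) (x2 2)"
      using crossing_face_steps(4)[of ?c1 1 ?c2 2 ?V lev pos x0 x1 x2] a lv
      by (simp add: to_right_if_det2_neg[OF R3_det2(6), unfolded One_nat_def])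
    then have "?F 1 R3_cut 2 R3_cut \<longleftrightarrow> face (M 1 2 = Over) (\<not> pos 2) (x2 1) (x1 1) (\<not> \<not> pos 1) (x2 2) (x1 2)"
      using face_flip[of "M 1 2 = Over" "pos 2" "x1 1" "x2 1" "\<not> pos 1" "x1 2" "x2 2"] by blast
    moreover have "(\<forall>i<3. {x0 i, x1 i, x2 i} \<subseteq> carrier X) \<longleftrightarrow>
        {x2 0, x1 0, x0 0, x2 1, x1 1, x0 1, x2 2, x1 2, x0 2} \<subseteq> carrier X"
      by (auto simp: less_3_iff)
    ultimately show "triangle (M 0 1 = Over) (M 0 2 = Over) (M 1 2 = Over) (\<not> pos 0) (\<not> pos 1) (\<not> pos 2)
       (x2 0) (x1 0) (x0 0) (x2 1) (x1 1) (x0 1) (x2 2) (x1 2) (x0 2) \<longleftrightarrow>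
       (\<forall>i<3. {x0 i, x1 i, x2 i} \<subseteq> carrier X) \<and> ?F 0 0 1 0 \<and> ?F 0 (- R3_cut) 2 (- R3_cut) \<and> ?F 1 (- (- R3_cut)) 2 (- (- R3_cut))"
      by (simp only: triangle_def minus_minus)
  qed (use a in auto)
  then show ?thesis
    using a by simp
qed

text \<open>\<open>triangle_move\<close> keeps the outer pieces and supplies the middle ones for the
  other picture; applied backwards it negates the directions twice.\<close>

lemma R3_extends:
  assumes lay: "layered M" and vl: "valid_levels R3_above lev" "valid_levels R3_below lev'"
    and lev: "\<forall>i s j t. strand_crosses R3_above i s j t \<longrightarrow> lev i s = M i j"
      "\<forall>i s j t. strand_crosses R3_below i s j t \<longrightarrow> lev' i s = M i j"
  shows "tangle_extends X R3_cut pos R3_above (strand_velocity R3_above) lev R3_below (strand_velocity R3_below) lev'"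
    and "tangle_extends X R3_cut pos R3_below (strand_velocity R3_below) lev' R3_above (strand_velocity R3_above) lev"
proof -
  note st = stepwise_R3_above[where pos = pos, OF lay vl(1) lev(1)] stepwise_R3_below[where pos = pos, OF lay vl(2) lev(2)]
  note ac = layered_acyclic[OF lay]
  let ?T = "triangle (M 0 1 = Over) (M 0 2 = Over) (M 1 2 = Over)"
  let ?x = "\<lambda>p q s i. if i = (0::nat) then p else if i = 1 then q else s"
  show "tangle_extends X R3_cut pos R3_above (strand_velocity R3_above) lev R3_below (strand_velocity R3_below) lev'"
  proof (rule tangle_extends_stepwise[OF confined_R(5) _ st])
    fix x0 x1 x2 y0 y1 y2 :: "nat \<Rightarrow> 'a"
    assume x: "?T (pos 0) (pos 1) (pos 2) (x0 0) (x1 0) (x2 0) (x0 1) (x1 1) (x2 1) (x0 2) (x1 2) (x2 2)"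
      and y: "?T (pos 0) (pos 1) (pos 2) (y0 0) (y1 0) (y2 0) (y0 1) (y1 1) (y2 1) (y0 2) (y1 2) (y2 2)"
      and xy: "\<And>i. i < length R3_above \<Longrightarrow> y0 i = x0 i \<and> y2 i = x2 i"
    have "y0 0 = x0 0" "y0 1 = x0 1" "y0 2 = x0 2" "y2 0 = x2 0" "y2 1 = x2 1" "y2 2 = x2 2"
      using xy by (simp_all add: length_R)
    then show "\<forall>i<length R3_above. y1 i = x1 i"
      using triangle_unique[OF x] y by (simp add: length_R less_3_iff)
  next
    fix x0 x1 x2 :: "nat \<Rightarrow> 'a"
    assume "?T (pos 0) (pos 1) (pos 2) (x0 0) (x1 0) (x2 0) (x0 1) (x1 1) (x2 1) (x0 2) (x1 2) (x2 2)"
    then obtain p q s where "?T (\<not> pos 0) (\<not> pos 1) (\<not> pos 2) (x2 0) p (x0 0) (x2 1) q (x0 1) (x2 2) s (x0 2)"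
      using triangle_move[OF ac] by blast
    then show "\<exists>(y0 :: nat \<Rightarrow> 'a) (y1 :: nat \<Rightarrow> 'a) (y2 :: nat \<Rightarrow> 'a). ?T (\<not> pos 0) (\<not> pos 1) (\<not> pos 2) (y2 0) (y1 0) (y0 0) (y2 1) (y1 1) (y0 1) (y2 2) (y1 2) (y0 2) \<and>
        (\<forall>i<length R3_above. y0 i = x0 i \<and> y2 i = x2 i)"
      by - (rule exI[of _ x0], rule exI[of _ "?x p q s"], rule exI[of _ x2], simp)
  qed (simp add: length_R)
  show "tangle_extends X R3_cut pos R3_below (strand_velocity R3_below) lev' R3_above (strand_velocity R3_above) lev"
  proof (rule tangle_extends_stepwise[OF confined_R(6) _ st(2,1)])
    fix x0 x1 x2 y0 y1 y2 :: "nat \<Rightarrow> 'a"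
    assume x: "?T (\<not> pos 0) (\<not> pos 1) (\<not> pos 2) (x2 0) (x1 0) (x0 0) (x2 1) (x1 1) (x0 1) (x2 2) (x1 2) (x0 2)"
      and y: "?T (\<not> pos 0) (\<not> pos 1) (\<not> pos 2) (y2 0) (y1 0) (y0 0) (y2 1) (y1 1) (y0 1) (y2 2) (y1 2) (y0 2)"
      and xy: "\<And>i. i < length R3_below \<Longrightarrow> y0 i = x0 i \<and> y2 i = x2 i"
    have "y0 0 = x0 0" "y0 1 = x0 1" "y0 2 = x0 2" "y2 0 = x2 0" "y2 1 = x2 1" "y2 2 = x2 2"
      using xy by (simp_all add: length_R)
    then show "\<forall>i<length R3_below. y1 i = x1 i"
      using triangle_unique[OF x] y by (simp add: length_R less_3_iff)
  next
    fix x0 x1 x2 :: "nat \<Rightarrow> 'a"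
    assume "?T (\<not> pos 0) (\<not> pos 1) (\<not> pos 2) (x2 0) (x1 0) (x0 0) (x2 1) (x1 1) (x0 1) (x2 2) (x1 2) (x0 2)"
    then obtain p q s where "?T (\<not> \<not> pos 0) (\<not> \<not> pos 1) (\<not> \<not> pos 2) (x0 0) p (x2 0) (x0 1) q (x2 1) (x0 2) s (x2 2)"
      using triangle_move[OF ac] by blast
    then show "\<exists>(y0 :: nat \<Rightarrow> 'a) (y1 :: nat \<Rightarrow> 'a) (y2 :: nat \<Rightarrow> 'a). ?T (pos 0) (pos 1) (pos 2) (y0 0) (y1 0) (y2 0) (y0 1) (y1 1) (y2 1) (y0 2) (y1 2) (y2 2) \<and>
        (\<forall>i<length R3_below. y0 i = x0 i \<and> y2 i = x2 i)"
      by - (rule exI[of _ x0], rule exI[of _ "?x p q s"], rule exI[of _ x2], simp)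
  qed (simp add: length_R)
qed

text \<open>The only crossing that can be classical is that of the two straight strands at parameter
  0, and these strands are identical in both pictures. This covers the mixed and the purely virtual
  move.\<close>

lemma R3_extends_mixed:
  assumes vl: "valid_levels R3_above lev" "valid_levels R3_below lev'"
    and lev: "\<And>i s j t. strand_crosses R3_above i s j t \<Longrightarrow> lev i s = M i j"
      "\<And>i s j t. strand_crosses R3_below i s j t \<Longrightarrow> lev' i s = M i j"
    and M: "M 0 2 = Virtual" "M 2 0 = Virtual" "M 1 2 = Virtual" "M 2 1 = Virtual"
  shows "tangle_extends X R3_cut pos R3_above (strand_velocity R3_above) lev R3_below (strand_velocity R3_below) lev'"
    and "tangle_extends X R3_cut pos R3_below (strand_velocity R3_below) lev' R3_above (strand_velocity R3_above) lev"
proof -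
  have cr: "strand_crosses R3_above i s j t \<and> lev i s \<noteq> Virtual \<longleftrightarrow>
      s = 0 \<and> t = 0 \<and> (i = 0 \<and> j = 1 \<or> i = 1 \<and> j = 0) \<and> M i j \<noteq> Virtual" for i s j t
    using lev(1)[of i s j t] M by (auto simp: R3_crosses)
  have cr': "strand_crosses R3_below i s j t \<and> lev' i s \<noteq> Virtual \<longleftrightarrow>
      s = 0 \<and> t = 0 \<and> (i = 0 \<and> j = 1 \<or> i = 1 \<and> j = 0) \<and> M i j \<noteq> Virtual" for i s j t
    using lev(2)[of i s j t] M by (auto simp: R3_crosses)
  have cl: "strand_classical R3_above lev i t \<longleftrightarrow> t = 0 \<and> (\<exists>j. (i = 0 \<and> j = 1 \<or> i = 1 \<and> j = 0) \<and> M i j \<noteq> Virtual)" for i t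
    using cr unfolding strand_classical_def by blast
  have cl': "strand_classical R3_below lev' i t \<longleftrightarrow> t = 0 \<and> (\<exists>j. (i = 0 \<and> j = 1 \<or> i = 1 \<and> j = 0) \<and> M i j \<noteq> Virtual)" for i t
    using cr' unfolding strand_classical_def by blast
  have lv: "lev i s = lev' i s" if "strand_crosses R3_below i s j t" "lev' i s \<noteq> Virtual" for i s j t
    using that cr cr' lev by (metis)
  have lv': "lev i s = lev' i s" if "strand_crosses R3_above i s j t" "lev i s \<noteq> Virtual" for i s j t
    using that cr cr' lev by (metis)
  have V: "strand_velocity R3_above i s = strand_velocity R3_below i s" if "strand_crosses R3_below i s j t" "lev' i s \<noteq> Virtual" for i s j t
  proof -
    have "i = 0 \<or> i = 1"
      using that cr'[of i s j t] by blast
    then show ?thesis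
      using R3_velocity by auto
  qed
  have step: "strand_crosses R3_above i s j t \<and> lev i s = Under \<and> lev j t = Over \<and>
      strand_velocity R3_below i s = strand_velocity R3_above i s \<and> strand_velocity R3_below j t = strand_velocity R3_above j t"
    if c: "strand_crosses R3_below i s j t" "lev' i s = Under" "lev' j t = Over" for i s j t
  proof -
    have c': "strand_crosses R3_below j t i s"
      using c(1) strand_crosses_commute by blast
    have "strand_crosses R3_above i s j t"
      using cr[of i s j t] cr'[of i s j t] c by simp
    then show ?thesis
      using lv[OF c(1)] lv[OF c'] V[OF c(1)] V[OF c'] c by simp
  qed
  have step': "strand_crosses R3_below i s j t \<and> lev' i s = Under \<and> lev' j t = Over \<and>
      strand_velocity R3_above i s = strand_velocity R3_below i s \<and> strand_velocity R3_above j t = strand_velocity R3_below j t"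
    if c: "strand_crosses R3_above i s j t" "lev i s = Under" "lev j t = Over" for i s j t
  proof -
    have c': "strand_crosses R3_above j t i s"
      using c(1) strand_crosses_commute by blast
    have b: "strand_crosses R3_below i s j t"
      using cr[of i s j t] cr'[of i s j t] c by simp
    have l: "lev' i s = Under" "lev' j t = Over"
      using lv'[OF c(1)] lv'[OF c'] c by simp_all
    have b': "strand_crosses R3_below j t i s"
      using b strand_crosses_commute by blast
    show ?thesis
      using b l V[OF b] V[OF b'] by simp
  qed
  show "tangle_extends X R3_cut pos R3_above (strand_velocity R3_above) lev R3_below (strand_velocity R3_below) lev'"
  proof (rule tangle_extends_same[OF confined_R(5)])
    show "strand_classical R3_below lev' i t = strand_classical R3_above lev i t" for i t
      unfolding cl cl' ..
    show "t = 0" if "strand_classical R3_above lev i t" for i t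
      using that unfolding cl by blast
  qed (use step in \<open>auto simp: length_R\<close>)
  show "tangle_extends X R3_cut pos R3_below (strand_velocity R3_below) lev' R3_above (strand_velocity R3_above) lev"
  proof (rule tangle_extends_same[OF confined_R(6)])
    show "strand_classical R3_above lev i t = strand_classical R3_below lev' i t" for i t
      unfolding cl cl' ..
    show "t = 0" if "strand_classical R3_below lev' i t" for i t
      using that unfolding cl' by blast
  qed (use step' in \<open>auto simp: length_R\<close>)
qed

end

section \<open>Planar isotopy\<close>

text \<open>The Jacobian is 1 at time 0, depends continuously on time and never vanishes, so the end
  map preserves orientation.\<close>

lemma ambient_isotopy_derivative:
  assumes "ambient_isotopy H"
  shows "\<exists>h'. \<forall>z. (H 1 has_derivative h' z) (at z) \<and> det2 (h' z 1) (h' z \<i>) > 0"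
proof -
  obtain H' where H': "\<And>t z. t \<in> {0..1} \<Longrightarrow> (H t has_derivative H' t z) (at z)"
      "\<And>t z. t \<in> {0..1} \<Longrightarrow> det2 (H' t z 1) (H' t z \<i>) \<noteq> 0"
      "\<And>v. continuous_on ({0..1} \<times> UNIV) (\<lambda>(t, z). H' t z v)"
    using assms unfolding ambient_isotopy_def by blast
  have "det2 (H' 1 z 1) (H' 1 z \<i>) > 0" for z
  proof -
    let ?d = "\<lambda>t. det2 (H' t z 1) (H' t z \<i>)"
    have "continuous_on {0..1} (\<lambda>t. H' t z v)" for v
    proof -
      have "continuous_on {0..1} (\<lambda>t. (t, z))"
        by (intro continuous_intros)
      then show ?thesis
        using continuous_on_compose2[OF H'(3)[of v], of "{0..1}" "\<lambda>t. (t, z)"] by auto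
    qed
    then have cont: "continuous_on {0..1} ?d"
      unfolding det2_def by (intro continuous_intros)
    have "H 0 = (\<lambda>z. z)"
      using assms by (auto simp: ambient_isotopy_def)
    then have "((\<lambda>z. z) has_derivative H' 0 z) (at z)"
      using H'(1)[of 0 z] by simp
    then have "H' 0 z = (\<lambda>x. x)"
      using has_derivative_unique has_derivative_ident by blast
    then have "?d 0 = 1"
      by (simp add: det2_def)
    show ?thesis
    proof (rule ccontr)
      assume "\<not> ?thesis"
      then have "\<exists>t\<ge>0. t \<le> 1 \<and> ?d t = 0"
        using \<open>?d 0 = 1\<close> cont by (intro IVT2') auto
      then show False
        using H'(2) by force
    qed
  qed
  then show ?thesis
    using H'(1)[of 1] by auto
qed

section \<open>Orientation-preserving reparametrizations of the circle\<close>

lemma cis_eq_cis_iff: "cis s = cis t \<longleftrightarrow> (\<exists>n::int. s = t + 2 * pi * n)"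
proof
  assume "cis s = cis t"
  then have "cis (s - t) = 1"
    by (metis cis_divide cis_neq_zero divide_self)
  then have "cos (s - t) = 1"
    by (metis cis.simps(1) one_complex.simps(1))
  then obtain n :: int where "s - t = real_of_int n * 2 * pi"
    unfolding cos_one_2pi_int by blast
  then have "s = t + 2 * pi * n"
    by (simp add: algebra_simps)
  then show "\<exists>n::int. s = t + 2 * pi * n" ..
next
  assume "\<exists>n::int. s = t + 2 * pi * n"
  then obtain n :: int where "s = t + 2 * pi * n" ..
  then show "cis s = cis t"
    using cis_multiple_2pi[of "of_int n"] by (simp add: cis_mult[symmetric])
qed

context
  fixes \<psi> :: "real \<Rightarrow> real"
  assumes reparam: "circle_reparam \<psi>"
begin

lemma circle_reparam_add_int: "\<psi> (t + 2 * pi * of_int n) = \<psi> t + 2 * pi * of_int n"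
proof -
  have step: "\<psi> (t + 2 * pi) = \<psi> t + 2 * pi" for t
    using reparam by (simp add: circle_reparam_def)
  have nat: "\<psi> (t + 2 * pi * of_nat m) = \<psi> t + 2 * pi * of_nat m" for t and m :: nat
  proof (induction m)
    case (Suc m)
    then show ?case
      using step[of "t + 2 * pi * of_nat m"] by (simp add: algebra_simps)
  qed simp
  show ?thesis
  proof (cases "n \<ge> 0")
    case True
    then show ?thesis
      using nat[of t "nat n"] by simp
  next
    case False
    then show ?thesis
      using nat[of "t + 2 * pi * of_int n" "nat (- n)"] by (simp add: algebra_simps)
  qed
qed

lemma circle_reparam_strict_mono: "strict_mono \<psi>"
  unfolding strict_mono_def
proof (intro allI impI)
  fix x y :: real assume "x < y"
  then show "\<psi> x < \<psi> y"
    using reparam by (intro DERIV_pos_imp_increasing[of x y \<psi>]) (auto simp: circle_reparam_def)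
qed

lemma circle_reparam_continuous: "continuous_on A \<psi>"
  using reparam unfolding circle_reparam_def by (meson DERIV_isCont continuous_at_imp_continuous_on)

lemma circle_reparam_surj: "\<exists>t. \<psi> t = y"
proof -
  obtain n :: int where n: "\<bar>y - \<psi> 0\<bar> \<le> of_int n"
    using ex_le_of_int by blast
  have "of_int n \<le> 2 * pi * of_int n"
    using n pi_ge_two mult_right_mono[of 1 "2 * pi" "of_int n"] by linarith
  \<comment> \<open>\<open>n\<close> full turns move \<open>\<psi>\<close> by
    \<open>2 * pi * n\<close>, which is at least \<open>n\<close>; so the values after
    \<open>- n\<close> and \<open>n\<close> turns enclose \<open>y\<close>.\<close>
  then have b: "\<psi> (2 * pi * of_int (- n)) \<le> y" "y \<le> \<psi> (2 * pi * of_int n)"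
    using n circle_reparam_add_int[of 0 n] circle_reparam_add_int[of 0 "- n"] by auto
  have "2 * pi * of_int (- n) \<le> 2 * pi * of_int n"
    using n pi_ge_zero by (intro mult_left_mono) auto
  then show ?thesis
    using IVT'[OF b _ circle_reparam_continuous] by blast
qed

text \<open>The lift commutes with full turns and is injective, so it descends to an injective map
  of the circle.\<close>

lemma cis_circle_reparam_eq_iff: "cis (\<psi> s) = cis (\<psi> t) \<longleftrightarrow> cis s = cis t"
proof -
  have "\<psi> s = \<psi> t + 2 * pi * of_int n \<longleftrightarrow> s = t + 2 * pi * of_int n" for n :: int
    unfolding circle_reparam_add_int[symmetric] using strict_mono_eq[OF circle_reparam_strict_mono] by blast
  then show ?thesis
    unfolding cis_eq_cis_iff by simp
qed

lemma eventually_circle_reparam: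
  "(\<forall>\<^sub>F s in at_right 0. Q (\<psi> t + s)) \<longleftrightarrow> (\<forall>\<^sub>F s in at_right 0. Q (\<psi> (t + s)))"
  "(\<forall>\<^sub>F s in at_right 0. Q (\<psi> t - s)) \<longleftrightarrow> (\<forall>\<^sub>F s in at_right 0. Q (\<psi> (t - s)))"
proof -
  have c: "continuous_on {-1..1} (\<lambda>x. \<psi> (t + x))"
    by (intro continuous_on_compose2[OF circle_reparam_continuous[of UNIV]] continuous_intros) auto
  have m: "strict_mono_on {-1..1} (\<lambda>x. \<psi> (t + x))"
    using strict_monoD[OF circle_reparam_strict_mono] by (intro strict_mono_onI) simp
  show "(\<forall>\<^sub>F s in at_right 0. Q (\<psi> t + s)) \<longleftrightarrow> (\<forall>\<^sub>F s in at_right 0. Q (\<psi> (t + s)))"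
    using eventually_strict_mono_at_right[OF c m, of 0 Q] by simp
  show "(\<forall>\<^sub>F s in at_right 0. Q (\<psi> t - s)) \<longleftrightarrow> (\<forall>\<^sub>F s in at_right 0. Q (\<psi> (t - s)))"
    using eventually_strict_mono_at_left[OF c m, of 0 Q] eventually_at_left_to_right[of "\<lambda>s. Q (\<psi> (t + s))" 0] by simp
qed

end

text \<open>Of the ambient isotopy only its end map \<open>h\<close> is kept, with a derivative of
  positive determinant.\<close>

locale diagram_isotopy =
  fixes D D' :: diagram and h :: "complex \<Rightarrow> complex" and h' :: "complex \<Rightarrow> complex \<Rightarrow> complex"
    and \<sigma> :: "nat \<Rightarrow> nat" and \<psi> :: "nat \<Rightarrow> real \<Rightarrow> real"
  assumes vld: "virtual_link_diagram D" "virtual_link_diagram D'"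
    and same_ncomp: "ncomp D = ncomp D'"
    and inj_h: "inj h"
    and h': "\<And>z. (h has_derivative h' z) (at z)" "\<And>z. det2 (h' z 1) (h' z \<i>) > 0"
    and \<sigma>: "bij_betw \<sigma> {..<ncomp D} {..<ncomp D}"
    and \<psi>: "\<And>k. k < ncomp D \<Longrightarrow> circle_reparam (\<psi> k)"
    and point_\<psi>: "\<And>k t. k < ncomp D \<Longrightarrow> point D' (\<sigma> k, cis (\<psi> k t)) = h (point D (k, cis t))"
    and level_\<psi>: "\<And>k t. k < ncomp D \<Longrightarrow> (k, cis t) \<in> double_points D \<Longrightarrow>
      level D' (\<sigma> k, cis (\<psi> k t)) = level D (k, cis t)"
begin

text \<open>The map of circles that goes with \<open>h\<close>. \<open>Arg\<close> picks one angle;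
  by \<open>transport_cis\<close> any other angle of the same point gives the same result.\<close>

definition transport :: "circle_point \<Rightarrow> circle_point" where
  "transport p = (\<sigma> (fst p), cis (\<psi> (fst p) (Arg (snd p))))"

lemma circles_cases:
  assumes "p \<in> circles D"
  obtains k t where "k < ncomp D" "p = (k, cis t)"
proof -
  have "norm (snd p) = 1" "fst p < ncomp D"
    using assms by (auto simp: circles_def)
  moreover from this have "cis (Arg (snd p)) = snd p"
    by (subst cis_Arg) (auto simp: sgn_div_norm)
  ultimately show ?thesis
    using that[of "fst p" "Arg (snd p)"] by (metis prod.collapse)
qed

lemma transport_cis:
  assumes "k < ncomp D"
  shows "transport (k, cis t) = (\<sigma> k, cis (\<psi> k t))"
proof -
  have "cis (Arg (cis t)) = cis t"
    by (subst cis_Arg) (auto simp: sgn_div_norm)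
  then show ?thesis
    using cis_circle_reparam_eq_iff[OF \<psi>[OF assms], of "Arg (cis t)" t] by (simp add: transport_def)
qed

lemma \<sigma>_less: "k < ncomp D \<Longrightarrow> \<sigma> k < ncomp D"
  using \<sigma> by (auto simp: bij_betw_def)

lemma bij_transport: "bij_betw transport (circles D) (circles D')"
proof (rule bij_betw_imageI)
  show "inj_on transport (circles D)"
  proof (rule inj_onI)
    fix p q assume p: "p \<in> circles D" and q: "q \<in> circles D" and eq: "transport p = transport q"
    obtain k t where kt: "k < ncomp D" "p = (k, cis t)"
      using p by (rule circles_cases)
    obtain l s where ls: "l < ncomp D" "q = (l, cis s)"
      using q by (rule circles_cases)
    have "\<sigma> k = \<sigma> l"
      using eq kt ls by (simp add: transport_cis)
    then have "k = l"
      using \<sigma> kt ls by (auto simp: bij_betw_def dest: inj_onD)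
    then show "p = q"
      using eq kt ls cis_circle_reparam_eq_iff[OF \<psi>] by (simp add: transport_cis)
  qed
  show "transport ` circles D = circles D'"
  proof
    show "transport ` circles D \<subseteq> circles D'"
      using \<sigma>_less by (auto simp: circles_def transport_def same_ncomp)
    show "circles D' \<subseteq> transport ` circles D"
    proof
      fix q assume q: "q \<in> circles D'"
      then have n: "norm (snd q) = 1" "fst q < ncomp D"
        by (auto simp: circles_def same_ncomp)
      then have "fst q \<in> \<sigma> ` {..<ncomp D}"
        using bij_betw_imp_surj_on[OF \<sigma>] by simp
      then obtain k where k: "k < ncomp D" "\<sigma> k = fst q"
        by auto
      obtain t where t: "\<psi> k t = Arg (snd q)"
        using circle_reparam_surj[OF \<psi>[OF k(1)]] by blast
      have "cis (Arg (snd q)) = snd q"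
        using n by (subst cis_Arg) (auto simp: sgn_div_norm)
      then have "transport (k, cis t) = q"
        using k t by (simp add: transport_cis prod_eq_iff)
      moreover have "(k, cis t) \<in> circles D"
        using k by (simp add: circles_def)
      ultimately show "q \<in> transport ` circles D"
        by (metis imageI)
    qed
  qed
qed

lemma transport_in_circles: "p \<in> circles D \<Longrightarrow> transport p \<in> circles D'"
  using bij_transport by (auto simp: bij_betw_def)

lemma transport_surj: "q \<in> circles D' \<Longrightarrow> \<exists>p\<in>circles D. q = transport p"
  using bij_transport by (auto simp: bij_betw_def)

lemma point_transport: "p \<in> circles D \<Longrightarrow> point D' (transport p) = h (point D p)"
  by (erule circles_cases) (simp add: transport_cis point_\<psi>)

lemma crosses_transport_iff:
  assumes "p \<in> circles D" "q \<in> circles D"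
  shows "crosses D' (transport p) (transport q) \<longleftrightarrow> crosses D p q"
  using assms inj_on_eq_iff[OF bij_betw_imp_inj_on[OF bij_transport], of p q] inj_eq[OF inj_h]
  by (simp add: crosses_def transport_in_circles point_transport)

lemma double_points_transport_iff:
  assumes "p \<in> circles D"
  shows "transport p \<in> double_points D' \<longleftrightarrow> p \<in> double_points D"
proof
  assume "transport p \<in> double_points D'"
  then obtain q' where q': "crosses D' (transport p) q'"
    by (auto simp: double_points_def)
  then obtain q where "q \<in> circles D" "q' = transport q"
    using transport_surj crosses_in_circles by blast
  then have "crosses D p q"
    using q' crosses_transport_iff assms by simp
  then show "p \<in> double_points D"
    unfolding double_points_def by blast
next
  assume "p \<in> double_points D"
  then obtain q where "crosses D p q"
    by (auto simp: double_points_def)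
  then have "crosses D' (transport p) (transport q)"
    using crosses_transport_iff crosses_in_circles by blast
  then show "transport p \<in> double_points D'"
    unfolding double_points_def by blast
qed

lemma level_transport: "p \<in> circles D \<Longrightarrow> p \<in> double_points D \<Longrightarrow> level D' (transport p) = level D p"
  by (erule circles_cases) (simp add: transport_cis level_\<psi>)

lemma regular_transport_iff:
  assumes "p \<in> circles D"
  shows "transport p \<in> regular_points D' \<longleftrightarrow> p \<in> regular_points D"
  using assms double_points_transport_iff[OF assms] level_transport[OF assms] transport_in_circles[OF assms]
  by (auto simp: regular_points_def classical_points_def)

lemma eventually_rot_transport:
  assumes "p \<in> circles D"
  shows "(\<forall>\<^sub>F s in at_right 0. P (rot (transport p) s)) \<longleftrightarrow> (\<forall>\<^sub>F s in at_right 0. P (transport (rot p s)))"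
    and "(\<forall>\<^sub>F s in at_right 0. P (rot (transport p) (- s))) \<longleftrightarrow> (\<forall>\<^sub>F s in at_right 0. P (transport (rot p (- s))))"
proof -
  obtain k t where kt: "k < ncomp D" "p = (k, cis t)"
    using assms by (rule circles_cases)
  have r: "rot (transport p) s = (\<sigma> k, cis (\<psi> k t + s))" "transport (rot p s) = (\<sigma> k, cis (\<psi> k (t + s)))" for s
    using transport_cis[OF kt(1)] by (simp_all add: kt(2) rot_def cis_mult)
  show "(\<forall>\<^sub>F s in at_right 0. P (rot (transport p) s)) \<longleftrightarrow> (\<forall>\<^sub>F s in at_right 0. P (transport (rot p s)))"
    unfolding r by (rule eventually_circle_reparam(1)[OF \<psi>[OF kt(1)], of "\<lambda>x. P (\<sigma> k, cis x)"])
  show "(\<forall>\<^sub>F s in at_right 0. P (rot (transport p) (- s))) \<longleftrightarrow> (\<forall>\<^sub>F s in at_right 0. P (transport (rot p (- s))))"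
    unfolding r using eventually_circle_reparam(2)[OF \<psi>[OF kt(1)], of "\<lambda>x. P (\<sigma> k, cis x)"] by simp
qed

text \<open>The reparametrized curve of \<open>D'\<close> equals \<open>h\<close> composed with the
  curve of \<open>D\<close>; differentiating both gives the factor \<open>c\<close>, the positive
  derivative of the reparametrization.\<close>

lemma velocity_transport:
  assumes "p \<in> circles D"
  shows "\<exists>c>0. c *\<^sub>R velocity D' (transport p) = h' (point D p) (velocity D p)"
proof -
  obtain k t where kt: "k < ncomp D" "p = (k, cis t)"
    using assms by (rule circles_cases)
  obtain \<psi>' where \<psi>': "\<And>t. (\<psi> k has_real_derivative \<psi>' t) (at t)" "\<And>t. \<psi>' t > 0"
    using \<psi>[OF kt(1)] unfolding circle_reparam_def by blast
  obtain c where c: "\<And>x. ((\<lambda>s. curve D k (cis s)) has_vector_derivative c x) (at x)"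
    using vld(1) kt(1) unfolding virtual_link_diagram_def C1_immersed_circle_def by metis
  obtain d where d: "\<And>x. ((\<lambda>s. curve D' (\<sigma> k) (cis s)) has_vector_derivative d x) (at x)"
    using vld(2) \<sigma>_less[OF kt(1)] unfolding virtual_link_diagram_def C1_immersed_circle_def same_ncomp by metis
  have shift: "vector_derivative (\<lambda>s. f (x + s)) (at 0) = y" if "(f has_vector_derivative y) (at x)"
    for f :: "real \<Rightarrow> complex" and x y
  proof -
    have "((\<lambda>s. x + s) has_real_derivative 1) (at 0)"
      by (auto intro!: derivative_eq_intros)
    then have "(f \<circ> (\<lambda>s. x + s) has_vector_derivative 1 *\<^sub>R y) (at 0)"
      using that by (intro vector_diff_chain_at) (simp_all add: has_real_derivative_iff_has_vector_derivative)
    then show ?thesis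
      by (simp add: o_def vector_derivative_at)
  qed
  have v: "velocity D p = c t" "velocity D' (transport p) = d (\<psi> k t)"
    using shift[OF c] shift[OF d] by (simp_all add: velocity_def transport_cis[OF kt(1)] kt(2) cis_mult)
  have "((\<lambda>s. curve D' (\<sigma> k) (cis s)) \<circ> \<psi> k has_vector_derivative \<psi>' t *\<^sub>R d (\<psi> k t)) (at t)"
    using \<psi>'(1)[of t] d by (intro vector_diff_chain_at) (simp_all add: has_real_derivative_iff_has_vector_derivative)
  moreover have "(\<lambda>s. curve D' (\<sigma> k) (cis s)) \<circ> \<psi> k = h \<circ> (\<lambda>s. curve D k (cis s))"
    using point_\<psi>[OF kt(1)] by (auto simp: point_def fun_eq_iff)
  ultimately have 1: "(h \<circ> (\<lambda>s. curve D k (cis s)) has_vector_derivative \<psi>' t *\<^sub>R d (\<psi> k t)) (at t)"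
    by simp
  have lin: "linear (h' (point D p))"
    using h'(1) has_derivative_linear by blast
  have "(h \<circ> (\<lambda>s. curve D k (cis s)) has_derivative (h' (curve D k (cis t)) \<circ> (\<lambda>x. x *\<^sub>R c t))) (at t)"
    using c[of t] by (intro diff_chain_at h') (simp add: has_vector_derivative_def)
  moreover have "h' (curve D k (cis t)) \<circ> (\<lambda>x. x *\<^sub>R c t) = (\<lambda>x. x *\<^sub>R h' (point D p) (c t))"
    using lin by (simp add: fun_eq_iff linear_scale point_def kt(2))
  ultimately have 2: "(h \<circ> (\<lambda>s. curve D k (cis s)) has_vector_derivative h' (point D p) (c t)) (at t)"
    by (simp add: has_vector_derivative_def)
  have "\<psi>' t *\<^sub>R d (\<psi> k t) = h' (point D p) (c t)"
    using 1 2 vector_derivative_unique_at by blast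
  then show ?thesis
    using \<psi>'(2) v by auto
qed

text \<open>The determinants differ by the positive Jacobian of \<open>h\<close> and by two positive
  speeds, hence have the same sign.\<close>

lemma leaves_right_transport:
  assumes "crosses D p q"
  shows "leaves_right D' (transport p) (transport q) \<longleftrightarrow> leaves_right D p q"
proof -
  have pq: "p \<in> circles D" "q \<in> circles D" "point D p = point D q"
    using assms by (auto simp: crosses_def)
  obtain a b where ab: "a > 0" "a *\<^sub>R velocity D' (transport p) = h' (point D p) (velocity D p)"
      "b > 0" "b *\<^sub>R velocity D' (transport q) = h' (point D p) (velocity D q)"
    using velocity_transport[OF pq(1)] velocity_transport[OF pq(2)] pq(3) by auto
  have lin: "linear (h' (point D p))"
    using h'(1) has_derivative_linear by blast
  have "b * a * det2 (velocity D' (transport q)) (velocity D' (transport p))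
      = det2 (h' (point D p) 1) (h' (point D p) \<i>) * det2 (velocity D q) (velocity D p)"
    using det2_scaleR[of b _ a] det2_linear[OF lin] ab(2,4) by metis
  then have "sgn (det2 (velocity D' (transport q)) (velocity D' (transport p))) = sgn (det2 (velocity D q) (velocity D p))"
    using ab(1,3) h'(2)[of "point D p"] by (metis mult.left_neutral mult_pos_pos sgn_mult sgn_pos)
  then show ?thesis
    unfolding leaves_right_def by (metis sgn_less)
qed

text \<open>Stated for a pair of functions related by \<open>transport\<close>, so that it serves
  both for pushing a coloring forward and for pulling one back. The facts \<open>1\<close>,
  \<open>2\<close>, \<open>3\<close> match the three clauses of
  \<open>point_colorings\<close>.\<close>

lemma point_colorings_transport_iff:
  assumes "\<And>p. p \<in> regular_points D \<Longrightarrow> G (transport p) = F p"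
    and "F \<in> extensional (regular_points D)" "G \<in> extensional (regular_points D')"
  shows "G \<in> point_colorings X D' \<longleftrightarrow> F \<in> point_colorings X D"
proof -
  have circ: "p \<in> circles D" if "p \<in> regular_points D" for p
    using that by (simp add: regular_points_def)
  have surj: "\<exists>p\<in>regular_points D. q = transport p" if "q \<in> regular_points D'" for q
  proof -
    have "q \<in> circles D'"
      using that by (simp add: regular_points_def)
    then obtain p where "p \<in> circles D" "q = transport p"
      using transport_surj by blast
    then show ?thesis
      using regular_transport_iff that by blast
  qed
  have ev: "(\<forall>\<^sub>F s in at_right 0. G (rot (transport p) s) = x) \<longleftrightarrow> (\<forall>\<^sub>F s in at_right 0. F (rot p s) = x)"
    "(\<forall>\<^sub>F s in at_right 0. G (rot (transport p) (- s)) = x) \<longleftrightarrow> (\<forall>\<^sub>F s in at_right 0. F (rot p (- s)) = x)"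
    if p: "p \<in> circles D" for p x
  proof -
    have "\<forall>\<^sub>F s in at 0. rot p s \<in> regular_points D"
      using eventually_rot_regular finite_classical_points vld(1) p by blast
    then have reg: "\<forall>\<^sub>F s in at_right 0. rot p s \<in> regular_points D" "\<forall>\<^sub>F s in at_right 0. rot p (- s) \<in> regular_points D"
      by (simp_all add: eventually_at_0_cases)
    have "\<forall>\<^sub>F s in at_right 0. (G (transport (rot p s)) = x) = (F (rot p s) = x)"
      using reg(1) by eventually_elim (simp add: assms(1))
    moreover have "\<forall>\<^sub>F s in at_right 0. (G (transport (rot p (- s))) = x) = (F (rot p (- s)) = x)"
      using reg(2) by eventually_elim (simp add: assms(1))
    ultimately show "(\<forall>\<^sub>F s in at_right 0. G (rot (transport p) s) = x) \<longleftrightarrow> (\<forall>\<^sub>F s in at_right 0. F (rot p s) = x)"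
      "(\<forall>\<^sub>F s in at_right 0. G (rot (transport p) (- s)) = x) \<longleftrightarrow> (\<forall>\<^sub>F s in at_right 0. F (rot p (- s)) = x)"
      unfolding eventually_rot_transport(1)[OF p, of "\<lambda>q. G q = x"] eventually_rot_transport(2)[OF p, of "\<lambda>q. G q = x"]
      by (auto dest: eventually_subst)
  qed
  have germs: "has_germs G (transport p) u b \<longleftrightarrow> has_germs F p u b" if "p \<in> circles D" for p u b
    using ev[OF that] by (simp add: has_germs_def)
  have 1: "G \<in> regular_points D' \<rightarrow>\<^sub>E carrier X \<longleftrightarrow> F \<in> regular_points D \<rightarrow>\<^sub>E carrier X"
  proof -
    have "(\<forall>q\<in>regular_points D'. G q \<in> carrier X) \<longleftrightarrow> (\<forall>p\<in>regular_points D. F p \<in> carrier X)"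
      using surj regular_transport_iff circ assms(1) by metis
    then show ?thesis
      using assms(2,3) by (auto simp: PiE_def)
  qed
  have 2: "(\<forall>q\<in>regular_points D'. \<forall>\<^sub>F s in at 0. G (rot q s) = G q) \<longleftrightarrow>
      (\<forall>p\<in>regular_points D. \<forall>\<^sub>F s in at 0. F (rot p s) = F p)"
  proof -
    have "(\<forall>\<^sub>F s in at 0. G (rot (transport p) s) = G (transport p)) \<longleftrightarrow> (\<forall>\<^sub>F s in at 0. F (rot p s) = F p)"
      if "p \<in> regular_points D" for p
      unfolding eventually_at_0_cases using ev[OF circ[OF that]] assms(1)[OF that] by simp
    then show ?thesis
      using surj regular_transport_iff circ by metis
  qed
  have cr: "crosses D' (transport p) (transport q) \<and> level D' (transport p) = Under \<and> level D' (transport q) = Over \<longleftrightarrow>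
      crosses D p q \<and> level D p = Under \<and> level D q = Over" if "p \<in> circles D" "q \<in> circles D" for p q
  proof (cases "crosses D p q")
    case True
    then have "p \<in> double_points D" "q \<in> double_points D"
      unfolding double_points_def crosses_def by (blast, metis (mono_tags, lifting) mem_Collect_eq)
    then show ?thesis
      using that crosses_transport_iff level_transport by simp
  qed (use that crosses_transport_iff in simp)
  have ok: "crossing_ok X D' G (transport p) (transport q) \<longleftrightarrow> crossing_ok X D F p q" if c: "crosses D p q" for p q
  proof -
    have "crosses D q p"
      using c by (auto simp: crosses_def)
    then show ?thesis
      using leaves_right_transport c germs crosses_in_circles[OF c] by (simp add: crossing_ok_def)
  qed
  have 3: "(\<forall>p' q'. crosses D' p' q' \<and> level D' p' = Under \<and> level D' q' = Over \<longrightarrow> crossing_ok X D' G p' q') \<longleftrightarrow>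
      (\<forall>p q. crosses D p q \<and> level D p = Under \<and> level D q = Over \<longrightarrow> crossing_ok X D F p q)"
  proof (intro iffI allI impI)
    fix p q assume *: "\<forall>p' q'. crosses D' p' q' \<and> level D' p' = Under \<and> level D' q' = Over \<longrightarrow> crossing_ok X D' G p' q'"
      and c: "crosses D p q \<and> level D p = Under \<and> level D q = Over"
    then show "crossing_ok X D F p q"
      using cr ok crosses_in_circles by blast
  next
    fix p' q' assume *: "\<forall>p q. crosses D p q \<and> level D p = Under \<and> level D q = Over \<longrightarrow> crossing_ok X D F p q"
      and c: "crosses D' p' q' \<and> level D' p' = Under \<and> level D' q' = Over"
    then obtain p q where pq: "p \<in> circles D" "q \<in> circles D" "p' = transport p" "q' = transport q"
      using transport_surj crosses_in_circles by metis
    then have "crosses D p q \<and> level D p = Under \<and> level D q = Over"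
      using cr c by blast
    then show "crossing_ok X D' G p' q'"
      using * ok pq by blast
  qed
  show ?thesis
    unfolding point_colorings_def mem_Collect_eq 1 2 3 ..
qed

lemma link_barcode_eq:
  assumes "is_filtration m S (biquandle_End X)" "finite (carrier X)"
  shows "link_barcode N X m S D = link_barcode N X m S D'"
proof (rule link_barcode_eqI[OF assms vld, of "regular_points D" transport])
  have circ: "p \<in> circles D" if "p \<in> regular_points D" for p
    using that by (simp add: regular_points_def)
  have ext: "F \<in> extensional (regular_points E)" if "F \<in> point_colorings X E" for F E
    using that by (simp add: point_colorings_def PiE_def)
  show "transport ` regular_points D \<subseteq> regular_points D'"
    using regular_transport_iff circ by blast
  have surj: "\<exists>p\<in>regular_points D. q = transport p" if "q \<in> regular_points D'" for q
  proof -
    have "q \<in> circles D'"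
      using that by (simp add: regular_points_def)
    then obtain p where "p \<in> circles D" "q = transport p"
      using transport_surj by blast
    then show ?thesis
      using regular_transport_iff that by blast
  qed
  show "F = G" if "F \<in> point_colorings X D" "G \<in> point_colorings X D" "\<forall>z\<in>regular_points D. F z = G z" for F G
    using extensionalityI[OF ext[OF that(1)] ext[OF that(2)]] that(3) by blast
  show "F = G" if "F \<in> point_colorings X D'" "G \<in> point_colorings X D'" "\<forall>z\<in>regular_points D. F (transport z) = G (transport z)" for F G
    using extensionalityI[OF ext[OF that(1)] ext[OF that(2)]] that(3) surj by metis
  show "\<exists>G\<in>point_colorings X D'. \<forall>z\<in>regular_points D. F z = G (transport z)" if F: "F \<in> point_colorings X D" for F
  proof -
    define G where "G = (\<lambda>q\<in>regular_points D'. F (inv_into (circles D) transport q))"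
    have G: "G (transport p) = F p" if "p \<in> regular_points D" for p
      using that circ[OF that] regular_transport_iff bij_transport by (simp add: G_def bij_betw_def)
    then have "G \<in> point_colorings X D'"
      using point_colorings_transport_iff[of G F X] F ext by (simp add: G_def)
    then show ?thesis
      using G by (intro bexI[of _ G]) simp_all
  qed
  show "\<exists>F\<in>point_colorings X D. \<forall>z\<in>regular_points D. F z = G (transport z)" if G: "G \<in> point_colorings X D'" for G
  proof -
    define F where "F = (\<lambda>p\<in>regular_points D. G (transport p))"
    have "F \<in> point_colorings X D"
      using point_colorings_transport_iff[of G F X] G ext by (simp add: F_def)
    then show ?thesis
      by (intro bexI[of _ F]) (simp_all add: F_def)
  qed
qed simp

end

section \<open>Invariance under planar isotopy and under each move\<close>

lemma planar_isotopic_link_barcode: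
  assumes "planar_isotopic D D'" "is_filtration m S (biquandle_End X)" "finite (carrier X)"
  shows "link_barcode N X m S D = link_barcode N X m S D'"
proof -
  obtain H \<sigma> \<psi> where H: "ambient_isotopy H" and \<sigma>: "bij_betw \<sigma> {..<ncomp D} {..<ncomp D}"
    and \<psi>: "\<forall>k<ncomp D. circle_reparam (\<psi> k) \<and>
           (\<forall>t. point D' (\<sigma> k, cis (\<psi> k t)) = H 1 (point D (k, cis t)) \<and>
                ((k, cis t) \<in> double_points D \<longrightarrow> level D' (\<sigma> k, cis (\<psi> k t)) = level D (k, cis t)))"
    using assms(1) unfolding planar_isotopic_def by blast
  obtain h' where h': "\<And>z. (H 1 has_derivative h' z) (at z) \<and> det2 (h' z 1) (h' z \<i>) > 0"
    using ambient_isotopy_derivative[OF H] by blast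
  have "bij (H 1)"
    using H by (auto simp: ambient_isotopy_def)
  then interpret diagram_isotopy D D' "H 1" h' \<sigma> \<psi>
    using assms(1) \<sigma> \<psi> h' by unfold_locales (auto simp: planar_isotopic_def bij_def)
  show ?thesis
    by (rule link_barcode_eq[OF assms(2,3)])
qed

text \<open>Reduces a move to the assumption \<open>ext\<close>, which concerns the two standard
  pictures alone, for every choice of directions and every admissible choice of levels.
  \<open>M\<close> constrains levels only where distinct strands cross, which leaves the sign of a
  kink free.\<close>

lemma local_move_link_barcode:
  assumes move: "local_move T T' M D D'"
    and V: "\<And>i t. i < length T \<Longrightarrow> ((T ! i) has_vector_derivative strand_velocity T i t) (at t)"
      "\<And>i t. i < length T' \<Longrightarrow> ((T' ! i) has_vector_derivative strand_velocity T' i t) (at t)"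
    and conf: "confined r T" "confined r T'"
    and ext: "\<And>pos lev lev'. \<lbrakk>valid_levels T lev; valid_levels T' lev';
        \<forall>i s j t. strand_crosses T i s j t \<and> i \<noteq> j \<longrightarrow> lev i s = M i j;
        \<forall>i s j t. strand_crosses T' i s j t \<and> i \<noteq> j \<longrightarrow> lev' i s = M i j\<rbrakk> \<Longrightarrow>
      tangle_extends X r pos T (strand_velocity T) lev T' (strand_velocity T') lev' \<and>
      tangle_extends X r pos T' (strand_velocity T') lev' T (strand_velocity T) lev"
    and "is_filtration m S (biquandle_End X)" "finite (carrier X)"
  shows "link_barcode N X m S D = link_barcode N X m S D'"
proof -
  obtain h e where h: "oriented_plane_diffeo h" and arc: "\<forall>i<length T. circle_arc D (e i)"
    and dis: "disjoint_family_on (\<lambda>i. e i ` {-1..1}) {..<length T}"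
    and pic: "shows_picture D h e T M" "shows_picture D' h e T' M"
    and out: "\<forall>p \<in> circles D - (\<Union>i<length T. e i ` {-1..1}).
           point D' p = point D p \<and> (p \<in> double_points D \<longrightarrow> level D' p = level D p)"
    using move unfolding local_move_def by blast
  have D: "virtual_link_diagram D" "virtual_link_diagram D'" "ncomp D' = ncomp D" "length T' = length T"
    using move unfolding local_move_def by simp_all
  obtain h' where h': "\<And>z. (h has_derivative h' z) (at z) \<and> det2 (h' z 1) (h' z \<i>) > 0"
    using h unfolding oriented_plane_diffeo_def by blast
  have "\<forall>i. \<exists>k \<theta> \<theta>'. i < length T \<longrightarrow> k < ncomp D \<and> continuous_on {-1..1} \<theta>' \<and>
     (\<forall>t\<in>{-1..1}. (\<theta> has_real_derivative \<theta>' t) (at t within {-1..1}) \<and> \<theta>' t \<noteq> 0) \<and>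
     \<bar>\<theta> 1 - \<theta> (-1)\<bar> < 2 * pi \<and> (\<forall>t\<in>{-1..1}. e i t = (k, cis (\<theta> t)))"
    using arc unfolding circle_arc_def by blast
  then obtain \<kappa> \<theta> \<theta>' where \<theta>: "\<And>i. i < length T \<Longrightarrow> \<kappa> i < ncomp D \<and> continuous_on {-1..1} (\<theta>' i) \<and>
     (\<forall>t\<in>{-1..1}. (\<theta> i has_real_derivative \<theta>' i t) (at t within {-1..1}) \<and> \<theta>' i t \<noteq> 0) \<and>
     \<bar>\<theta> i 1 - \<theta> i (-1)\<bar> < 2 * pi \<and> (\<forall>t\<in>{-1..1}. e i t = (\<kappa> i, cis (\<theta> i t)))"
    by metis
  have inj: "inj h"
    using h by (simp add: oriented_plane_diffeo_def bij_def)
  interpret P: local_picture D h h' e \<kappa> \<theta> \<theta>' T "strand_velocity T"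
    by unfold_locales (use D inj h' \<theta> dis V(1) pic(1) in \<open>simp_all add: shows_picture_def\<close>)
  interpret P': local_picture D' h h' e \<kappa> \<theta> \<theta>' T' "strand_velocity T'"
    by unfold_locales (use D inj h' \<theta> dis V(2) pic(2) in \<open>simp_all add: shows_picture_def\<close>)
  interpret picture_pair D D' h h' e \<kappa> \<theta> \<theta>' T T' "strand_velocity T" "strand_velocity T'"
    by unfold_locales (use D out in \<open>simp_all add: P.arcs_upto_def\<close>)
  have "\<forall>i s j t. strand_crosses T i s j t \<and> i \<noteq> j \<longrightarrow> P.lev i s = M i j"
    using pic(1) unfolding shows_picture_def strand_crosses_def P.lev_def by blast
  moreover have "\<forall>i s j t. strand_crosses T' i s j t \<and> i \<noteq> j \<longrightarrow> P'.lev i s = M i j"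
    using pic(2) unfolding shows_picture_def strand_crosses_def P'.lev_def by blast
  moreover have "valid_levels T P.lev" "valid_levels T' P'.lev"
    using P.lev_cases P'.lev_cases unfolding valid_levels_def by blast+
  ultimately have "tangle_extends X r P.pos T (strand_velocity T) P.lev T' (strand_velocity T') P'.lev \<and>
      tangle_extends X r P.pos T' (strand_velocity T') P'.lev T (strand_velocity T) P.lev"
    by (intro ext)
  then show ?thesis
    using link_barcode_eq[OF conf] assms(7,8) by blast
qed

lemma strand_velocity_works:
  "((T ! i) has_vector_derivative v) (at t) \<Longrightarrow> ((T ! i) has_vector_derivative strand_velocity T i t) (at t)"
  unfolding strand_velocity_def using vector_derivative_at by metis

lemma R_strand_velocity:
  "i < length R1_straight \<Longrightarrow> ((R1_straight ! i) has_vector_derivative strand_velocity R1_straight i t) (at t)"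
  "i < length R1_kink \<Longrightarrow> ((R1_kink ! i) has_vector_derivative strand_velocity R1_kink i t) (at t)"
  "i < length R2_apart \<Longrightarrow> ((R2_apart ! i) has_vector_derivative strand_velocity R2_apart i t) (at t)"
  "i < length R2_overlap \<Longrightarrow> ((R2_overlap ! i) has_vector_derivative strand_velocity R2_overlap i t) (at t)"
  "i < length R3_above \<Longrightarrow> ((R3_above ! i) has_vector_derivative strand_velocity R3_above i t) (at t)"
  "i < length R3_below \<Longrightarrow> ((R3_below ! i) has_vector_derivative strand_velocity R3_below i t) (at t)"
  unfolding length_R less_one less_2_iff less_3_iff
  using R1_straight_derivative R1_kink_derivative R2_derivative R3_derivative
  by (blast intro: strand_velocity_works)+

lemma reidemeister_move_link_barcode:
  assumes "reidemeister_move D D'" "biquandle X" "is_filtration m S (biquandle_End X)" "finite (carrier X)"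
  shows "link_barcode N X m S D = link_barcode N X m S D'"
proof -
  interpret biquandle X by fact
  note filt = assms(3,4)
  have R3_lev: "lev i s = M i j" if "\<forall>i s j t. strand_crosses R3_above i s j t \<and> i \<noteq> j \<longrightarrow> lev i s = M i j"
      "strand_crosses R3_above i s j t" for lev M i s j t
    using that by (auto simp: R3_crosses)
  have R3_lev': "lev i s = M i j" if "\<forall>i s j t. strand_crosses R3_below i s j t \<and> i \<noteq> j \<longrightarrow> lev i s = M i j"
      "strand_crosses R3_below i s j t" for lev M i s j t
    using that by (auto simp: R3_crosses)
  \<comment> \<open>Assumes nothing about the crossing of strands 0 and 1, so that it applies to the
    mixed and to the purely virtual move.\<close>
  have mixed: "link_barcode N X m S D = link_barcode N X m S D'"
    if "local_move R3_above R3_below M D D'" "M 0 2 = Virtual" "M 2 0 = Virtual" "M 1 2 = Virtual" "M 2 1 = Virtual" for M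
  proof (rule local_move_link_barcode[OF that(1) R_strand_velocity(5,6) confined_R(5,6) _ filt])
    fix pos lev lev'
    assume vl: "valid_levels R3_above lev" "valid_levels R3_below lev'"
      and lev: "\<forall>i s j t. strand_crosses R3_above i s j t \<and> i \<noteq> j \<longrightarrow> lev i s = M i j"
        "\<forall>i s j t. strand_crosses R3_below i s j t \<and> i \<noteq> j \<longrightarrow> lev' i s = M i j"
    show "tangle_extends X R3_cut pos R3_above (strand_velocity R3_above) lev R3_below (strand_velocity R3_below) lev' \<and>
      tangle_extends X R3_cut pos R3_below (strand_velocity R3_below) lev' R3_above (strand_velocity R3_above) lev"
      by (intro conjI R3_extends_mixed[of lev lev' M]) (use vl that(2-) R3_lev[OF lev(1)] R3_lev'[OF lev(2)] in auto)
  qed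
  show ?thesis
    using assms(1)
  proof cases
    case (R1 M)
    show ?thesis
    proof (rule local_move_link_barcode[OF R1 R_strand_velocity(1,2) confined_R(1,2) _ filt])
      fix pos lev lev'
      assume vl: "valid_levels R1_kink lev'"
      show "tangle_extends X kink_cut pos R1_straight (strand_velocity R1_straight) lev R1_kink (strand_velocity R1_kink) lev' \<and>
        tangle_extends X kink_cut pos R1_kink (strand_velocity R1_kink) lev' R1_straight (strand_velocity R1_straight) lev"
        by (intro conjI R1_extends[OF assms(4) vl])
    qed
  next
    case (R2 M)
    show ?thesis
    proof (rule local_move_link_barcode[OF R2 R_strand_velocity(3,4) confined_R(3,4) _ filt])
      fix pos lev lev'
      assume vl: "valid_levels R2_overlap lev'"
        and lev: "\<forall>i s j t. strand_crosses R2_overlap i s j t \<and> i \<noteq> j \<longrightarrow> lev' i s = M i j"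
      have c: "strand_crosses R2_overlap 0 s 1 s" "strand_crosses R2_overlap 1 s 0 s" if "\<bar>s\<bar> = kink_cut" for s
        using that by (simp_all add: R2_overlap_crosses)
      have "lev' 0 s = M 0 1 \<and> lev' 1 s = M 1 0" if "\<bar>s\<bar> = kink_cut" for s
        using lev c[OF that] by auto
      then have "lev' 0 (- kink_cut) = lev' 0 kink_cut" "lev' 1 (- kink_cut) = lev' 1 kink_cut"
        using kink_cut_bounds by simp_all
      then show "tangle_extends X kink_cut pos R2_apart (strand_velocity R2_apart) lev R2_overlap (strand_velocity R2_overlap) lev' \<and>
        tangle_extends X kink_cut pos R2_overlap (strand_velocity R2_overlap) lev' R2_apart (strand_velocity R2_apart) lev"
        using R2_extends[OF vl] by blast
    qed
  next
    case (R3_classical M)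
    show ?thesis
    proof (rule local_move_link_barcode[OF R3_classical(1) R_strand_velocity(5,6) confined_R(5,6) _ filt])
      fix pos lev lev'
      assume vl: "valid_levels R3_above lev" "valid_levels R3_below lev'"
        and lev: "\<forall>i s j t. strand_crosses R3_above i s j t \<and> i \<noteq> j \<longrightarrow> lev i s = M i j"
          "\<forall>i s j t. strand_crosses R3_below i s j t \<and> i \<noteq> j \<longrightarrow> lev' i s = M i j"
      have "\<forall>i s j t. strand_crosses R3_above i s j t \<longrightarrow> lev i s = M i j"
        "\<forall>i s j t. strand_crosses R3_below i s j t \<longrightarrow> lev' i s = M i j"
        using R3_lev[OF lev(1)] R3_lev'[OF lev(2)] by blast+
      then show "tangle_extends X R3_cut pos R3_above (strand_velocity R3_above) lev R3_below (strand_velocity R3_below) lev' \<and>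
        tangle_extends X R3_cut pos R3_below (strand_velocity R3_below) lev' R3_above (strand_velocity R3_above) lev"
        using R3_extends[OF R3_classical(2) vl] by blast
    qed
  next
    case (R3_virtual M)
    then show ?thesis
      by (intro mixed[of M]) (simp_all add: all_virtual_def)
  next
    case (R3_mixed M)
    then show ?thesis
      by (intro mixed[of M]) (simp_all add: mixed_def)
  qed
qed

theorem corollary3p3p1:
  fixes X :: "('a, 'm) biquandle_ops_scheme"
    and S :: "nat \<Rightarrow> ('a \<Rightarrow> 'a) set"
    and m N :: nat
    and L\<^sub>1 L\<^sub>2 :: diagram
  assumes "biquandle X" and "finite (carrier X)"
    and "is_filtration m S (biquandle_End X)" and "S 0 = {}"
    and "1 \<le> N"
    and "virtual_link_diagram L\<^sub>1" and "virtual_link_diagram L\<^sub>2"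
    and "virtually_equivalent L\<^sub>1 L\<^sub>2"
  shows "link_barcode N X m S L\<^sub>1 = link_barcode N X m S L\<^sub>2"
proof -
  have step: "link_barcode N X m S D = link_barcode N X m S D'"
    if "planar_isotopic D D' \<or> reidemeister_move D D'" for D D'
    using that planar_isotopic_link_barcode reidemeister_move_link_barcode assms(1-3) by metis
  have "equivclp (\<lambda>D D'. planar_isotopic D D' \<or> reidemeister_move D D') L\<^sub>1 L\<^sub>2"
    using assms(8) by (simp add: virtually_equivalent_def)
  then show ?thesis
    \<comment> \<open>An equivalence is a chain of moves in either direction; an equality of
      barcodes can be read both ways.\<close>
    by (induction rule: equivclp_induct) (use step in metis)+
qed

end
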